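(* Let $L$ be a finite extension of $K_\infty$ and $r\ge2$. For every $N\in\mathbb{N}$ there exists a Drinfeld $A$-module $\phi$ of rank $r$ over $L$ whose field of periods $L(\Lambda)$ (which equals the torsion field $L(\mathrm{tor}(\phi))$) has ramification index $e(L(\Lambda)|L)\ge N$. In particular, the degree $[L(\Lambda):L]$ is unbounded as $\phi$ ranges over Drinfeld $A$-modules of rank $r$ over $L$.
   Context: Let $\mathbb{F}=\mathbb{F}_q$, $A=\mathbb{F}[T]$, $K_\infty=\mathbb{F}((T^{-1}))$ with absolute value normalized by $|T|=q$, and $C$ the completion of an algebraic closure of $K_\infty$; $L\subset C$. A Drinfeld $A$-module $\phi$ of rank $r$ over $L$ is given by $\phi_T(X)=TX+g_1X^q+\dots+g_rX^{q^r}$ with $g_i\in L$, $g_r\ne0$; its period lattice $\Lambda\subset C$ is the discrete free $A$-submodule of rank $r$ with $e_\Lambda(Tz)=\phi_T(e_\Lambda(z))$ for all $z\in C$, where $e_\Lambda(z)=z\prod_{0\ne\lambda\in\Lambda}(1-z/\lambda)$. $\mathrm{tor}(\phi)$ denotes the set of $x\in C$ with $\phi_a(x)=0$ for some $0\ne a\in A$. $L(\Lambda)$ is a finite Galois extension of $L$ and $e(\cdot|\cdot)$ denotes ramification index. *)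

theory Defs
  imports "HOL-Analysis.Analysis" "HOL-Algebra.Algebra" "HOL-Algebra.Algebraic_Closure_Type"
begin

text \<open>
  The finite field \<open>F\<close> with \<open>q\<close> elements is a type \<open>'k\<close>, so \<open>q = CARD('k)\<close>, and \<open>A = F[T]\<close> is
  \<open>'k poly\<close>. The field \<open>F((1/T))\<close> is \<open>'k fls\<close> with the library's variable in the role of \<open>1/T\<close>;
  hence \<open>T\<close> is \<open>fls_X_inv\<close>. The type \<open>'c\<close> is a completion of \<open>'k fls alg_closure\<close>, and all
  subfields of \<open>'c\<close> (such as the finite extensions of \<open>F((1/T))\<close>) are sets of elements of \<open>'c\<close>.
\<close>

definition absv :: "'c::{field,complete_space} \<Rightarrow> real" where
  "absv x = dist x 0"

text \<open>
  Here \<open>j\<close> is the inclusion of the algebraic closure into its completion. That \<open>'c\<close> is complete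
  is part of its sort. The assumption \<open>absv_Kinf\<close> includes the normalisation \<open>|T| = q\<close>.
\<close>

locale completed_alg_closure =
  fixes j :: "'k::{field,finite} fls alg_closure \<Rightarrow> 'c::{field,complete_space}"
  assumes hom: "j \<in> ring_hom ring_of_type_algebra ring_of_type_algebra"
    and dist_absv: "\<And>x y :: 'c. dist x y = absv (x - y)"
    and absv_mult: "\<And>x y :: 'c. absv (x * y) = absv x * absv y"
    and absv_add: "\<And>x y :: 'c. absv (x + y) \<le> max (absv x) (absv y)"
    and absv_Kinf: "\<And>f :: 'k fls. f \<noteq> 0 \<Longrightarrow>
      absv (j (to_ac f)) = real CARD('k) powi (- fls_subdegree f)"
    and dense: "closure (range j) = UNIV"

definition emb_K :: "('k::{field,finite} fls alg_closure \<Rightarrow> 'c) \<Rightarrow> 'k fls \<Rightarrow> 'c" where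
  "emb_K j f = j (to_ac f)"

definition K_inf :: "('k::{field,finite} fls alg_closure \<Rightarrow> 'c) \<Rightarrow> 'c set" where
  "K_inf j = range (emb_K j)"

definition emb_A :: "('k::{field,finite} fls alg_closure \<Rightarrow> 'c) \<Rightarrow> 'k poly \<Rightarrow> 'c" where
  "emb_A j a = emb_K j (poly (map_poly fls_const a) fls_X_inv)"

definition finite_extension :: "'c::field set \<Rightarrow> 'c set \<Rightarrow> bool" where
  "finite_extension K M \<longleftrightarrow>
     subfield K ring_of_type_algebra \<and> subfield M ring_of_type_algebra \<and> K \<subseteq> M \<and>
     ring.finite_dimension ring_of_type_algebra K M"

definition ext_degree :: "'c::field set \<Rightarrow> 'c set \<Rightarrow> nat" where
  "ext_degree K M = ring.dim ring_of_type_algebra K M"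

definition adjoin :: "'c::field set \<Rightarrow> 'c set \<Rightarrow> 'c set" where
  "adjoin K S = generate_field ring_of_type_algebra (K \<union> S)"

text \<open>The ramification index is the index of \<open>|K\<^sup>*|\<close> in \<open>|M\<^sup>*|\<close>.\<close>

definition value_group :: "'c::{field,complete_space} set \<Rightarrow> real monoid" where
  "value_group M = \<lparr>carrier = absv ` (M - {0}), monoid.mult = (*), one = 1\<rparr>"

definition ramification_index :: "'c::{field,complete_space} set \<Rightarrow> 'c set \<Rightarrow> nat" where
  "ramification_index K M = card (rcosets\<^bsub>value_group M\<^esub> (carrier (value_group K)))"

text \<open>A Drinfeld module is represented by the polynomial \<open>P = \<phi>\<^sub>T(X)\<close>.\<close>

definition drinfeld_module ::
    "('k::{field,finite} fls alg_closure \<Rightarrow> 'c::field) \<Rightarrow> 'c set \<Rightarrow> nat \<Rightarrow> 'c poly \<Rightarrow> bool" where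
  "drinfeld_module j L r P \<longleftrightarrow>
     (\<exists>g. (\<forall>i\<in>{1..r}. g i \<in> L) \<and> g r \<noteq> 0 \<and>
          P = Polynomial.monom (emb_A j [:0, 1:]) 1 +
            (\<Sum>i=1..r. Polynomial.monom (g i) (CARD('k) ^ i)))"

text \<open>
  The polynomial \<open>\<phi>\<^sub>a(X)\<close>: if \<open>a\<close> has coefficients \<open>a\<^sub>i\<close>, then \<open>\<phi>\<^sub>a\<close> is the sum of \<open>a\<^sub>i\<close> times
  the \<open>i\<close>-fold composition power of \<open>\<phi>\<^sub>T\<close>.
\<close>

definition drinfeld_poly ::
    "('k::{field,finite} fls alg_closure \<Rightarrow> 'c::field) \<Rightarrow> 'c poly \<Rightarrow> 'k poly \<Rightarrow> 'c poly" where
  "drinfeld_poly j P a =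
     (\<Sum>i\<le>Polynomial.degree a.
        Polynomial.smult (emb_A j [:Polynomial.coeff a i:]) ((pcompose P ^^ i) [:0, 1:]))"

definition torsion ::
    "('k::{field,finite} fls alg_closure \<Rightarrow> 'c::field) \<Rightarrow> 'c poly \<Rightarrow> 'c set" where
  "torsion j P = {x. \<exists>a. a \<noteq> 0 \<and> poly (drinfeld_poly j P a) x = 0}"

definition free_A_submodule ::
    "('k::{field,finite} fls alg_closure \<Rightarrow> 'c::field) \<Rightarrow> nat \<Rightarrow> 'c set \<Rightarrow> bool" where
  "free_A_submodule j r \<Lambda> \<longleftrightarrow>
     (\<exists>b :: nat \<Rightarrow> 'c.
        \<Lambda> = range (\<lambda>a :: nat \<Rightarrow> 'k poly. \<Sum>i<r. emb_A j (a i) * b i) \<and>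
        (\<forall>a :: nat \<Rightarrow> 'k poly. (\<Sum>i<r. emb_A j (a i) * b i) = 0 \<longrightarrow> (\<forall>i<r. a i = 0)))"

text \<open>
  The product is the unordered one, i.e. the limit over the finite subsets of \<open>\<Lambda> - {0}\<close>. It
  converges for a discrete \<open>\<Lambda>\<close> that is free of finite rank, since such a \<open>\<Lambda>\<close> meets every ball in
  a finite set.
\<close>

definition lattice_exp :: "'c::{field,complete_space} set \<Rightarrow> 'c \<Rightarrow> 'c" where
  "lattice_exp \<Lambda> z = z * Lim (finite_subsets_at_top (\<Lambda> - {0})) (\<lambda>F. \<Prod>\<mu>\<in>F. 1 - z / \<mu>)"

definition period_lattice ::
    "('k::{field,finite} fls alg_closure \<Rightarrow> 'c::{field,complete_space}) \<Rightarrow> nat \<Rightarrow> 'c poly \<Rightarrow>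
      'c set \<Rightarrow> bool" where
  "period_lattice j r P \<Lambda> \<longleftrightarrow>
     free_A_submodule j r \<Lambda> \<and> discrete \<Lambda> \<and>
     (\<forall>z. lattice_exp \<Lambda> (emb_A j [:0, 1:] * z) = poly P (lattice_exp \<Lambda> z))"

end

theory Submission
  imports Defs
begin

text \<open>
  No Galois theory is needed. Write \<open>q = |F|\<close> and \<open>e\<^sub>n(X) = \<Prod> (X - a)\<close>, the product over all \<open>a \<in> A\<close> of
  degree less than \<open>n\<close>. Choose \<open>c \<in> L\<close> of large absolute value such that \<open>|c|\<close> is not a \<open>p\<close>-th power
  in \<open>|L\<^sup>*|\<close>, and solve \<open>e\<^sub>n(w) = c\<close>. Then \<open>|w|\<close> to the power \<open>q\<^sup>n\<close> is \<open>|c|\<close>, so \<open>|w|\<close> has order exactly \<open>q\<^sup>n\<close>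
  modulo \<open>|L\<^sup>*|\<close>. Taking one such \<open>w\<^sub>i\<close> for each of \<open>r - 1\<close> different large values of \<open>n\<close>, the elements
  \<open>1, w\<^sub>1, \<dots>, w\<^bsub>r-1\<^esub>\<close> have absolute values in different classes modulo \<open>|L\<^sup>*|\<close>. Hence they are an
  orthogonal basis of a lattice \<open>\<Lambda>\<close>, and \<open>L(\<Lambda>)\<close> is highly ramified over \<open>L\<close>.

  The Drinfeld module of \<open>\<Lambda>\<close> is defined over \<open>L\<close>: since \<open>e\<^sub>m(a w\<^sub>i) \<in> L\<close> for all large \<open>m\<close>, grouping the
  product for \<open>e\<^sub>\<Lambda>\<close> by cosets of \<open>A\<close> gives \<open>e\<^sub>\<Lambda>(z) \<in> L\<close> for all \<open>z \<in> L\<close>; as \<open>\<phi>\<^sub>T\<close> maps \<open>e\<^sub>\<Lambda>(z)\<close> to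
  \<open>e\<^sub>\<Lambda>(T z)\<close>, interpolation at infinitely many of these points shows that its coefficients lie in \<open>L\<close>.
  Torsion points are limits of expressions in periods, and each period \<open>v\<close> is the limit of
  \<open>T\<^sup>m e\<^sub>\<Lambda>(v / T\<^sup>m)\<close>, so the two fields agree because finite extensions of \<open>L\<close> are closed.
\<close>

subsection \<open>Finite fields, polynomials of bounded degree, powers in groups\<close>

text \<open>The equation \<open>e_n(w) = c\<close> is suggested by Galois theory: \<open>e_n\<close>
  is additive and vanishes exactly at the polynomials of degree < n, so all roots of
  \<open>e_n(X) - c\<close> have the form w + a with a in A. Conjugation over L therefore keeps the
  lattice stable, which is the reason to expect its Drinfeld module to descend to L. The proof uses
  an analytic counterpart: the product of 1 - z/\<mu> over a coset w + V of a finite space V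
  involves w only through the value at w of the additive polynomial of V. When V consists of the
  polynomials up to a large degree, this value lies in L even though w does not.

  Both conditions on c are about |w|. Its size forces |w| > |a| for all a of degree < n, so that
  every factor w - a has absolute value |w|; that |c| is not a p-th power gives |w| the full order
  q^n modulo the values of L. A single c serves all the w_i. The exponents are n = N + i, where N is
  the required ramification: the orders are then different, and all of them exceed N.\<close>

lemma finite_field_power_card_minus_1:
  fixes a :: "'k::{field,finite}"
  assumes "a \<noteq> 0"
  shows "a ^ (CARD('k) - 1) = 1"
proof -
  let ?S = "UNIV - {0::'k}"
  have inj: "inj_on ((*) a) ?S" using assms by (auto intro: inj_onI)
  moreover have "(*) a ` ?S = ?S"
  proof (rule card_subset_eq)
    show "(*) a ` ?S \<subseteq> ?S" using assms by auto
  qed (auto simp: card_image inj)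
  ultimately have "(\<Prod>x\<in>?S. x) = (\<Prod>x\<in>?S. a * x)"
    using prod.reindex[OF inj, of "\<lambda>x. x"] by simp
  also have "\<dots> = a ^ (CARD('k) - 1) * (\<Prod>x\<in>?S. x)"
    by (simp add: prod.distrib card_Diff_singleton)
  finally show ?thesis by simp
qed

lemma finite_field_power_card:
  fixes a :: "'k::{field,finite}"
  shows "a ^ CARD('k) = a"
proof (cases "a = 0")
  case False
  have "a ^ CARD('k) = a * a ^ (CARD('k) - 1)"
    by (metis Suc_diff_1 power_Suc zero_less_card_finite)
  then show ?thesis using finite_field_power_card_minus_1[OF False] by simp
qed (simp add: zero_power)

text \<open>By Sylow's theorem a prime l dividing q gives a subgroup of order l in the additive
  group; its nonzero elements are annihilated by l, so l is the characteristic p. This makes x ->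
  x^q additive on C, and turns q^n into a power of p when orders are computed.\<close>

lemma CARD_eq_CHAR_power: "\<exists>e. CARD('k::{field,finite}) = CHAR('k) ^ e"
proof -
  let ?p = "CHAR('k)" and ?q = "CARD('k)"
  have pp: "normalization_semidom_class.prime ?p" by (rule prime_CHAR_semidom) (simp add: finite_imp_CHAR_pos)
  have "l = ?p" if l: "normalization_semidom_class.prime l" "l dvd ?q" for l :: nat
  proof (rule ccontr)
    assume ne: "l \<noteq> ?p"
    let ?G = "add_monoid (ring_of_type_algebra :: 'k ring)"
    interpret R: Ring.field "ring_of_type_algebra :: 'k ring" by (rule field_from_type_algebra)
    have car: "carrier ?G = UNIV" by (simp add: ring_of_type_algebra_def)
    obtain H where H: "subgroup H ?G" "card H = l ^ 1"
      using sylow_thm[of l ?G 1 "?q div l"] l R.add.is_group car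
      by (auto simp: order_def)
    have "H \<noteq> {0}" using H(2) prime_gt_1_nat[OF l(1)] by auto
    moreover have "0 \<in> H" using subgroup.one_closed[OF H(1)] by (simp add: ring_of_type_algebra_def)
    ultimately obtain x where x: "x \<in> H" "x \<noteq> 0" by auto
    let ?GH = "?G\<lparr>carrier := H\<rparr>"
    interpret GH: group ?GH using subgroup.subgroup_is_group[OF H(1) R.add.is_group] .
    have pw: "x [^]\<^bsub>?GH\<^esub> (n::nat) = of_nat n * x" for n
      by (induction n) (simp_all add: ring_of_type_algebra_def algebra_simps nat_pow_def)
    have "x [^]\<^bsub>?GH\<^esub> (order ?GH) = \<one>\<^bsub>?GH\<^esub>"
      by (rule GH.pow_order_eq_1) (simp add: x)
    hence "of_nat l * x = 0" using pw[of l] H(2) by (simp add: order_def ring_of_type_algebra_def)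
    hence "(of_nat l :: 'k) = 0" using x by simp
    hence "?p dvd l" using of_nat_eq_0_iff_char_dvd by blast
    thus False using primes_dvd_imp_eq[OF pp l(1)] ne by simp
  qed
  hence "prime_factors ?q \<subseteq> {?p}" by (auto simp: in_prime_factors_iff)
  hence "\<exists>n. ?q = ?p ^ n"
  proof -
    have "?q = (\<Prod>x\<in>prime_factors ?q. x ^ multiplicity x ?q)"
      by (simp add: prime_factorization_nat)
    also have "\<dots> = (\<Prod>x\<in>{?p}. x ^ multiplicity x ?q)"
      using \<open>prime_factors ?q \<subseteq> {?p}\<close>
      by (intro prod.mono_neutral_left) (auto simp: prime_factors_multiplicity  pp not_dvd_imp_multiplicity_0 in_prime_factors_iff)
    finally show ?thesis by auto
  qed
  thus ?thesis .
qed

text \<open>The condition on coefficients avoids the convention \<open>degree 0 = 0\<close>: the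
  zero polynomial belongs to the set for every n, for n = 0 it is the only element, and closure
  under addition is immediate.\<close>

definition bounded_polys :: "nat \<Rightarrow> 'a::zero poly set" where
  "bounded_polys n = {a. \<forall>k\<ge>n. Polynomial.coeff a k = 0}"

lemma bounded_polys_0: "bounded_polys 0 = {0}"
  by (auto simp: bounded_polys_def poly_eq_iff)

lemma pCons_in_bounded_polys_iff [simp]: "pCons s a \<in> bounded_polys (Suc n) \<longleftrightarrow> a \<in> bounded_polys n"
  unfolding bounded_polys_def by (auto simp: coeff_pCons split: nat.splits)

lemma bounded_polys_Suc: "bounded_polys (Suc n) = (\<lambda>(s, a). pCons s a) ` (UNIV \<times> bounded_polys n)"
proof -
  have "a \<in> (\<lambda>(s, a). pCons s a) ` (UNIV \<times> bounded_polys n)" if "a \<in> bounded_polys (Suc n)" for a :: "'a poly"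
    using that by (cases a) (auto intro!: image_eqI)
  thus ?thesis by auto
qed

lemma card_bounded_polys:
  "finite (bounded_polys n :: 'a::{zero,finite} poly set) \<and> card (bounded_polys n :: 'a poly set) = CARD('a) ^ n"
proof (induction n)
  case (Suc n)
  have "inj_on (\<lambda>(s, a). pCons s a) (UNIV \<times> bounded_polys n :: ('a \<times> 'a poly) set)"
    by (auto intro!: inj_onI)
  thus ?case using Suc by (simp add: bounded_polys_Suc card_image card_cartesian_product)
qed (simp add: bounded_polys_0)

lemma finite_bounded_polys [simp]: "finite (bounded_polys n :: 'a::{zero,finite} poly set)"
  using card_bounded_polys by blast

lemma bounded_polys_iff_degree: "a \<in> bounded_polys n \<longleftrightarrow> a = 0 \<or> Polynomial.degree a < n"
proof
  assume a: "a \<in> bounded_polys n"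
  have "Polynomial.degree a < n" if "a \<noteq> 0"
  proof (rule ccontr)
    assume "\<not> Polynomial.degree a < n"
    hence "Polynomial.coeff a (Polynomial.degree a) = 0" using a by (simp add: bounded_polys_def)
    thus False using that by simp
  qed
  thus "a = 0 \<or> Polynomial.degree a < n" by blast
next
  assume "a = 0 \<or> Polynomial.degree a < n"
  thus "a \<in> bounded_polys n"
    unfolding bounded_polys_def by (elim disjE) (auto intro: coeff_eq_0)
qed

lemma zero_in_bounded_polys [simp]: "0 \<in> bounded_polys n"
  by (simp add: bounded_polys_def)

lemma bounded_polys_add: "a \<in> bounded_polys n \<Longrightarrow> b \<in> bounded_polys n \<Longrightarrow> a + b \<in> bounded_polys n"
  for a :: "'a::comm_monoid_add poly"
  by (simp add: bounded_polys_def)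

lemma bounded_polys_smult: "a \<in> bounded_polys n \<Longrightarrow> Polynomial.smult s a \<in> bounded_polys n"
  for a :: "'a::comm_semiring_0 poly"
  by (simp add: bounded_polys_def)

text \<open>Write k = p^t k' with k' prime to p and suppose t < s. Then y = x^(p^(s-1)) has both its
  p-th and its k'-th power in G, so y lies in G by Bezout, and x^(p^s) = y^p is a p-th power in G
  after all. In other words, x has order exactly p^s modulo G.\<close>

lemma prime_power_dvd_of_power_in_group:
  fixes x :: real and G :: "real set"
  assumes G: "1 \<in> G" "\<And>u v. u \<in> G \<Longrightarrow> v \<in> G \<Longrightarrow> u * v \<in> G" "\<And>u v. u \<in> G \<Longrightarrow> v \<in> G \<Longrightarrow> u / v \<in> G"
    and p: "normalization_semidom_class.prime p" and x: "x > 0" "x ^ (p ^ s) \<in> G"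
    and nonpower: "\<And>g. g \<in> G \<Longrightarrow> x ^ (p ^ s) \<noteq> g ^ p"
    and k: "x ^ k \<in> G"
  shows "p ^ s dvd k"
proof (rule ccontr)
  assume nd: "\<not> p ^ s dvd k"
  have pow: "u ^ n \<in> G" if "u \<in> G" for u n using that by (induction n) (auto intro: G)
  have "k \<noteq> 0" using nd by (intro notI) simp
  moreover have "\<not> is_unit p" using p by (simp add: prime_nat_iff)
  ultimately obtain k' where k': "k = p ^ multiplicity p k * k'" "\<not> p dvd k'"
    using multiplicity_decompose'[of k p] by blast
  define t where "t = multiplicity p k"
  have ts: "t < s"
  proof (rule ccontr)
    assume "\<not> t < s"
    hence "p ^ s dvd p ^ t" by (intro le_imp_power_dvd) simp
    hence "p ^ s dvd k" unfolding k'(1)[folded t_def] by (rule dvd_mult2)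
    thus False using nd by contradiction
  qed
  define y where "y = x ^ (p ^ (s - 1))"
  have yp: "y ^ p = x ^ (p ^ s)" using ts by (simp add: y_def flip: power_mult power_Suc2)
  have "y ^ k' = (x ^ k) ^ (p ^ (s - 1 - t))"
  proof -
    have "p ^ (s - 1) * k' = k * p ^ (s - 1 - t)"
      using ts k'(1)[folded t_def] by (simp add: mult.commute mult.left_commute flip: power_add)
    thus ?thesis by (simp add: y_def flip: power_mult)
  qed
  hence yk: "y ^ k' \<in> G" using pow[OF k] by simp
  have "coprime k' p" using prime_imp_coprime[OF p k'(2)] by (simp add: coprime_commute)
  moreover have "k' \<noteq> 0" using k'(2) by (intro notI) simp
  ultimately obtain u v where uv: "k' * u = p * v + 1"
    using bezout_nat[of k' p] by auto
  have "y ^ (k' * u) = y ^ (p * v) * y" by (simp add: uv)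
  hence "y = (y ^ k') ^ u / (y ^ p) ^ v" using x by (simp add: power_mult y_def)
  also have "\<dots> \<in> G" by (intro G(3) pow[OF yk] pow[of "y ^ p"]) (simp add: yp x)
  finally show False using nonpower[of y] yp by simp
qed

subsection \<open>The absolute value\<close>

context completed_alg_closure begin

lemma j_add: "j (x + y) = j x + j y"
  using ring_hom_add[OF hom] by (simp add: ring_of_type_algebra_def)
lemma j_mult: "j (x * y) = j x * j y"
  using ring_hom_mult[OF hom] by (simp add: ring_of_type_algebra_def)
lemma j_1 [simp]: "j 1 = 1"
  using ring_hom_one[OF hom] by (simp add: ring_of_type_algebra_def)
lemma j_0 [simp]: "j 0 = 0"
  using j_add[of 0 0] by (metis add.right_neutral add_left_cancel)
lemma j_uminus: "j (- x) = - j x"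
  using j_add[of x "-x"] by (simp add: eq_neg_iff_add_eq_0 add.commute)
lemma j_diff: "j (x - y) = j x - j y"
  using j_add[of x "-y"] by (simp add: j_uminus)
lemma j_eq_0_iff [simp]: "j x = 0 \<longleftrightarrow> x = 0"
proof
  assume "j x = 0"
  thus "x = 0" using j_mult[of x "inverse x"] by (cases "x = 0") auto
qed simp
lemma j_inverse: "j (inverse x) = inverse (j x)"
  using j_mult[of x "inverse x"] by (cases "x = 0") (auto simp: inverse_unique)

lemma emb_K_add: "emb_K j (x + y) = emb_K j x + emb_K j y"
  by (simp add: emb_K_def j_add)
lemma emb_K_diff: "emb_K j (x - y) = emb_K j x - emb_K j y"
  by (simp add: emb_K_def j_diff)
lemma emb_K_mult: "emb_K j (x * y) = emb_K j x * emb_K j y"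
  by (simp add: emb_K_def j_mult)
lemma emb_K_1 [simp]: "emb_K j 1 = 1" by (simp add: emb_K_def)
lemma emb_K_0 [simp]: "emb_K j 0 = 0" by (simp add: emb_K_def)
lemma emb_K_eq_0_iff [simp]: "emb_K j x = 0 \<longleftrightarrow> x = 0" by (simp add: emb_K_def)
lemma emb_K_inverse: "emb_K j (inverse x) = inverse (emb_K j x)" by (simp add: emb_K_def j_inverse)
lemma emb_K_uminus: "emb_K j (- x) = - emb_K j x" by (simp add: emb_K_def j_uminus)

definition sc :: "'k \<Rightarrow> 'c" where "sc s = emb_A j [:s:]"
definition TT :: 'c where "TT = emb_A j [:0, 1:]"

lemma emb_A_0 [simp]: "emb_A j 0 = 0" by (simp add: emb_A_def)

lemma sc_conv_emb_K: "sc s = emb_K j (fls_const s)"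
  by (simp add: sc_def emb_A_def map_poly_pCons)
lemma TT_conv_emb_K: "TT = emb_K j fls_X_inv"
  by (simp add: TT_def emb_A_def map_poly_pCons)

lemma emb_A_pCons: "emb_A j (pCons s a) = sc s + TT * emb_A j a"
  unfolding sc_conv_emb_K TT_conv_emb_K emb_A_def
  by (simp add: map_poly_pCons emb_K_add emb_K_mult)

lemma sc_0 [simp]: "sc 0 = 0" and sc_1 [simp]: "sc 1 = 1"
  by (simp_all add: sc_conv_emb_K)
lemma sc_add: "sc (s + t) = sc s + sc t"
  unfolding sc_conv_emb_K by (metis fls_plus_const emb_K_add)
lemma sc_mult: "sc (s * t) = sc s * sc t"
  unfolding sc_conv_emb_K by (metis fls_const_mult_const emb_K_mult)
lemma sc_eq_0_iff [simp]: "sc s = 0 \<longleftrightarrow> s = 0"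
  by (simp add: sc_conv_emb_K)
lemma sc_uminus: "sc (- s) = - sc s"
  using sc_add[of s "-s"] by (simp add: eq_neg_iff_add_eq_0 add.commute)
lemma sc_diff: "sc (s - t) = sc s - sc t"
  using sc_add[of s "-t"] by (simp add: sc_uminus)
lemma inj_sc: "inj sc"
  by (rule injI) (metis sc_diff sc_eq_0_iff right_minus_eq)
lemma sc_power: "sc (s ^ n) = sc s ^ n"
  by (induction n) (auto simp: sc_mult)
lemma sc_power_card: "sc s ^ CARD('k) = sc s"
  by (simp add: finite_field_power_card flip: sc_power)

lemma emb_A_add: "emb_A j (a + b) = emb_A j a + emb_A j b"
proof (induction a arbitrary: b)
  case (pCons s a)
  obtain t b' where "b = pCons t b'" by (cases b)
  thus ?case by (simp add: emb_A_pCons pCons.IH sc_add distrib_left)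
qed simp

lemma emb_A_smult: "emb_A j (Polynomial.smult s a) = sc s * emb_A j a"
  by (induction a) (auto simp: emb_A_pCons sc_mult algebra_simps)

lemma emb_A_mult: "emb_A j (a * b) = emb_A j a * emb_A j b"
  by (induction a) (auto simp: emb_A_pCons emb_A_add emb_A_smult algebra_simps)

lemma emb_A_1 [simp]: "emb_A j 1 = 1"
  by (simp add: one_pCons emb_A_pCons)
lemma emb_A_uminus: "emb_A j (- a) = - emb_A j a"
  using emb_A_add[of a "-a"] by (simp add: eq_neg_iff_add_eq_0 add.commute)
lemma emb_A_diff: "emb_A j (a - b) = emb_A j a - emb_A j b"
  using emb_A_add[of a "-b"] by (simp add: emb_A_uminus)
lemma emb_A_power: "emb_A j (a ^ n) = emb_A j a ^ n"
  by (induction n) (auto simp: emb_A_mult)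

lemma absv_0 [simp]: "absv (0::'c) = 0" by (simp add: absv_def)
lemma absv_nonneg [simp]: "absv (x::'c) \<ge> 0" by (simp add: absv_def)
lemma absv_eq_0_iff [simp]: "absv (x::'c) = 0 \<longleftrightarrow> x = 0" by (simp add: absv_def)
lemma absv_pos_iff [simp]: "absv (x::'c) > 0 \<longleftrightarrow> x \<noteq> 0"
  by (simp add: absv_def)
lemma absv_1 [simp]: "absv (1::'c) = 1"
  using absv_mult[of 1 1] by simp
lemma absv_uminus [simp]: "absv (- x::'c) = absv x"
proof -
  have "absv (-1::'c) * absv (-1::'c) = 1" using absv_mult[of "-1" "-1"] by simp
  hence "absv (-1::'c) = 1"
    by (metis absv_nonneg abs_of_nonneg power2_eq_1_iff power2_eq_square abs_minus_cancel abs_1)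
  thus ?thesis using absv_mult[of "-1" x] by simp
qed
lemma absv_diff_commute: "absv (x - y::'c) = absv (y - x)"
  using absv_uminus[of "x - y"] by simp
lemma absv_diff: "absv (x - y::'c) \<le> max (absv x) (absv y)"
  using absv_add[of x "-y"] by simp
lemma absv_power: "absv (x ^ n::'c) = absv x ^ n"
  by (induction n) (auto simp: absv_mult)
lemma absv_inverse: "absv (inverse x::'c) = inverse (absv x)"
  using absv_mult[of x "inverse x"] by (cases "x = 0") (auto simp: inverse_unique)
lemma absv_divide: "absv (x / y::'c) = absv x / absv y"
  by (simp add: divide_inverse absv_mult absv_inverse)
lemma absv_prod: "absv (prod f S :: 'c) = (\<Prod>x\<in>S. absv (f x))"
  by (induction S rule: infinite_finite_induct) (auto simp: absv_mult)

lemma absv_add_eq: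
  assumes "absv (x::'c) < absv y" shows "absv (x + y) = absv y"
proof (rule antisym)
  show "absv (x + y) \<le> absv y" using absv_add[of x y] assms by simp
  show "absv y \<le> absv (x + y)" using absv_diff[of "x + y" x] assms by (auto simp: max_def split: if_splits)
qed

lemma absv_diff_eq:
  assumes "absv (x::'c) < absv y" shows "absv (x - y) = absv y"
  using absv_add_eq[of x "-y"] assms by simp

text \<open>One of the nonzero terms dominates, and a new term either stays below it or replaces it.
  Zero terms are exempt from distinctness because several coordinates of a lattice vector may vanish
  at once.\<close>

lemma absv_sum_distinct:
  assumes "finite S"
    and "\<And>i k. i \<in> S \<Longrightarrow> k \<in> S \<Longrightarrow> i \<noteq> k \<Longrightarrow> f i \<noteq> 0 \<Longrightarrow> f k \<noteq> 0 \<Longrightarrow> absv (f i :: 'c) \<noteq> absv (f k)"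
  shows "(\<forall>i\<in>S. f i = 0) \<or> (\<exists>i\<in>S. f i \<noteq> 0 \<and> absv (sum f S) = absv (f i) \<and> (\<forall>k\<in>S. absv (f k) \<le> absv (f i)))"
  using assms
proof (induction S rule: finite_induct)
  case (insert x F)
  have IH: "(\<forall>i\<in>F. f i = 0) \<or> (\<exists>i\<in>F. f i \<noteq> 0 \<and> absv (sum f F) = absv (f i) \<and> (\<forall>k\<in>F. absv (f k) \<le> absv (f i)))"
    using insert by blast
  show ?case
  proof (cases "f x = 0")
    case True then show ?thesis using IH insert.hyps by auto
  next
    case nz: False
    show ?thesis
    proof (cases "\<forall>i\<in>F. f i = 0")
      case True thus ?thesis using nz insert.hyps by auto
    next
      case False
      then obtain i where i: "i \<in> F" "f i \<noteq> 0" "absv (sum f F) = absv (f i)" "\<forall>k\<in>F. absv (f k) \<le> absv (f i)"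
        using IH by blast
      have ne: "absv (f x) \<noteq> absv (f i)" using insert.prems[of x i] insert.hyps i nz by auto
      show ?thesis
      proof (cases "absv (f x) < absv (f i)")
        case True
        have "absv (sum f (insert x F)) = absv (f i)"
          using absv_add_eq[of "f x" "sum f F"] True i insert.hyps by simp
        thus ?thesis using True i by (intro disjI2 bexI[of _ i]) auto
      next
        case False
        hence lt: "absv (f i) < absv (f x)" using ne by simp
        have "absv (sum f (insert x F)) = absv (f x)"
          using absv_add_eq[of "sum f F" "f x"] lt i insert.hyps by (simp add: add.commute)
        thus ?thesis using lt i nz by (intro disjI2 bexI[of _ x]) force+
      qed
    qed
  qed
qed simp

lemma absv_le_absv_sum_distinct:
  assumes "finite S"
    and "\<And>i k. i \<in> S \<Longrightarrow> k \<in> S \<Longrightarrow> i \<noteq> k \<Longrightarrow> f i \<noteq> 0 \<Longrightarrow> f k \<noteq> 0 \<Longrightarrow> absv (f i :: 'c) \<noteq> absv (f k)"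
    and "i \<in> S"
  shows "absv (f i) \<le> absv (sum f S)"
proof -
  have "(\<forall>i\<in>S. f i = 0) \<or> (\<exists>i\<in>S. f i \<noteq> 0 \<and> absv (sum f S) = absv (f i) \<and> (\<forall>k\<in>S. absv (f k) \<le> absv (f i)))"
    by (rule absv_sum_distinct) (use assms in auto)
  thus ?thesis using assms(3) by auto
qed

lemma card_gt_1: "CARD('k) > 1"
  using card_mono[of "UNIV::'k set" "{0,1}"] by simp

lemma absv_sc [simp]: "s \<noteq> 0 \<Longrightarrow> absv (sc s) = 1"
  using absv_Kinf[of "fls_const s"] by (simp add: sc_conv_emb_K emb_K_def)
lemma absv_sc_le: "absv (sc s) \<le> 1"
  by (cases "s = 0") auto
lemma absv_TT: "absv TT = real CARD('k)"
  using absv_Kinf[of fls_X_inv] by (simp add: TT_conv_emb_K emb_K_def)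
lemma TT_nz [simp]: "TT \<noteq> 0"
  using absv_TT card_gt_1 by (metis absv_0 of_nat_0_eq_iff not_one_less_zero)

lemma absv_emb_A: "a \<noteq> 0 \<Longrightarrow> absv (emb_A j a) = real CARD('k) ^ Polynomial.degree a"
proof (induction a)
  case (pCons s a)
  show ?case
  proof (cases "a = 0")
    case True
    thus ?thesis using pCons by (auto simp: emb_A_pCons)
  next
    case False
    have "absv (TT * emb_A j a) = real CARD('k) ^ Suc (Polynomial.degree a)"
      using pCons.IH[OF False] by (simp add: absv_mult absv_TT)
    moreover have "real CARD('k) ^ Suc (Polynomial.degree a) > 1"
      using card_gt_1 by (intro one_less_power) auto
    ultimately show ?thesis using absv_add_eq[of "sc s" "TT * emb_A j a"] absv_sc_le[of s] False
      by (simp add: emb_A_pCons)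
  qed
qed simp

lemma emb_A_eq_0_iff [simp]: "emb_A j a = 0 \<longleftrightarrow> a = 0"
  using absv_emb_A[of a] card_gt_1 by (metis absv_0 emb_A_0 of_nat_0_eq_iff not_one_less_zero power_not_zero)

lemma absv_emb_A_ge_1: "a \<noteq> 0 \<Longrightarrow> absv (emb_A j a) \<ge> 1"
  using absv_emb_A[of a] card_gt_1 by simp

lemma CHAR_b: "CHAR('c) = CHAR('k)"
proof (rule CHAR_eqI)
  have eq: "of_nat n = sc (of_nat n)" for n by (induction n) (auto simp: sc_add)
  show "of_nat CHAR('k) = (0::'c)" by (simp add: eq)
  show "CHAR('k) dvd n" if "of_nat n = (0::'c)" for n
    using that by (simp add: eq of_nat_eq_0_iff_char_dvd)
qed

lemma prime_CHAR: "normalization_semidom_class.prime CHAR('k)"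
  by (rule prime_CHAR_semidom) (simp add: finite_imp_CHAR_pos)

lemma frobenius_add: "((x::'c) + y) ^ (CARD('k) ^ i) = x ^ (CARD('k) ^ i) + y ^ (CARD('k) ^ i)"
proof -
  obtain e where e: "CARD('k) = CHAR('k) ^ e" using CARD_eq_CHAR_power by blast
  show ?thesis
    by (rule freshmans_dream'[of _ "e * i"]) (use prime_CHAR in \<open>simp_all add: CHAR_b e power_mult\<close>)
qed

subsection \<open>Limits and closed subspaces\<close>

text \<open>The sort of \<open>'c\<close> supplies a metric but does not relate it to addition and
  multiplication; that relation comes from the locale assumptions. The rules for limits are
  therefore derived from the ultrametric absolute value.\<close>

lemma C_tendsto_iff: "((f :: 'x \<Rightarrow> 'c) \<longlongrightarrow> l) F \<longleftrightarrow> ((\<lambda>x. absv (f x - l)) \<longlongrightarrow> 0) F"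
  by (simp add: tendsto_dist_iff[of f] dist_absv)

lemma C_tendsto_add:
  assumes "((f :: 'x \<Rightarrow> 'c) \<longlongrightarrow> l) F" "(g \<longlongrightarrow> m) F"
  shows "((\<lambda>x. f x + g x) \<longlongrightarrow> l + m) F"
  unfolding C_tendsto_iff
proof (rule Lim_null_comparison)
  show "\<forall>\<^sub>F x in F. norm (absv (f x + g x - (l + m))) \<le> absv (f x - l) + absv (g x - m)"
  proof (rule always_eventually, rule allI)
    fix x
    have "absv ((f x - l) + (g x - m)) \<le> max (absv (f x - l)) (absv (g x - m))" by (rule absv_add)
    also have "\<dots> \<le> absv (f x - l) + absv (g x - m)" by simp
    finally show "norm (absv (f x + g x - (l + m))) \<le> absv (f x - l) + absv (g x - m)"
      by (simp add: algebra_simps)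
  qed
  show "((\<lambda>x. absv (f x - l) + absv (g x - m)) \<longlongrightarrow> 0) F"
    using tendsto_add[OF assms[unfolded C_tendsto_iff]] by simp
qed

lemma C_tendsto_mult:
  assumes "((f :: 'x \<Rightarrow> 'c) \<longlongrightarrow> l) F" "(g \<longlongrightarrow> m) F"
  shows "((\<lambda>x. f x * g x) \<longlongrightarrow> l * m) F"
  unfolding C_tendsto_iff
proof (rule Lim_null_comparison)
  let ?B = "\<lambda>x. absv (f x - l) * absv (g x - m) + absv l * absv (g x - m) + absv m * absv (f x - l)"
  show "\<forall>\<^sub>F x in F. norm (absv (f x * g x - (l * m))) \<le> ?B x"
  proof (rule always_eventually, rule allI)
    fix x
    have "f x * g x - l * m = ((f x - l) * (g x - m) + l * (g x - m)) + m * (f x - l)"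
      by (simp add: algebra_simps)
    also have "absv \<dots> \<le> max (absv ((f x - l) * (g x - m) + l * (g x - m))) (absv (m * (f x - l)))"
      by (rule absv_add)
    also have "\<dots> \<le> max (max (absv ((f x - l) * (g x - m))) (absv (l * (g x - m)))) (absv (m * (f x - l)))"
      by (intro max.mono absv_add order_refl)
    also have "\<dots> \<le> ?B x" by (simp add: absv_mult)
    finally show "norm (absv (f x * g x - (l * m))) \<le> ?B x" by simp
  qed
  show "(?B \<longlongrightarrow> 0) F"
    using tendsto_add[OF tendsto_add[OF tendsto_mult[OF assms[unfolded C_tendsto_iff]]
       tendsto_mult[OF tendsto_const[of "absv l"] assms(2)[unfolded C_tendsto_iff]]]
       tendsto_mult[OF tendsto_const[of "absv m"] assms(1)[unfolded C_tendsto_iff]]] by simp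
qed

lemma C_tendsto_cmult:
  assumes "((f :: 'x \<Rightarrow> 'c) \<longlongrightarrow> l) F"
  shows "((\<lambda>x. a * f x) \<longlongrightarrow> a * l) F"
  by (rule C_tendsto_mult[OF tendsto_const assms])

lemma C_tendsto_diff:
  assumes "((f :: 'x \<Rightarrow> 'c) \<longlongrightarrow> l) F" "(g \<longlongrightarrow> m) F"
  shows "((\<lambda>x. f x - g x) \<longlongrightarrow> l - m) F"
  using C_tendsto_add[OF assms(1) C_tendsto_cmult[OF assms(2), of "-1"]] by simp

lemma C_tendsto_prod:
  assumes "\<And>i. i \<in> S \<Longrightarrow> ((f i :: 'x \<Rightarrow> 'c) \<longlongrightarrow> l i) F"
  shows "((\<lambda>x. \<Prod>i\<in>S. f i x) \<longlongrightarrow> (\<Prod>i\<in>S. l i)) F"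
  using assms by (induction S rule: infinite_finite_induct) (auto intro: C_tendsto_mult)

lemma absv_tendsto:
  assumes "((f :: 'x \<Rightarrow> 'c) \<longlongrightarrow> l) F"
  shows "((\<lambda>x. absv (f x)) \<longlongrightarrow> absv l) F"
  unfolding absv_def by (intro tendsto_intros assms)

lemma C_tendsto_inverse:
  assumes f: "((f :: 'x \<Rightarrow> 'c) \<longlongrightarrow> l) F" and l: "l \<noteq> 0"
  shows "((\<lambda>x. inverse (f x)) \<longlongrightarrow> inverse l) F"
  unfolding C_tendsto_iff
proof (rule Lim_transform_eventually)
  have ev: "\<forall>\<^sub>F x in F. f x \<noteq> 0"
    using tendsto_imp_eventually_ne[OF f l] .
  show "((\<lambda>x. absv (f x - l) * inverse (absv (f x) * absv l)) \<longlongrightarrow> 0) F"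
    using tendsto_mult[OF f[unfolded C_tendsto_iff]
      tendsto_inverse[OF tendsto_mult[OF absv_tendsto[OF f] tendsto_const[of "absv l"]]]] l by simp
  show "\<forall>\<^sub>F x in F. absv (f x - l) * inverse (absv (f x) * absv l) = absv (inverse (f x) - inverse l)"
    using ev
  proof eventually_elim
    case (elim x)
    have "inverse (f x) - inverse l = - ((f x - l) * inverse (f x * l))"
      using elim l by (simp add: field_simps)
    thus ?case by (simp add: absv_mult absv_inverse)
  qed
qed

lemma closed_C_sequentially:
  "closed (S :: 'c set) \<longleftrightarrow> (\<forall>f l. (\<forall>n. f n \<in> S) \<longrightarrow> f \<longlonglongrightarrow> l \<longrightarrow> l \<in> S)"
  by (simp add: closed_sequential_limits) blast

lemma closed_C_limit: "closed (S :: 'c set) \<Longrightarrow> (\<And>n. f n \<in> S) \<Longrightarrow> f \<longlonglongrightarrow> l \<Longrightarrow> l \<in> S"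
  unfolding closed_C_sequentially by blast

lemma C_cauchyI:
  assumes "\<And>e. e > 0 \<Longrightarrow> \<exists>N. \<forall>m\<ge>N. \<forall>n\<ge>N. absv ((f :: nat \<Rightarrow> 'c) m - f n) < e"
  shows "convergent f"
  using assms by (intro Cauchy_convergent) (simp add: Cauchy_def dist_absv)

text \<open>Since V is closed, b has a distance d > 0 from V, and scaling by a gives |a| d \<le> |a
  b + x| for x in V. Hence the coefficients k of a convergent sequence k b + v form a Cauchy
  sequence; their limit lies in K, and what remains of the sequence converges in V.\<close>

lemma closed_line_extension:
  fixes K V :: "'c set"
  assumes K: "closed K" "\<And>a b. a \<in> K \<Longrightarrow> b \<in> K \<Longrightarrow> a - b \<in> K" "\<And>a. a \<in> K \<Longrightarrow> inverse a \<in> K"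
    and V: "closed V" "0 \<in> V" "\<And>x y. x \<in> V \<Longrightarrow> y \<in> V \<Longrightarrow> x - y \<in> V" "\<And>a x. a \<in> K \<Longrightarrow> x \<in> V \<Longrightarrow> a * x \<in> V"
    and b: "b \<notin> V"
  shows "closed {k * b + v |k v. k \<in> K \<and> v \<in> V}"
  unfolding closed_C_sequentially
proof (intro allI impI)
  fix f l assume f: "\<forall>n::nat. f n \<in> {k * b + v |k v. k \<in> K \<and> v \<in> V}" and lim: "f \<longlonglongrightarrow> l"
  then obtain k v where kv: "\<And>n. f n = k n * b + v n" "\<And>n. k n \<in> K" "\<And>n. v n \<in> V"
    by (simp add: choice_iff) metis
  have "open (- V)" "b \<in> - V" using V b by auto
  then obtain d where d: "d > 0" "\<And>y. dist y b < d \<Longrightarrow> y \<notin> V"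
    unfolding open_dist by blast
  have bound: "absv a * d \<le> absv (a * b + x)" if "a \<in> K" "x \<in> V" for a x
  proof (cases "a = 0")
    case False
    have "0 - x \<in> V" using V(2,3) that by blast
    hence "inverse a * (0 - x) \<in> V" using K(3) V(4) that by blast
    hence "\<not> dist (inverse a * (0 - x)) b < d" using d(2) by blast
    hence "d \<le> absv (inverse a * (0 - x) - b)" by (simp add: dist_absv)
    hence "absv a * d \<le> absv a * absv (inverse a * (0 - x) - b)" by (intro mult_left_mono) auto
    also have "\<dots> = absv (a * (inverse a * (0 - x) - b))" by (simp only: absv_mult)
    also have "a * (inverse a * (0 - x)) = - x" using False by (simp flip: mult.assoc)
    hence "a * (inverse a * (0 - x) - b) = - (a * b + x)" by (simp only: right_diff_distrib) simp
    finally show ?thesis by (simp only: absv_uminus)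
  qed auto
  have "convergent k"
  proof (rule C_cauchyI)
    fix e :: real assume "e > 0"
    hence "e * d > 0" using d by simp
    moreover have "Cauchy f" using lim by (intro LIMSEQ_imp_Cauchy)
    ultimately obtain N where N: "\<forall>m\<ge>N. \<forall>n\<ge>N. absv (f m - f n) < e * d"
      unfolding Cauchy_def dist_absv by blast
    have "absv (k m - k n) < e" if "m \<ge> N" "n \<ge> N" for m n
    proof -
      have "absv (k m - k n) * d \<le> absv ((k m - k n) * b + (v m - v n))"
        by (intro bound K V kv)
      also have "(k m - k n) * b + (v m - v n) = f m - f n" by (simp add: kv algebra_simps)
      also have "absv \<dots> < e * d" using N that by blast
      finally show ?thesis using d by simp
    qed
    thus "\<exists>N. \<forall>m\<ge>N. \<forall>n\<ge>N. absv (k m - k n) < e" by blast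
  qed
  then obtain a where a: "k \<longlonglongrightarrow> a" by (auto simp: convergent_def)
  have "a \<in> K" using K(1) kv(2) a unfolding closed_C_sequentially by blast
  have "(\<lambda>n. f n - b * k n) \<longlonglongrightarrow> l - b * a"
    by (intro C_tendsto_diff lim C_tendsto_cmult a)
  moreover have "(\<lambda>n. f n - b * k n) = v" by (simp add: kv fun_eq_iff)
  ultimately have "v \<longlonglongrightarrow> l - b * a" by simp
  hence "l - b * a \<in> V" using V(1) kv(3) unfolding closed_C_sequentially by blast
  moreover have "l = a * b + (l - b * a)" by simp
  ultimately show "l \<in> {k * b + v |k v. k \<in> K \<and> v \<in> V}" using \<open>a \<in> K\<close> by blast
qed

section \<open>Subfields of C and vector spaces over them\<close>

abbreviation RC :: "'c ring" where "RC \<equiv> ring_of_type_algebra"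

sublocale RC: Ring.field "ring_of_type_algebra :: 'c ring" by (rule field_from_type_algebra)

lemma RC_simps [simp]:
  "carrier RC = UNIV" "x \<otimes>\<^bsub>RC\<^esub> y = x * y" "\<one>\<^bsub>RC\<^esub> = 1" "\<zero>\<^bsub>RC\<^esub> = 0" "x \<oplus>\<^bsub>RC\<^esub> y = x + y"
  by (simp_all add: ring_of_type_algebra_def)

lemma RC_uminus [simp]: "\<ominus>\<^bsub>RC\<^esub> x = - x"
  using RC.add.inv_equality[of "-x" x] by (simp add: ring_of_type_algebra_def a_inv_def)

lemma RC_inverse [simp]: "x \<noteq> 0 \<Longrightarrow> inv\<^bsub>RC\<^esub> x = inverse x"
  using RC.comm_inv_char[of x "inverse x"] by simp

lemma subfieldD:
  assumes "subfield K RC"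
  shows "0 \<in> K" "1 \<in> K" "\<And>x y. x \<in> K \<Longrightarrow> y \<in> K \<Longrightarrow> x + y \<in> K" "\<And>x y. x \<in> K \<Longrightarrow> y \<in> K \<Longrightarrow> x * y \<in> K"
    "\<And>x. x \<in> K \<Longrightarrow> - x \<in> K" "\<And>x y. x \<in> K \<Longrightarrow> y \<in> K \<Longrightarrow> x - y \<in> K" "\<And>x. x \<in> K \<Longrightarrow> inverse x \<in> K"
    "\<And>x y. x \<in> K \<Longrightarrow> y \<in> K \<Longrightarrow> x / y \<in> K"
proof -
  note r = subringE[OF subfieldE(1)[OF assms]]
  show "0 \<in> K" "1 \<in> K" and add: "\<And>x y. x \<in> K \<Longrightarrow> y \<in> K \<Longrightarrow> x + y \<in> K"
    and m: "\<And>x y. x \<in> K \<Longrightarrow> y \<in> K \<Longrightarrow> x * y \<in> K"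
    using r(2,3,6,7) by simp_all
  show um: "- x \<in> K" if "x \<in> K" for x using r(5)[OF that] by simp
  show "x - y \<in> K" if "x \<in> K" "y \<in> K" for x y using add[OF that(1) um[OF that(2)]] by simp
  show i: "inverse x \<in> K" if "x \<in> K" for x
    using RC.subfield_m_inv(1)[OF assms, of x] that by (cases "x = 0") auto
  show "x / y \<in> K" if "x \<in> K" "y \<in> K" for x y
    using m[OF that(1) i[OF that(2)]] by (simp add: divide_inverse)
qed

lemma subfield_power: "subfield K RC \<Longrightarrow> x \<in> K \<Longrightarrow> x ^ n \<in> K"
  by (induction n) (simp_all add: subfieldD)
lemma subfield_sum: "subfield K RC \<Longrightarrow> (\<And>i. i \<in> S \<Longrightarrow> f i \<in> K) \<Longrightarrow> sum f S \<in> K"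
  by (induction S rule: infinite_finite_induct) (simp_all add: subfieldD)
lemma subfield_prod: "subfield K RC \<Longrightarrow> (\<And>i. i \<in> S \<Longrightarrow> f i \<in> K) \<Longrightarrow> prod f S \<in> K"
  by (induction S rule: infinite_finite_induct) (simp_all add: subfieldD)

lemma line_extension_RC: "RC.line_extension K a E = {k * a + v |k v. k \<in> K \<and> v \<in> E}"
proof (rule Set.set_eqI)
  fix x
  have "x \<in> RC.line_extension K a E \<longleftrightarrow> (\<exists>k\<in>K. \<exists>v\<in>E. x = k * a + v)"
    by (simp only: RC.line_extension_mem_iff RC_simps)
  thus "x \<in> RC.line_extension K a E \<longleftrightarrow> x \<in> {k * a + v |k v. k \<in> K \<and> v \<in> E}" by blast
qed

lemma subalgebraD:
  assumes "subalgebra K V RC"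
  shows "0 \<in> V" "\<And>x y. x \<in> V \<Longrightarrow> y \<in> V \<Longrightarrow> x - y \<in> V" "\<And>a x. a \<in> K \<Longrightarrow> x \<in> V \<Longrightarrow> a * x \<in> V"
proof -
  interpret V: subalgebra K V RC by fact
  show "0 \<in> V" using V.one_closed by simp
  show "a * x \<in> V" if "a \<in> K" "x \<in> V" for a x using V.smult_closed[OF that] by simp
  fix x y assume xy: "x \<in> V" "y \<in> V"
  have "\<ominus>\<^bsub>RC\<^esub> y \<in> V" using V.m_inv_closed[OF xy(2)] by (simp only: a_inv_def)
  thus "x - y \<in> V" using V.m_closed[OF xy(1)] by fastforce
qed

text \<open>Induction on the dimension, one basis vector at a time. Over \<open>K_inf j\<close> this
  makes L closed; over L it makes the field of periods and the torsion field closed.\<close>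

lemma closed_finite_dimension:
  assumes K: "subfield K RC" "closed K" and "RC.finite_dimension K V"
  shows "closed V"
proof -
  obtain n where "RC.dimension n K V" using assms(3) unfolding RC.finite_dimension_def by blast
  thus ?thesis
  proof (induction n arbitrary: V)
    case 0
    hence "V = {0}" using RC.dimension_zero[OF K(1)] by simp
    thus ?case by simp
  next
    case (Suc n)
    from Suc.prems obtain v E where vE: "V = RC.line_extension K v E" "v \<notin> E" "RC.dimension n K E"
      by (cases rule: RC.dimension.cases) blast+
    have "subalgebra K E RC"
      using vE(3) K by (intro RC.finite_dimension_imp_subalgebra RC.finite_dimensionI)
    note E = subalgebraD[OF this]
    show ?case unfolding vE(1) line_extension_RC
    proof (rule closed_line_extension)
      show "closed K" "closed E" "0 \<in> E" "v \<notin> E"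
        by (fact K(2), fact Suc.IH[OF vE(3)], fact E(1), fact vE(2))
    qed (fact subfieldD[OF K(1)] E)+
  qed
qed

lemma subfield_subalgebra:
  assumes "subfield K RC" "subfield M RC" "K \<subseteq> M"
  shows "subalgebra K M RC"
proof (intro subalgebra.intro subalgebra_axioms.intro)
  show "subgroup M (add_monoid RC)"
    using subring.axioms(1) subfieldE(1)[OF assms(2)] by blast
  show "k \<otimes>\<^bsub>RC\<^esub> v \<in> M" if "k \<in> K" "v \<in> M" for k v
  proof -
    have "k \<in> M" using that assms(3) by blast
    from subfieldD(4)[OF assms(2) this that(2)] show ?thesis by simp
  qed
qed

section \<open>The field F((1/T)) as a closed subfield of C\<close>

lemma absv_emb_K: "f \<noteq> 0 \<Longrightarrow> absv (emb_K j f) = real CARD('k) powi (- fls_subdegree f)"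
  using absv_Kinf by (simp add: emb_K_def)

lemma absv_emb_K_less_iff:
  "absv (emb_K j f) < real CARD('k) powi (- n) \<longleftrightarrow> (\<forall>k\<le>n. fls_nth f k = 0)"
proof (cases "f = 0")
  case True
  thus ?thesis using card_gt_1 by (simp add: zero_less_power_int)
next
  case False
  have "absv (emb_K j f) < real CARD('k) powi (- n) \<longleftrightarrow> n < fls_subdegree f"
    using card_gt_1 power_int_strict_increasing[of "- fls_subdegree f" "-n" "real CARD('k)"]
      power_int_increasing[of "-n" "- fls_subdegree f" "real CARD('k)"]
    by (cases "n < fls_subdegree f") (auto simp: absv_emb_K[OF False] not_less)
  also have "\<dots> \<longleftrightarrow> (\<forall>k\<le>n. fls_nth f k = 0)"
    using False fls_subdegree_greaterI[OF False, of n] by auto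
  finally show ?thesis .
qed

lemma subfield_K_inf: "subfield (K_inf j) RC"
proof (rule RC.subfieldI'[OF RC.subringI])
  fix x y assume xy: "x \<in> K_inf j" "y \<in> K_inf j"
  thus "x \<otimes>\<^bsub>RC\<^esub> y \<in> K_inf j" "x \<oplus>\<^bsub>RC\<^esub> y \<in> K_inf j" "\<ominus>\<^bsub>RC\<^esub> x \<in> K_inf j"
    by (auto simp: K_inf_def simp flip: emb_K_add emb_K_mult emb_K_uminus)
next
  fix x assume "x \<in> K_inf j - {\<zero>\<^bsub>RC\<^esub>}"
  thus "inv\<^bsub>RC\<^esub> x \<in> K_inf j"
    by (auto simp: K_inf_def simp flip: emb_K_inverse)
next
  show "\<one>\<^bsub>RC\<^esub> \<in> K_inf j" using emb_K_1 by (metis K_inf_def RC_simps(3) rangeI)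
qed simp

lemma emb_A_in_K_inf: "emb_A j a \<in> K_inf j"
  by (simp add: emb_A_def K_inf_def)

lemma TT_in_K_inf: "TT \<in> K_inf j" and sc_in_K_inf: "sc s \<in> K_inf j"
  by (simp_all add: TT_def sc_def emb_A_in_K_inf)

lemma infinite_K_inf: "infinite (K_inf j)"
proof
  assume "finite (K_inf j)"
  hence "finite (range (\<lambda>n. TT ^ n))"
    by (rule finite_subset[rotated]) (use subfield_power[OF subfield_K_inf TT_in_K_inf] in blast)
  moreover have "inj (\<lambda>n. TT ^ n)"
  proof (rule injI)
    fix m n assume "TT ^ m = TT ^ n"
    hence "real CARD('k) ^ m = real CARD('k) ^ n" by (metis absv_TT absv_power)
    thus "m = n" using card_gt_1 by (simp add: power_inject_exp)
  qed
  ultimately show False using finite_imageD by blast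
qed

lemma card_powi_neg_tendsto_0: "(\<lambda>n. real CARD('k) powi (- int n)) \<longlonglongrightarrow> 0"
proof -
  have "(\<lambda>n. inverse (real CARD('k)) ^ n) \<longlonglongrightarrow> 0"
    using card_gt_1 by (intro LIMSEQ_realpow_zero) (auto simp: field_simps)
  thus ?thesis by (simp add: power_int_minus power_inverse)
qed

text \<open>Choose a series \<open>x n\<close> within q^(-n) of the limit. Closeness means agreement
  of coefficients, so \<open>x n\<close> and all later approximations have the same coefficients up
  to index n, and the limit series can be read off diagonally.\<close>

lemma closed_K_inf: "closed (K_inf j)"
  unfolding closed_C_sequentially
proof (intro allI impI)
  let ?q = "real CARD('k)"
  fix f l assume f: "\<forall>n::nat. f n \<in> K_inf j" and lim: "f \<longlonglongrightarrow> l"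
  have "\<exists>x. absv (emb_K j x - l) < ?q powi (- int n)" for n
  proof -
    have "?q powi (- int n) > 0" using card_gt_1 by (simp add: zero_less_power_int)
    then obtain m where "absv (f m - l) < ?q powi (- int n)"
      using lim unfolding LIMSEQ_def dist_absv by blast
    thus ?thesis using f by (metis K_inf_def imageE)
  qed
  then obtain x where x: "\<And>n. absv (emb_K j (x n) - l) < ?q powi (- int n)" by metis
  have agree: "fls_nth (x n) k = fls_nth (x m) k" if "n \<le> m" "k \<le> int n" for n m k
  proof -
    have "?q powi (- int m) \<le> ?q powi (- int n)"
      using card_gt_1 that by (intro power_int_increasing) auto
    hence "absv ((emb_K j (x n) - l) - (emb_K j (x m) - l)) < ?q powi (- int n)"
      using absv_diff[of "emb_K j (x n) - l" "emb_K j (x m) - l"] x[of n] x[of m] by simp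
    hence "absv (emb_K j (x n - x m)) < ?q powi (- int n)"
      by (simp add: emb_K_diff)
    hence "fls_nth (x n - x m) k = 0" unfolding absv_emb_K_less_iff using that by blast
    thus ?thesis by simp
  qed
  \<comment> \<open>For negative k the index \<open>nat k\<close> is 0, so the polar part is that of
    \<open>x 0\<close>. It is finite, and by \<open>agree\<close> with n = 0 it is shared by all
    approximations.\<close>
  define g where "g = Abs_fls (\<lambda>k. fls_nth (x (nat k)) k)"
  have g: "fls_nth g k = fls_nth (x (nat k)) k" for k
    unfolding g_def
    by (rule nth_Abs_fls_lower_bound[of "min 0 (fls_subdegree (x 0))"]) auto
  have "absv (emb_K j (g - x n)) < ?q powi (- int n)" for n
    unfolding absv_emb_K_less_iff using agree[of "nat _" n] by (auto simp: g)
  hence "absv (emb_K j g - emb_K j (x n)) < ?q powi (- int n)" for n by (simp add: emb_K_diff)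
  hence "absv (emb_K j g - l) \<le> ?q powi (- int n)" for n
    using absv_add[of "emb_K j g - emb_K j (x n)" "emb_K j (x n) - l"] x[of n]
    by (smt (verit) diff_add_cancel add_diff_eq)
  hence "absv (emb_K j g - l) \<le> 0"
    by (intro LIMSEQ_le_const[OF card_powi_neg_tendsto_0]) auto
  hence "emb_K j g = l" using absv_nonneg[of "emb_K j g - l"] absv_eq_0_iff[of "emb_K j g - l"]
    by (simp add: order_antisym)
  thus "l \<in> K_inf j" by (auto simp: K_inf_def)
qed

section \<open>Frobenius and products over the scalars\<close>

lemma card_sum_power:
  "(\<Sum>i\<in>S. f i :: 'c) ^ CARD('k) = (\<Sum>i\<in>S. f i ^ CARD('k))"
  using frobenius_add[of _ _ 1]
  by (induction S rule: infinite_finite_induct) (auto simp: zero_power)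

text \<open>Homogenised form of the identity that z^q - z is the product of all z - s. Both sides of
  the latter are monic of degree q and vanish at the q scalars, so they agree; then z = y/u.\<close>

lemma prod_scalars:
  "(\<Prod>s\<in>(UNIV::'k set). y - sc s * u) = y ^ CARD('k) - u ^ (CARD('k) - 1) * y"
proof -
  let ?q = "CARD('k)"
  define p where "p = (\<Prod>s\<in>(UNIV::'k set). [:- sc s, 1:])"
  define r where "r = Polynomial.monom 1 ?q - Polynomial.monom (1::'c) 1"
  have degp: "Polynomial.degree p = ?q"
    unfolding p_def by (subst degree_prod_eq_sum_degree) auto
  have lcp: "Polynomial.coeff p (Polynomial.degree p) = 1" unfolding p_def by (simp add: lead_coeff_prod)
  have "p = r"
  proof (rule poly_eqI_degree_lead_coeff[of _ ?q _ "range sc"])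
    show "Polynomial.coeff p ?q = Polynomial.coeff r ?q"
      using degp lcp card_gt_1 by (simp add: r_def)
    show "?q \<le> card (range sc)" using card_image[OF inj_sc] by simp
    show "Polynomial.degree p \<le> ?q" using degp by simp
    show "Polynomial.degree r \<le> ?q" unfolding r_def
      using card_gt_1 by (intro degree_diff_le) (auto simp: Polynomial.degree_monom_eq)
    show "poly p z = poly r z" if "z \<in> range sc" for z
      using that by (auto simp: p_def r_def poly_prod poly_monom sc_power_card prod_zero_iff)
  qed
  hence *: "(\<Prod>s\<in>(UNIV::'k set). z - sc s) = z ^ ?q - z" for z
  proof -
    have "poly p z = poly r z" using \<open>p = r\<close> by simp
    thus ?thesis by (simp add: p_def r_def poly_prod poly_monom)
  qed
  show ?thesis
  proof (cases "u = 0")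
    case True
    thus ?thesis using card_gt_1 by (simp add: zero_power)
  next
    case False
    have "(\<Prod>s\<in>(UNIV::'k set). y - sc s * u) = (\<Prod>s\<in>(UNIV::'k set). u * (y / u - sc s))"
      using False by (intro prod.cong) (auto simp: field_simps)
    also have "\<dots> = u ^ ?q * ((y / u) ^ ?q - y / u)"
      using *[of "y / u"] by (simp add: prod.distrib)
    also have "\<dots> = y ^ ?q - u ^ (?q - 1) * y"
    proof -
      have "u ^ ?q = u ^ (?q - 1) * u" using card_gt_1 by (metis Suc_diff_1 power_Suc2 zero_less_card_finite)
      hence "u ^ ?q * (y / u) = u ^ (?q - 1) * y" using False by simp
      moreover have "u ^ ?q * (y / u) ^ ?q = y ^ ?q" using False by (simp add: power_divide)
      ultimately show ?thesis by (simp only: right_diff_distrib)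
    qed
    finally show ?thesis .
  qed
qed

subsection \<open>Finite \<open>F\<^sub>q\<close>-subspaces\<close>

definition fq_subspace :: "'c set \<Rightarrow> bool" where
  "fq_subspace V \<longleftrightarrow> 0 \<in> V \<and> (\<forall>x\<in>V. \<forall>y\<in>V. x + y \<in> V) \<and> (\<forall>s. \<forall>x\<in>V. sc s * x \<in> V)"

lemma fq_subspaceD:
  assumes "fq_subspace V"
  shows "0 \<in> V" "x \<in> V \<Longrightarrow> y \<in> V \<Longrightarrow> x + y \<in> V" "x \<in> V \<Longrightarrow> sc s * x \<in> V"
    "x \<in> V \<Longrightarrow> - x \<in> V" "x \<in> V \<Longrightarrow> y \<in> V \<Longrightarrow> x - y \<in> V"
proof -
  show *: "0 \<in> V" "\<And>x y. x \<in> V \<Longrightarrow> y \<in> V \<Longrightarrow> x + y \<in> V" "\<And>x. x \<in> V \<Longrightarrow> sc s * x \<in> V" for s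
    using assms by (auto simp: fq_subspace_def)
  show **: "- x \<in> V" if "x \<in> V" for x using *(3)[OF that, of "-1"] by (simp add: sc_uminus)
  show "x \<in> V \<Longrightarrow> y \<in> V \<Longrightarrow> x - y \<in> V" using *(2)[of x "-y"] **[of y] by simp
qed

definition vanishing :: "'c set \<Rightarrow> 'c \<Rightarrow> 'c" where
  "vanishing V z = (\<Prod>v\<in>V. z - v)"

lemma vanishing_eq_0_iff: "finite V \<Longrightarrow> vanishing V z = 0 \<longleftrightarrow> z \<in> V"
  by (auto simp: vanishing_def)

text \<open>The list may be dependent: a generator that is already in the span changes nothing. So a
  finite subspace is the span of a list of all its elements, and no basis has to be chosen.\<close>

fun fspan :: "'c list \<Rightarrow> 'c set" where
  "fspan [] = {0}"
| "fspan (b # bs) = (\<lambda>(s, v). sc s * b + v) ` (UNIV \<times> fspan bs)"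

lemma finite_fspan: "finite (fspan bs)"
  by (induction bs) auto

lemma fq_subspace_fspan: "fq_subspace (fspan bs)"
proof (induction bs)
  case (Cons b bs)
  note D = fq_subspaceD[OF Cons.IH]
  show ?case unfolding fq_subspace_def
  proof (intro conjI ballI allI)
    show "0 \<in> fspan (b # bs)" using D(1) by (auto intro!: image_eqI[of _ _ "(0,0)"])
  next
    fix x y assume "x \<in> fspan (b # bs)" "y \<in> fspan (b # bs)"
    then obtain s v t w where "x = sc s * b + v" "y = sc t * b + w" "v \<in> fspan bs" "w \<in> fspan bs"
      by auto
    thus "x + y \<in> fspan (b # bs)" using D(2)
      by (auto intro!: image_eqI[of _ _ "(s + t, v + w)"] simp: sc_add algebra_simps)
  next
    fix t x assume "x \<in> fspan (b # bs)"
    then obtain s v where "x = sc s * b + v" "v \<in> fspan bs" by auto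
    thus "sc t * x \<in> fspan (b # bs)" using D(3)
      by (auto intro!: image_eqI[of _ _ "(t * s, sc t * v)"] simp: sc_mult algebra_simps)
  qed
qed (auto simp: fq_subspace_def)

lemma set_subset_fspan: "set bs \<subseteq> fspan bs"
proof (induction bs)
  case (Cons b bs)
  have "b \<in> fspan (b # bs)" using fq_subspaceD(1)[OF fq_subspace_fspan[of bs]]
    by (auto intro!: image_eqI[of _ _ "(1,0)"])
  moreover have "x \<in> fspan (b # bs)" if "x \<in> set bs" for x
    using that Cons by (auto intro!: image_eqI[of _ _ "(0,x)"])
  ultimately show ?case by (metis set_ConsD subsetI)
qed simp

lemma fspan_subset: "fq_subspace V \<Longrightarrow> set bs \<subseteq> V \<Longrightarrow> fspan bs \<subseteq> V"
  by (induction bs) (auto intro!: fq_subspaceD)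

text \<open>Adjoining b to V replaces f, the vanishing polynomial of V, by the product of f(z) - s
  f(b) over the scalars s, which is f(z)^q - f(b)^(q-1) f(z). This is again a combination of powers
  z^(q^i). The monic top coefficient is recorded because it later shows that the leading coefficient
  of the Drinfeld module is nonzero.\<close>

lemma vanishing_fspan:
  "\<exists>n c. card (fspan bs) = CARD('k) ^ n \<and> c n = 1 \<and>
     (\<forall>z. vanishing (fspan bs) z = (\<Sum>i\<le>n. c i * z ^ (CARD('k) ^ i)))"
proof (induction bs)
  case Nil
  show ?case by (intro exI[of _ 0] exI[of _ "\<lambda>_. 1"]) (simp add: vanishing_def)
next
  case (Cons b bs)
  let ?q = "CARD('k)" and ?V = "fspan bs"
  note D = fq_subspaceD[OF fq_subspace_fspan[of bs]]
  obtain n c where IH: "card ?V = ?q ^ n" "c n = 1"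
    "\<And>z. vanishing ?V z = (\<Sum>i\<le>n. c i * z ^ (?q ^ i))" using Cons by blast
  show ?case
  proof (cases "b \<in> ?V")
    case True
    have "fspan (b # bs) = ?V"
    proof
      show "?V \<subseteq> fspan (b # bs)" by (auto intro!: image_eqI[of _ _ "(0,_)"])
      show "fspan (b # bs) \<subseteq> ?V" using D True by auto
    qed
    thus ?thesis using Cons by simp
  next
    case False
    have inj: "inj_on (\<lambda>(s, v). sc s * b + v) (UNIV \<times> ?V)"
    proof (rule inj_onI, clarsimp)
      fix s v t w assume vw: "v \<in> ?V" "w \<in> ?V" and eq: "sc s * b + v = sc t * b + w"
      hence e: "sc (s - t) * b = w - v" by (simp add: sc_diff algebra_simps)
      have "s = t"
      proof (rule ccontr)
        assume "s \<noteq> t"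
        hence "b = sc (inverse (s - t)) * (w - v)"
          by (simp flip: e mult.assoc sc_mult)
        thus False using False D(3,5) vw by metis
      qed
      thus "s = t \<and> v = w" using eq by simp
    qed
    define u where "u = vanishing ?V b ^ (?q - 1)"
    \<comment> \<open>Taking q-th powers shifts the index by one, which accounts for the first
      summand. The second is cut off above n because nothing is known about \<open>c\<close>
      there.\<close>
    define c' where "c' i = (if i = 0 then 0 else c (i - 1) ^ ?q) - (if i \<le> n then u * c i else 0)" for i
    have addV: "vanishing ?V (x - sc s * y) = vanishing ?V x - sc s * vanishing ?V y" for x y s
    proof -
      have "(x - sc s * y) ^ (?q ^ i) = x ^ (?q ^ i) - sc s * y ^ (?q ^ i)" for i
      proof -
        have "sc (-s) ^ (?q ^ i) = sc (-s)"
          by (induction i) (auto simp: sc_power_card power_mult)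
        hence "(x + sc (-s) * y) ^ (?q ^ i) = x ^ (?q ^ i) + sc (-s) * y ^ (?q ^ i)"
          by (simp add: frobenius_add power_mult_distrib)
        thus ?thesis by (simp add: sc_uminus)
      qed
      thus ?thesis unfolding IH
        by (simp only: right_diff_distrib sum_subtractf sum_distrib_left mult.left_commute)
    qed
    have "vanishing (fspan (b # bs)) z = (\<Sum>i\<le>Suc n. c' i * z ^ (?q ^ i))" for z
    proof -
      have "vanishing (fspan (b # bs)) z = (\<Prod>(s,v)\<in>UNIV \<times> ?V. z - (sc s * b + v))"
        unfolding vanishing_def fspan.simps using prod.reindex[OF inj] by (simp add: case_prod_unfold o_def)
      also have "\<dots> = (\<Prod>s\<in>UNIV. \<Prod>v\<in>?V. (z - sc s * b) - v)"
        by (simp add: prod.cartesian_product algebra_simps)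
      also have "\<dots> = (\<Prod>s\<in>UNIV. vanishing ?V z - sc s * vanishing ?V b)"
        by (simp add: vanishing_def[symmetric] addV)
      also have "\<dots> = vanishing ?V z ^ ?q - u * vanishing ?V z"
        by (simp add: prod_scalars u_def)
      also have "vanishing ?V z ^ ?q = (\<Sum>i\<le>n. c i ^ ?q * z ^ (?q ^ Suc i))"
        unfolding IH card_sum_power by (simp add: power_mult_distrib mult.commute flip: power_mult)
      also have "\<dots> = (\<Sum>i\<le>Suc n. (if i = 0 then 0 else c (i - 1) ^ ?q) * z ^ (?q ^ i))"
        by (subst sum.atMost_Suc_shift) simp
      also have "u * vanishing ?V z = (\<Sum>i\<le>Suc n. (if i \<le> n then u * c i else 0) * z ^ (?q ^ i))"
        unfolding IH by (simp add: sum_distrib_left mult.assoc)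
      finally show ?thesis by (simp only: c'_def left_diff_distrib sum_subtractf)
    qed
    moreover have "card (fspan (b # bs)) = ?q ^ Suc n"
      unfolding fspan.simps card_image[OF inj] by (simp add: card_cartesian_product IH)
    moreover have "c' (Suc n) = 1" by (simp add: c'_def IH)
    ultimately show ?thesis by blast
  qed
qed

lemma vanishing_q_polynomial:
  assumes "finite V" "fq_subspace V"
  obtains n c where "card V = CARD('k) ^ n" "c n = 1"
    "\<And>z. vanishing V z = (\<Sum>i\<le>n. c i * z ^ (CARD('k) ^ i))"
proof -
  obtain bs where bs: "set bs = V" using finite_list[OF assms(1)] by blast
  hence "fspan bs = V" using fspan_subset[OF assms(2)] set_subset_fspan by (metis order_refl subset_antisym)
  thus ?thesis using vanishing_fspan[of bs] that by metis
qed

lemma scalar_power_card_power: "sc s ^ (CARD('k) ^ i) = sc s"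
  by (induction i) (auto simp: sc_power_card power_mult)

lemma vanishing_add:
  assumes "finite V" "fq_subspace V"
  shows "vanishing V (x + y) = vanishing V x + vanishing V y"
  by (rule vanishing_q_polynomial[OF assms])
     (simp add: frobenius_add sum.distrib algebra_simps)

lemma vanishing_scalar:
  assumes "finite V" "fq_subspace V"
  shows "vanishing V (sc s * y) = sc s * vanishing V y"
  by (rule vanishing_q_polynomial[OF assms])
     (simp add: power_mult_distrib scalar_power_card_power sum_distrib_left mult.left_commute)

lemma vanishing_diff:
  assumes "finite V" "fq_subspace V"
  shows "vanishing V (x - y) = vanishing V x - vanishing V y"
  using vanishing_add[OF assms, of "x - y" y] by (simp add: algebra_simps)

lemma vanishing_sum:
  assumes "finite V" "fq_subspace V"
  shows "vanishing V (sum f S) = (\<Sum>i\<in>S. vanishing V (f i))"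
proof -
  have "vanishing V 0 = 0" using assms by (simp add: vanishing_eq_0_iff fq_subspaceD)
  thus ?thesis
    by (induction S rule: infinite_finite_induct) (auto simp: vanishing_add[OF assms])
qed

lemma vanishing_direct_sum:
  assumes V: "finite V" "fq_subspace V" and "finite U" and inj: "inj_on (\<lambda>(u, v). u + v) (U \<times> V)"
  shows "vanishing ((\<lambda>(u, v). u + v) ` (U \<times> V)) z = (\<Prod>u\<in>U. vanishing V z - vanishing V u)"
proof -
  have "vanishing ((\<lambda>(u, v). u + v) ` (U \<times> V)) z = (\<Prod>(u,v)\<in>U \<times> V. z - (u + v))"
    unfolding vanishing_def using prod.reindex[OF inj] by (simp add: case_prod_unfold o_def)
  also have "\<dots> = (\<Prod>u\<in>U. \<Prod>v\<in>V. (z - u) - v)"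
    by (simp add: prod.cartesian_product algebra_simps)
  finally show ?thesis by (simp add: vanishing_def[symmetric] vanishing_diff[OF V])
qed

text \<open>The analogue of \<open>lattice_exp\<close> for a finite \<open>V\<close>: the multiple of \<open>vanishing V\<close> with derivative 1 at 0.\<close>

definition fexp :: "'c set \<Rightarrow> 'c \<Rightarrow> 'c" where
  "fexp V z = z * (\<Prod>v\<in>V - {0}. 1 - z / v)"

lemma vanishing_conv_fexp:
  assumes "finite V" "0 \<in> V"
  shows "vanishing V z = (\<Prod>v\<in>V - {0}. - v) * fexp V z"
proof -
  have "vanishing V z = z * (\<Prod>v\<in>V - {0}. z - v)"
    unfolding vanishing_def by (subst prod.remove[OF assms]) simp
  also have "(\<Prod>v\<in>V - {0}. z - v) = (\<Prod>v\<in>V - {0}. - v * (1 - z / v))"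
    by (intro prod.cong) (auto simp: field_simps)
  finally show ?thesis unfolding fexp_def prod.distrib by (simp only: mult_ac)
qed

lemma fexp_conv_vanishing:
  assumes "finite V" "0 \<in> V"
  shows "fexp V z = vanishing V z / (\<Prod>v\<in>V - {0}. - v)"
  unfolding vanishing_conv_fexp[OF assms] using assms by simp

lemma fexp_add:
  assumes "finite V" "fq_subspace V"
  shows "fexp V (x + y) = fexp V x + fexp V y"
  by (simp add: fexp_conv_vanishing fq_subspaceD assms vanishing_add add_divide_distrib)

lemma fexp_scalar:
  assumes "finite V" "fq_subspace V"
  shows "fexp V (sc s * y) = sc s * fexp V y"
  by (simp add: fexp_conv_vanishing fq_subspaceD assms vanishing_scalar)

text \<open>After replacing v by -v the product is the quotient of the vanishing polynomial at w - z
  and at w, and additivity splits the numerator. The point of the formula is that w enters only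
  through \<open>fexp V w\<close>.\<close>

lemma prod_coset:
  assumes V: "finite V" "fq_subspace V" and w: "w \<notin> V"
  shows "(\<Prod>v\<in>V. 1 - z / (w + v)) = 1 - fexp V z / fexp V w"
proof -
  let ?D = "\<Prod>v\<in>V - {0}. - v"
  have D: "?D \<noteq> 0" using V by simp
  have w0: "vanishing V w \<noteq> 0" using w V by (simp add: vanishing_eq_0_iff)
  have wv: "w + v \<noteq> 0" if "v \<in> V" for v
    using w fq_subspaceD(4)[OF V(2) that] by (metis add_eq_0_iff2 minus_minus)
  have reindex: "(\<Prod>v\<in>V. g (- v)) = (\<Prod>v\<in>V. g v)" for g :: "'c \<Rightarrow> 'c"
    by (rule prod.reindex_bij_witness[of _ uminus uminus]) (auto intro: fq_subspaceD V)
  have "(\<Prod>v\<in>V. 1 - z / (w + v)) = (\<Prod>v\<in>V. ((w - z) - (- v)) / (w - (- v)))"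
    using wv by (intro prod.cong) (auto simp: field_simps)
  also have "\<dots> = (\<Prod>v\<in>V. ((w - z) - v) / (w - v))" by (rule reindex)
  also have "\<dots> = (\<Prod>v\<in>V. (w - z) - v) / (\<Prod>v\<in>V. w - v)" by (rule prod_dividef)
  also have "\<dots> = vanishing V (w - z) / vanishing V w"
    by (simp only: vanishing_def)
  also have "\<dots> = 1 - vanishing V z / vanishing V w"
    using w0 by (simp add: vanishing_diff[OF V] diff_divide_distrib)
  also have "vanishing V z / vanishing V w = fexp V z / fexp V w"
    using D by (simp add: vanishing_conv_fexp[OF V(1) fq_subspaceD(1)[OF V(2)]])
  finally show ?thesis .
qed

lemma fq_subspace_scale: "fq_subspace V \<Longrightarrow> fq_subspace ((*) t ` V)"
  unfolding fq_subspace_def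
  by (auto simp: mult.left_commute[of _ t] intro!: image_eqI[of 0 _ 0] simp flip: distrib_left)

lemma fexp_scale:
  assumes "t \<noteq> 0"
  shows "fexp ((*) t ` V) (t * z) = t * fexp V z"
proof -
  have inj: "inj_on ((*) t) (V - {0})" using assms by (auto intro: inj_onI)
  have "(*) t ` V - {0} = (*) t ` (V - {0})" using assms by auto
  hence "(\<Prod>v\<in>(*) t ` V - {0}. 1 - t * z / v) = (\<Prod>v\<in>V - {0}. 1 - z / v)"
    using assms by (simp add: prod.reindex[OF inj])
  thus ?thesis by (simp add: fexp_def mult.assoc)
qed

text \<open>The coset of 0 contributes \<open>fexp V z\<close>, every other coset one factor by
  \<open>prod_coset\<close>. With V a multiple of T this yields the functional equation; with V
  inside A it yields the values of the exponential function on L.\<close>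

lemma fexp_direct_sum:
  assumes V: "finite V" "fq_subspace V" and U: "finite U" "0 \<in> U"
    and inj: "inj_on (\<lambda>(u, v). u + v) (U \<times> V)"
  shows "fexp ((\<lambda>(u, v). u + v) ` (U \<times> V)) z = fexp V z * (\<Prod>u\<in>U - {0}. 1 - fexp V z / fexp V u)"
proof -
  \<comment> \<open>The value 1 at 0 lets the product run over the whole direct sum, including the
    point 0.\<close>
  define g where "g x = (if x = 0 then 1 else 1 - z / x)" for x
  have "(\<Prod>x\<in>(\<lambda>(u, v). u + v) ` (U \<times> V) - {0}. 1 - z / x) = (\<Prod>x\<in>(\<lambda>(u, v). u + v) ` (U \<times> V). g x)"
    by (rule prod.mono_neutral_cong_left) (use U V in \<open>auto simp: g_def\<close>)
  also have "\<dots> = (\<Prod>(u, v)\<in>U \<times> V. g (u + v))"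
    by (subst prod.reindex[OF inj]) (simp add: case_prod_unfold o_def)
  also have "\<dots> = (\<Prod>u\<in>U. \<Prod>v\<in>V. g (u + v))"
    by (simp add: prod.cartesian_product)
  also have "\<dots> = (\<Prod>v\<in>V. g (0 + v)) * (\<Prod>u\<in>U - {0}. \<Prod>v\<in>V. g (u + v))"
    by (rule prod.remove[OF U])
  also have "(\<Prod>v\<in>V. g (0 + v)) = (\<Prod>v\<in>V - {0}. 1 - z / v)"
    by (rule prod.mono_neutral_cong_right[OF V(1)]) (auto simp: g_def)
  also have "(\<Prod>u\<in>U - {0}. \<Prod>v\<in>V. g (u + v)) = (\<Prod>u\<in>U - {0}. 1 - fexp V z / fexp V u)"
  proof (rule prod.cong[OF refl])
    fix u assume u: "u \<in> U - {0}"
    have uV: "u \<notin> V"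
    proof
      assume "u \<in> V"
      hence "(u, 0) = (0, u)" using u U fq_subspaceD(1)[OF V(2)] by (intro inj_onD[OF inj]) auto
      thus False using u by simp
    qed
    have "u + v \<noteq> 0" if "v \<in> V" for v
      using uV fq_subspaceD(4)[OF V(2) that] by (metis eq_neg_iff_add_eq_0)
    hence "(\<Prod>v\<in>V. g (u + v)) = (\<Prod>v\<in>V. 1 - z / (u + v))"
      by (intro prod.cong) (auto simp: g_def)
    also have "\<dots> = 1 - fexp V z / fexp V u" by (rule prod_coset[OF V uV])
    finally show "(\<Prod>v\<in>V. g (u + v)) = 1 - fexp V z / fexp V u" .
  qed
  finally show ?thesis by (simp add: fexp_def mult_ac)
qed

subsection \<open>The exponential function of a lattice\<close>

lemma absv_prod_one_minus:
  assumes "\<And>i. i \<in> S \<Longrightarrow> absv (x i :: 'c) \<le> d" "0 \<le> d" "d \<le> 1"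
  shows "absv ((\<Prod>i\<in>S. 1 - x i) - 1) \<le> d"
  using assms(1)
proof (induction S rule: infinite_finite_induct)
  case (insert i S)
  let ?P = "\<Prod>i\<in>S. 1 - x i"
  have IH: "absv (?P - 1) \<le> d" using insert by auto
  have "absv ?P \<le> 1"
    using absv_add[of "?P - 1" 1] IH assms by simp
  hence "absv (x i * ?P) \<le> d * 1"
    unfolding absv_mult using insert.prems assms by (intro mult_mono) auto
  moreover have "(\<Prod>i\<in>insert i S. 1 - x i) - 1 = (?P - 1) - x i * ?P"
    using insert.hyps by (simp add: algebra_simps)
  ultimately show ?case using absv_diff[of "?P - 1" "x i * ?P"] IH
    by (smt (verit))
qed (use assms in auto)

text \<open>The form of discreteness that the infinite product requires: for fixed z, all but
  finitely many factors are as close to 1 as desired.\<close>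

definition locally_finite :: "'c set \<Rightarrow> bool" where
  "locally_finite \<Lambda> \<longleftrightarrow> (\<forall>R. finite {\<mu>\<in>\<Lambda>. absv \<mu> \<le> R})"

text \<open>Factors with |\<mu>| > n \<ge> N > |z| have absolute value 1 and differ from 1 by at
  most |z|/n. Hence all partial products that contain \<open>B N\<close> have the same absolute
  value C, and those that contain \<open>B n\<close> lie within C |z| / n of each other. The last
  claim passes the same ultrametric estimate to the limit and controls the exponential function near
  0.\<close>

lemma lattice_product:
  assumes "locally_finite \<Lambda>"
  obtains l where "((\<lambda>F. \<Prod>\<mu>\<in>F. 1 - z / \<mu>) \<longlongrightarrow> l) (finite_subsets_at_top (\<Lambda> - {0}))"
    "l = 0 \<longleftrightarrow> z \<in> \<Lambda> - {0}"
    "\<And>d. 0 \<le> d \<Longrightarrow> d \<le> 1 \<Longrightarrow> (\<And>\<mu>. \<mu> \<in> \<Lambda> - {0} \<Longrightarrow> absv (z / \<mu>) \<le> d) \<Longrightarrow> absv (l - 1) \<le> d"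
proof -
  let ?A = "\<Lambda> - {0}" and ?p = "\<lambda>F. \<Prod>\<mu>\<in>F. 1 - z / \<mu>"
  define B where "B n = {\<mu>\<in>?A. absv \<mu> \<le> real n}" for n :: nat
  have finB: "finite (B n)" for n
    using assms by (auto simp: B_def locally_finite_def intro: finite_subset[of _ "{\<mu>\<in>\<Lambda>. absv \<mu> \<le> real n}"])
  obtain N :: nat where N: "absv z < real N" using reals_Archimedean2 by blast
  have N0: "N > 0" using N absv_nonneg[of z] by (intro gr0I) (auto simp: not_less[symmetric])
  define C where "C = absv (?p (B N))"
  have outside: "absv (z / \<mu>) \<le> absv z / real n" if "\<mu> \<in> ?A - B n" "n \<ge> N" for \<mu> n
  proof -
    have "real n < absv \<mu>" using that by (auto simp: B_def)
    thus ?thesis using that N0 unfolding absv_divide by (intro divide_left_mono) auto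
  qed
  have mono: "B n \<subseteq> B m" if "n \<le> m" for n m using that by (auto simp: B_def)
  have absC: "absv (?p F) = C" if F: "finite F" "B N \<subseteq> F" "F \<subseteq> ?A" for F
  proof -
    have "absv (1 - z / \<mu>) = 1" if "\<mu> \<in> F - B N" for \<mu>
    proof -
      have "absv (z / \<mu>) \<le> absv z / real N" using outside[of \<mu> N] that F by blast
      also have "\<dots> < 1" using N N0 by simp
      finally show ?thesis using absv_diff_eq[of "z / \<mu>" 1] by (simp add: absv_diff_commute)
    qed
    hence "absv (?p (F - B N)) = 1" by (simp add: absv_prod)
    moreover have "?p F = ?p (F - B N) * ?p (B N)" using F by (simp add: prod.subset_diff)
    ultimately show ?thesis by (simp add: C_def absv_mult)
  qed
  have close: "absv (?p F - ?p (B n)) \<le> C * absv z / real n"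
    if F: "finite F" "B n \<subseteq> F" "F \<subseteq> ?A" and n: "n \<ge> N" for F n
  proof -
    have "absv (?p (F - B n) - 1) \<le> absv z / real n"
    proof (rule absv_prod_one_minus)
      show "absv (z / i) \<le> absv z / real n" if "i \<in> F - B n" for i
        using outside[of i n] that F n by blast
      show "absv z / real n \<le> 1" using N n N0 by simp
    qed simp
    hence "absv (?p (F - B n) - 1) * absv (?p (B n)) \<le> absv z / real n * C"
      using absC[of "B n"] finB mono[OF n] by (intro mult_mono) (auto simp: B_def)
    moreover have "?p F - ?p (B n) = (?p (F - B n) - 1) * ?p (B n)"
      using F by (simp add: prod.subset_diff[of "B n" F] algebra_simps)
    ultimately show ?thesis by (simp add: absv_mult mult.commute)
  qed
  have to0: "(\<lambda>n. C * absv z / real n) \<longlonglongrightarrow> 0"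
    by (rule lim_const_over_n)
  have "convergent (\<lambda>n. ?p (B n))"
  proof (rule C_cauchyI)
    fix e :: real assume "e > 0"
    then obtain M where M: "\<And>n. n \<ge> M \<Longrightarrow> C * absv z / real n < e"
      using order_tendstoD(2)[OF to0] unfolding eventually_sequentially by blast
    let ?M = "max M N"
    have "absv (?p (B m) - ?p (B n)) < e" if "m \<ge> ?M" "n \<ge> ?M" for m n
    proof -
      have "absv (?p (B k) - ?p (B ?M)) < e" if "k \<ge> ?M" for k
      proof -
        have "absv (?p (B k) - ?p (B ?M)) \<le> C * absv z / real ?M"
          by (rule close) (use finB mono[OF that] in \<open>auto simp: B_def\<close>)
        also have "\<dots> < e" by (rule M) simp
        finally show ?thesis .
      qed
      hence "absv ((?p (B m) - ?p (B ?M)) - (?p (B n) - ?p (B ?M))) < e"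
        using absv_diff[of "?p (B m) - ?p (B ?M)" "?p (B n) - ?p (B ?M)"] that
        by (simp only: max_less_iff_conj le_less_trans)
      thus ?thesis by simp
    qed
    thus "\<exists>M. \<forall>m\<ge>M. \<forall>n\<ge>M. absv (?p (B m) - ?p (B n)) < e" by blast
  qed
  then obtain l where l: "(\<lambda>n. ?p (B n)) \<longlonglongrightarrow> l" by (auto simp: convergent_def)
  have l_close: "absv (?p (B n) - l) \<le> C * absv z / real n" if "n \<ge> N" for n
  proof (rule tendsto_upperbound)
    show "(\<lambda>m. absv (?p (B n) - ?p (B m))) \<longlonglongrightarrow> absv (?p (B n) - l)"
      by (intro absv_tendsto C_tendsto_diff tendsto_const l)
    show "\<forall>\<^sub>F m in sequentially. absv (?p (B n) - ?p (B m)) \<le> C * absv z / real n"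
      using eventually_ge_at_top[of n]
    proof eventually_elim
      case (elim m)
      have "absv (?p (B m) - ?p (B n)) \<le> C * absv z / real n"
        by (rule close) (use finB mono[OF elim] that in \<open>auto simp: B_def\<close>)
      thus ?case by (simp only: absv_diff_commute)
    qed
  qed simp
  have lim: "(?p \<longlongrightarrow> l) (finite_subsets_at_top ?A)"
    unfolding tendsto_iff dist_absv
  proof (intro allI impI)
    fix e :: real assume "e > 0"
    then obtain M where M: "\<And>n. n \<ge> M \<Longrightarrow> C * absv z / real n < e"
      using order_tendstoD(2)[OF to0] unfolding eventually_sequentially by blast
    let ?M = "max M N"
    have "absv (?p Y - l) < e" if "finite Y" "B ?M \<subseteq> Y" "Y \<subseteq> ?A" for Y
      using absv_add[of "?p Y - ?p (B ?M)" "?p (B ?M) - l"] close[OF that, simplified] l_close[of ?M] M[of ?M]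
      by simp
    thus "\<forall>\<^sub>F F in finite_subsets_at_top ?A. absv (?p F - l) < e"
      unfolding eventually_finite_subsets_at_top
      by (intro exI[of _ "B ?M"]) (use finB in \<open>auto simp: B_def\<close>)
  qed
  have "(\<lambda>n. absv (?p (B n))) \<longlonglongrightarrow> C"
  proof (rule tendsto_eventually)
    show "\<forall>\<^sub>F n in sequentially. absv (?p (B n)) = C"
      using eventually_ge_at_top[of N]
      by eventually_elim (rule absC, use finB mono in \<open>auto simp: B_def\<close>)
  qed
  \<comment> \<open>A product of nonzero factors could tend to 0; the constant absolute value C
    excludes this, so the limit vanishes only if one of the finitely many factors over
    \<open>B N\<close> does.\<close>
  hence "absv l = C" using absv_tendsto[OF l] by (intro LIMSEQ_unique)
  hence "l = 0 \<longleftrightarrow> ?p (B N) = 0" by (metis C_def absv_eq_0_iff)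
  also have "\<dots> \<longleftrightarrow> z \<in> ?A"
    using finB[of N] N by (auto simp: B_def prod_zero_iff)
  finally have zero: "l = 0 \<longleftrightarrow> z \<in> ?A" .
  have "absv (l - 1) \<le> d" if d: "0 \<le> d" "d \<le> 1" "\<And>\<mu>. \<mu> \<in> ?A \<Longrightarrow> absv (z / \<mu>) \<le> d" for d
  proof (rule tendsto_upperbound)
    show "(\<lambda>n. absv (?p (B n) - 1)) \<longlonglongrightarrow> absv (l - 1)"
      by (intro absv_tendsto C_tendsto_diff tendsto_const l)
    show "\<forall>\<^sub>F n in sequentially. absv (?p (B n) - 1) \<le> d"
      by (intro always_eventually allI absv_prod_one_minus) (use d in \<open>auto simp: B_def\<close>)
  qed simp
  thus ?thesis using that lim zero by blast
qed

lemma tendsto_lattice_exp: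
  assumes "locally_finite \<Lambda>"
  shows "((\<lambda>F. z * (\<Prod>\<mu>\<in>F. 1 - z / \<mu>)) \<longlongrightarrow> lattice_exp \<Lambda> z) (finite_subsets_at_top (\<Lambda> - {0}))"
proof -
  obtain l where l: "((\<lambda>F. \<Prod>\<mu>\<in>F. 1 - z / \<mu>) \<longlongrightarrow> l) (finite_subsets_at_top (\<Lambda> - {0}))"
    by (rule lattice_product[OF assms, of z])
  hence "Lim (finite_subsets_at_top (\<Lambda> - {0})) (\<lambda>F. \<Prod>\<mu>\<in>F. 1 - z / \<mu>) = l"
    by (intro tendsto_Lim) auto
  thus ?thesis using C_tendsto_cmult[OF l, of z] by (simp add: lattice_exp_def)
qed

lemma lattice_exp_eq_0_iff:
  assumes "locally_finite \<Lambda>" "0 \<in> \<Lambda>"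
  shows "lattice_exp \<Lambda> z = 0 \<longleftrightarrow> z \<in> \<Lambda>"
proof -
  obtain l where l: "((\<lambda>F. \<Prod>\<mu>\<in>F. 1 - z / \<mu>) \<longlongrightarrow> l) (finite_subsets_at_top (\<Lambda> - {0}))"
    "l = 0 \<longleftrightarrow> z \<in> \<Lambda> - {0}"
    by (rule lattice_product[OF assms(1), of z])
  hence "Lim (finite_subsets_at_top (\<Lambda> - {0})) (\<lambda>F. \<Prod>\<mu>\<in>F. 1 - z / \<mu>) = l"
    by (intro tendsto_Lim) auto
  thus ?thesis using l(2) assms(2) by (auto simp: lattice_exp_def)
qed

lemma lattice_exp_close:
  assumes "locally_finite \<Lambda>" "\<And>\<mu>. \<mu> \<in> \<Lambda> - {0} \<Longrightarrow> absv (z / \<mu>) \<le> d" "0 \<le> d" "d \<le> 1"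
  shows "absv (lattice_exp \<Lambda> z - z) \<le> absv z * d"
proof -
  obtain l where l: "((\<lambda>F. \<Prod>\<mu>\<in>F. 1 - z / \<mu>) \<longlongrightarrow> l) (finite_subsets_at_top (\<Lambda> - {0}))"
    "absv (l - 1) \<le> d"
    by (rule lattice_product[OF assms(1), of z]) (use assms in blast)
  have "Lim (finite_subsets_at_top (\<Lambda> - {0})) (\<lambda>F. \<Prod>\<mu>\<in>F. 1 - z / \<mu>) = l"
    by (intro tendsto_Lim l) auto
  hence "lattice_exp \<Lambda> z - z = z * (l - 1)" by (simp add: lattice_exp_def algebra_simps)
  thus ?thesis using l(2) by (simp add: absv_mult mult_left_mono)
qed

text \<open>The product is a limit over all finite subsets, so every exhausting sequence of finite
  sets computes it. This leaves the shape of the sets free to be adapted to each purpose.\<close>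

lemma fexp_tendsto_lattice_exp:
  assumes \<Lambda>: "locally_finite \<Lambda>" and V: "\<And>m::nat. finite (V m)" "\<And>m. V m \<subseteq> \<Lambda>"
    and ex: "\<And>\<mu>. \<mu> \<in> \<Lambda> \<Longrightarrow> \<forall>\<^sub>F m in sequentially. \<mu> \<in> V m"
  shows "(\<lambda>m. fexp (V m) z) \<longlonglongrightarrow> lattice_exp \<Lambda> z"
proof -
  have "filterlim (\<lambda>m. V m - {0}) (finite_subsets_at_top (\<Lambda> - {0})) sequentially"
    unfolding filterlim_finite_subsets_at_top
  proof (intro allI impI)
    fix Y assume Y: "finite Y \<and> Y \<subseteq> \<Lambda> - {0}"
    hence "\<forall>\<^sub>F m in sequentially. \<forall>\<mu>\<in>Y. \<mu> \<in> V m"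
      using ex by (intro eventually_ball_finite) auto
    thus "\<forall>\<^sub>F m in sequentially. finite (V m - {0}) \<and> Y \<subseteq> V m - {0} \<and> V m - {0} \<subseteq> \<Lambda> - {0}"
      by eventually_elim (use Y V in auto)
  qed
  from filterlim_compose[OF tendsto_lattice_exp[OF \<Lambda>, of z] this]
  show ?thesis by (simp add: fexp_def)
qed

section \<open>Polynomials with values in a subfield\<close>

lemma infinite_C: "infinite (UNIV :: 'c set)"
  using infinite_K_inf finite_subset[OF subset_UNIV] by blast

lemma C_poly_eqI:
  fixes p p' :: "'c poly"
  assumes "\<And>x. poly p x = poly p' x"
  shows "p = p'"
proof (rule ccontr)
  assume "p \<noteq> p'"
  hence "finite {x. poly (p - p') x = 0}" by (intro poly_roots_finite) simp
  thus False using assms infinite_C by simp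
qed

text \<open>Newton interpolation, one node at a time: dividing p - p(x0) by X - x0 leaves a quotient
  of smaller degree that again takes values in L at infinitely many points of L.\<close>

lemma coeff_in_subfield:
  fixes p :: "'c poly"
  assumes L: "subfield L RC" and inf: "infinite {x \<in> L. poly p x \<in> L}"
  shows "Polynomial.coeff p i \<in> L"
  using inf
proof (induction "Polynomial.degree p" arbitrary: p i)
  case 0
  then obtain c where c: "p = [:c:]" by (metis degree_eq_zeroE)
  obtain x where "x \<in> L" "poly p x \<in> L" using 0 by (metis (mono_tags, lifting) empty_Collect_eq finite.emptyI)
  hence "c \<in> L" by (simp add: c)
  thus ?case using subfieldD(1)[OF L] by (simp add: c coeff_pCons split: nat.splits)
next
  case (Suc n)
  obtain x0 where x0: "x0 \<in> L" "poly p x0 \<in> L"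
    using Suc by (metis (mono_tags, lifting) empty_Collect_eq finite.emptyI)
  define s where "s = synthetic_div p x0"
  have p: "p = [:- x0, 1:] * s + [:poly p x0:]"
    using synthetic_div_correct'[of x0 p] by (simp add: s_def)
  have "infinite ({x \<in> L. poly p x \<in> L} - {x0})" using Suc by simp
  moreover have "{x \<in> L. poly p x \<in> L} - {x0} \<subseteq> {x \<in> L. poly s x \<in> L}"
  proof
    fix x assume x: "x \<in> {x \<in> L. poly p x \<in> L} - {x0}"
    have "poly p x = (x - x0) * poly s x + poly p x0" by (subst p) (simp add: left_diff_distrib)
    hence "poly s x = (poly p x - poly p x0) / (x - x0)" using x by (simp add: field_simps)
    thus "x \<in> {x \<in> L. poly s x \<in> L}" using x x0 subfieldD(6,8)[OF L] by auto
  qed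
  ultimately have "infinite {x \<in> L. poly s x \<in> L}" using finite_subset by blast
  moreover have "n = Polynomial.degree s" using Suc(2) by (simp add: s_def degree_synthetic_div)
  ultimately have s: "Polynomial.coeff s i \<in> L" for i using Suc(1) by blast
  have "Polynomial.coeff p i = Polynomial.coeff ([:- x0, 1:] * s + [:poly p x0:]) i" using p by simp
  also have "\<dots> = - x0 * Polynomial.coeff s i + Polynomial.coeff (pCons 0 s) i + Polynomial.coeff [:poly p x0:] i"
    by simp
  also have "\<dots> \<in> L"
    using s x0 subfieldD[OF L] by (auto simp: coeff_pCons split: nat.splits intro!: subfieldD[OF L])
  finally show ?case .
qed

lemma emb_A_conv_poly: "emb_A j a = poly (map_poly sc a) TT"
  by (induction a) (auto simp: emb_A_pCons map_poly_pCons)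

lemma emb_A_altdef: "emb_A j a = (\<Sum>i\<le>Polynomial.degree a. sc (Polynomial.coeff a i) * TT ^ i)"
proof -
  have "Polynomial.degree (map_poly sc a) = Polynomial.degree a"
    by (rule degree_map_poly) simp
  thus ?thesis by (simp add: emb_A_conv_poly poly_altdef coeff_map_poly)
qed

lemma fexp_in_subfield:
  assumes "subfield M RC" "V \<subseteq> M" "z \<in> M"
  shows "fexp V z \<in> M"
  unfolding fexp_def
proof (intro subfieldD(4)[OF assms(1)] subfield_prod[OF assms(1)] assms)
  fix v assume "v \<in> V - {0}"
  hence "z / v \<in> M" using assms by (intro subfieldD(8)[OF assms(1)]) auto
  thus "1 - z / v \<in> M" using subfieldD(2,6)[OF assms(1)] by blast
qed

subsection \<open>Algebraic elements and ramification\<close>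

lemma eval_rev: "RC.eval (rev cs) x = poly (Poly cs) x"
proof (induction cs)
  case (Cons c cs)
  thus ?case by (simp add: RC.eval_append_aux mult.commute add.commute)
qed simp

lemma algebraic_iff_root:
  assumes L: "subfield L RC"
  shows "(RC.algebraic over L) x \<longleftrightarrow> (\<exists>p. p \<noteq> 0 \<and> (\<forall>i. Polynomial.coeff p i \<in> L) \<and> poly p x = 0)"
proof
  assume "(RC.algebraic over L) x"
  then obtain p where p: "p \<in> carrier (L[X]\<^bsub>RC\<^esub>)" "p \<noteq> []" "RC.eval p x = \<zero>\<^bsub>RC\<^esub>"
    by (rule RC.algebraicE[OF subfieldE(1)[OF L], rotated]) auto
  hence pol: "set p \<subseteq> L" "hd p \<noteq> 0"
    by (auto simp: univ_poly_carrier[symmetric] polynomial_def)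
  have "Poly (rev p) \<noteq> 0"
  proof
    assume "Poly (rev p) = 0"
    then obtain n where "rev p = replicate n 0" by (auto simp: Poly_eq_0)
    hence "set (rev p) \<subseteq> {0}" by auto
    hence "hd p = 0" using hd_in_set[OF p(2)] by (simp only: set_rev subset_iff singleton_iff)
    thus False using pol(2) by contradiction
  qed
  moreover have "Polynomial.coeff (Poly (rev p)) i \<in> L" for i
    using pol(1) subfieldD(1)[OF L] nth_mem[of i "rev p"] by (auto simp: coeff_Poly_eq nth_default_def)
  moreover have "poly (Poly (rev p)) x = 0" using p(3) eval_rev[of "rev p" x] by simp
  ultimately show "\<exists>p. p \<noteq> 0 \<and> (\<forall>i. Polynomial.coeff p i \<in> L) \<and> poly p x = 0" by blast
next
  assume "\<exists>p. p \<noteq> 0 \<and> (\<forall>i. Polynomial.coeff p i \<in> L) \<and> poly p x = 0"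
  then obtain p where p: "p \<noteq> 0" "\<And>i. Polynomial.coeff p i \<in> L" "poly p x = 0" by blast
  have ne: "coeffs p \<noteq> []" using p(1) by simp
  have "hd (rev (coeffs p)) \<noteq> 0" using p(1) ne by (simp add: hd_rev last_coeffs_eq_coeff_degree)
  moreover have "set (coeffs p) \<subseteq> L" using p(2) by (auto simp: coeffs_def)
  ultimately have "rev (coeffs p) \<in> carrier (L[X]\<^bsub>RC\<^esub>)"
    by (simp add: univ_poly_carrier[symmetric] polynomial_def)
  thus "(RC.algebraic over L) x"
    using ne p(3) by (intro RC.algebraicI[of "rev (coeffs p)"]) (auto simp: eval_rev)
qed

lemma poly_map_j_pCons: "poly (map_poly j (pCons a p)) x = j a + x * poly (map_poly j p) x"
  by (simp add: map_poly_pCons)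
lemma poly_map_j_add: "poly (map_poly j (p + p')) x = poly (map_poly j p) x + poly (map_poly j p') x"
proof (induction p arbitrary: p')
  case (pCons a p)
  obtain a' p'' where "p' = pCons a' p''" by (cases p')
  thus ?case by (simp add: poly_map_j_pCons pCons.IH j_add distrib_left)
qed simp
lemma poly_map_j_smult: "poly (map_poly j (Polynomial.smult a p)) x = j a * poly (map_poly j p) x"
  by (induction p) (auto simp: poly_map_j_pCons j_mult distrib_left mult_ac)
lemma poly_map_j_mult: "poly (map_poly j (p * p')) x = poly (map_poly j p) x * poly (map_poly j p') x"
  by (induction p) (auto simp: poly_map_j_pCons poly_map_j_add poly_map_j_smult algebra_simps)

lemma root_in_range_j:
  assumes "p \<noteq> 0" "poly (map_poly j p) x = 0"
  shows "x \<in> range j"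
  using assms
proof (induction "Polynomial.degree p" arbitrary: p)
  case 0
  then obtain c where "p = [:c:]" by (metis degree_eq_zeroE)
  thus ?case using 0 by (simp add: map_poly_pCons)
next
  case (Suc n)
  obtain a where a: "poly p a = 0"
    using alg_closed_imp_poly_has_root[of p] Suc(2) by auto
  then obtain s where s: "p = [:- a, 1:] * s" by (metis dvdE poly_eq_0_iff_dvd)
  have "s \<noteq> 0" using Suc(3) s by auto
  have "(x - j a) * poly (map_poly j s) x = 0"
    using Suc(4) unfolding s poly_map_j_mult by (simp add: poly_map_j_pCons j_uminus)
  hence "x = j a \<or> poly (map_poly j s) x = 0" by simp
  moreover have "n = Polynomial.degree s" using Suc(2) \<open>s \<noteq> 0\<close> unfolding s by (subst (asm) degree_mult_eq) auto
  ultimately show ?case using Suc(1)[of s] \<open>s \<noteq> 0\<close> by auto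
qed

text \<open>L is algebraic over \<open>K_inf j\<close>, and the image of the algebraic closure
  contains all roots of polynomials over it. So the right-hand side c of \<open>e_n(w) = c\<close>
  has a preimage under \<open>j\<close>, and the equation can be solved in the algebraic
  closure.\<close>

lemma finite_extension_subset_range_j:
  assumes "finite_extension (K_inf j) L"
  shows "L \<subseteq> range j"
proof
  fix x assume x: "x \<in> L"
  have fe: "subfield L RC" "RC.finite_dimension (K_inf j) L"
    using assms by (auto simp: finite_extension_def)
  have "(RC.algebraic over K_inf j) x"
    using RC.finite_dimension_imp_algebraic[OF subfield_K_inf subfieldE(1)[OF fe(1)] fe(2) x] .
  then obtain p where p: "p \<noteq> 0" "\<And>i. Polynomial.coeff p i \<in> K_inf j" "poly p x = 0"
    unfolding algebraic_iff_root[OF subfield_K_inf] by blast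
  have "\<forall>i. \<exists>y. j y = Polynomial.coeff p i"
  proof
    fix i
    obtain y where "Polynomial.coeff p i = emb_K j y" using p(2)[of i] by (auto simp: K_inf_def)
    thus "\<exists>y. j y = Polynomial.coeff p i" by (metis emb_K_def)
  qed
  then obtain g where g: "\<And>i. j (g i) = Polynomial.coeff p i" by metis
  define p' where "p' = Poly (map g [0..<Suc (Polynomial.degree p)])"
  have "map_poly j p' = p"
  proof (rule poly_eqI)
    fix i
    show "Polynomial.coeff (map_poly j p') i = Polynomial.coeff p i"
      by (auto simp: p'_def coeff_map_poly coeff_Poly_eq nth_default_def g coeff_eq_0 simp del: upt_Suc)
  qed
  thus "x \<in> range j" using root_in_range_j[of p' x] p by (cases "p' = 0") auto
qed

lemma finite_dimension_subfield:
  assumes "subfield L RC" "RC.finite_dimension L M" "subfield M' RC" "L \<subseteq> M'" "M' \<subseteq> M"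
  shows "RC.finite_dimension L M'"
  by (rule RC.subalbegra_incl_imp_finite_dimension[OF assms(1,2) subfield_subalgebra assms(5)])
     (use assms in auto)

lemma subfield_adjoin: "subfield (adjoin L S) RC" and adjoin_supset: "L \<union> S \<subseteq> adjoin L S"
  unfolding adjoin_def using RC.generate_field_is_subfield[of "L \<union> S"]
  by (auto intro: generate_field.incl)

lemma adjoin_minimal: "subfield M RC \<Longrightarrow> L \<subseteq> M \<Longrightarrow> S \<subseteq> M \<Longrightarrow> adjoin L S \<subseteq> M"
  unfolding adjoin_def by (rule RC.generate_field_min_subfield1) auto

text \<open>S may be infinite, as a lattice is; it only has to lie in every field that contains L
  and the finitely many algebraic elements \<open>xs\<close>.\<close>

lemma finite_extension_adjoin:
  assumes L: "subfield L RC" and xs: "\<And>x. x \<in> set xs \<Longrightarrow> (RC.algebraic over L) x"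
    and S: "\<And>M. subfield M RC \<Longrightarrow> L \<subseteq> M \<Longrightarrow> set xs \<subseteq> M \<Longrightarrow> S \<subseteq> M"
  shows "finite_extension L (adjoin L S)"
proof -
  let ?F = "RC.finite_extension L xs"
  have F: "subfield ?F RC" "RC.finite_dimension L ?F"
    using RC.finite_extension_is_subfield[OF L, of xs] RC.finite_extension_finite_dimension(1)[OF L, of xs] xs
    by auto
  have LF: "L \<subseteq> ?F" "set xs \<subseteq> ?F"
    using RC.finite_extension_incl[of L xs] RC.finite_extension_mem[OF subfieldE(1)[OF L], of xs] by auto
  have "adjoin L S \<subseteq> ?F" by (intro adjoin_minimal F LF S)
  thus ?thesis unfolding finite_extension_def
    using L subfield_adjoin adjoin_supset[of L S] finite_dimension_subfield[OF L F(2), of "adjoin L S"] by auto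
qed

section \<open>Value groups and the ramification index\<close>

definition absv_group :: "'c set \<Rightarrow> real set" where
  "absv_group L = absv ` (L - {0})"

lemma absv_groupD:
  assumes "subfield L RC"
  shows "1 \<in> absv_group L" "x \<in> absv_group L \<Longrightarrow> y \<in> absv_group L \<Longrightarrow> x * y \<in> absv_group L"
    "x \<in> absv_group L \<Longrightarrow> y \<in> absv_group L \<Longrightarrow> x / y \<in> absv_group L"
    "x \<in> absv_group L \<Longrightarrow> x > 0" "x \<in> absv_group L \<Longrightarrow> inverse x \<in> absv_group L"
proof -
  show "1 \<in> absv_group L" using subfieldD(2)[OF assms] unfolding absv_group_def by (intro image_eqI[of _ _ 1]) auto
  show "x * y \<in> absv_group L" if "x \<in> absv_group L" "y \<in> absv_group L"
    using that subfieldD(4)[OF assms] unfolding absv_group_def by (auto simp flip: absv_mult)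
  show d: "x / y \<in> absv_group L" if "x \<in> absv_group L" "y \<in> absv_group L" for x y
    using that subfieldD(8)[OF assms] unfolding absv_group_def by (auto simp flip: absv_divide)
  show "x > 0" if "x \<in> absv_group L" using that by (auto simp: absv_group_def)
  show "inverse x \<in> absv_group L" if "x \<in> absv_group L"
    using d[OF \<open>1 \<in> absv_group L\<close> that] by (simp add: inverse_eq_divide)
qed

lemma absv_group_power: "subfield L RC \<Longrightarrow> x \<in> absv_group L \<Longrightarrow> x ^ n \<in> absv_group L"
  by (induction n) (auto intro: absv_groupD)

definition distinct_classes :: "'c set \<Rightarrow> 'c list \<Rightarrow> bool" where
  "distinct_classes L us \<longleftrightarrow> 0 \<notin> set us \<and> sorted_wrt (\<lambda>u v. absv u / absv v \<notin> absv_group L) us"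

text \<open>In k u + v with both terms nonzero, |v| lies in the class of a later list element by
  induction, so it differs from |k u| and the larger term determines the absolute value.
  Consequently elements from different classes are linearly independent.\<close>

lemma absv_Span_distinct_classes:
  assumes L: "subfield L RC" and "distinct_classes L us" "y \<in> RC.Span L us" "y \<noteq> 0"
  shows "\<exists>u\<in>set us. \<exists>g\<in>absv_group L. absv y = g * absv u"
  using assms(2-)
proof (induction us arbitrary: y)
  case (Cons u us)
  have "y \<in> RC.line_extension L u (RC.Span L us)" using Cons.prems by simp
  then obtain k v where kv: "k \<in> L" "v \<in> RC.Span L us" "y = k * u + v"
    unfolding line_extension_RC by blast
  have dc: "distinct_classes L us" "u \<noteq> 0" "\<And>v. v \<in> set us \<Longrightarrow> absv u / absv v \<notin> absv_group L \<and> v \<noteq> 0"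
    using Cons.prems by (auto simp: distinct_classes_def)
  have IH: "\<exists>u\<in>set us. \<exists>g\<in>absv_group L. absv v = g * absv u" if "v \<noteq> 0"
    using Cons.IH[OF dc(1) kv(2) that] .
  have ku: "k \<noteq> 0 \<Longrightarrow> absv k \<in> absv_group L" using kv by (auto simp: absv_group_def)
  consider "k = 0" | "k \<noteq> 0" "v = 0" | "k \<noteq> 0" "v \<noteq> 0" by blast
  thus ?case
  proof cases
    case 1
    thus ?thesis using IH Cons.prems kv by auto
  next
    case 2
    thus ?thesis using kv ku by (auto simp: absv_mult)
  next
    case 3
    then obtain u' g where u': "u' \<in> set us" "g \<in> absv_group L" "absv v = g * absv u'" using IH by blast
    have "absv (k * u) \<noteq> absv v"
    proof
      assume "absv (k * u) = absv v"
      hence "absv u / absv u' = g / absv k" using u' 3 dc(3)[OF u'(1)] by (simp add: absv_mult field_simps)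
      thus False using absv_groupD(3)[OF L u'(2) ku[OF 3(1)]] dc(3)[OF u'(1)] by simp
    qed
    then consider "absv (k * u) < absv v" | "absv v < absv (k * u)" by linarith
    thus ?thesis
    proof cases
      case 1
      thus ?thesis using absv_add_eq[OF 1] u' kv by auto
    next
      case 2
      hence "absv y = absv k * absv u" using absv_add_eq[OF 2] kv by (simp add: absv_mult add.commute)
      thus ?thesis using ku 3 by auto
    qed
  qed
qed simp

lemma distinct_classes_independent:
  assumes L: "subfield L RC" and "distinct_classes L us"
  shows "RC.independent L us"
  using assms(2)
proof (induction us)
  case (Cons u us)
  have dc: "distinct_classes L us" "u \<noteq> 0" "\<And>v. v \<in> set us \<Longrightarrow> absv u / absv v \<notin> absv_group L \<and> v \<noteq> 0"
    using Cons.prems by (auto simp: distinct_classes_def)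
  have "u \<notin> RC.Span L us"
  proof
    assume "u \<in> RC.Span L us"
    then obtain v g where v: "v \<in> set us" "g \<in> absv_group L" "absv u = g * absv v"
      using absv_Span_distinct_classes[OF L dc(1) _ dc(2)] by blast
    hence "absv u / absv v = g" using dc(3) by auto
    thus False using dc(3)[OF v(1)] v(2) by simp
  qed
  thus ?case using Cons.IH[OF dc(1)] by (intro RC.li_Cons) auto
qed auto

lemma finite_extension_dimension:
  fixes L M :: "'c set"
  assumes "finite_extension L M"
  shows "RC.dimension (ext_degree L M) L M"
proof -
  have "subfield L RC" "RC.finite_dimension L M" using assms by (auto simp: finite_extension_def)
  from RC.finite_dimensionE[OF this] show ?thesis by (simp add: ext_degree_def over_def)
qed

lemma rcosets_value_group:
  "rcosets\<^bsub>value_group M\<^esub> carrier (value_group L) = (\<lambda>m. (\<lambda>h. h * absv m) ` absv_group L) ` (M - {0})"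
  by (auto simp: RCOSETS_def r_coset_def value_group_def absv_group_def)

lemma coset_eq_iff:
  assumes L: "subfield L RC" and "u \<noteq> (0 :: 'c)" "v \<noteq> (0 :: 'c)"
  shows "(\<lambda>h. h * absv u) ` absv_group L = (\<lambda>h. h * absv v) ` absv_group L \<longleftrightarrow> absv u / absv v \<in> absv_group L"
proof
  assume eq: "(\<lambda>h. h * absv u) ` absv_group L = (\<lambda>h. h * absv v) ` absv_group L"
  have "absv u \<in> (\<lambda>h. h * absv u) ` absv_group L"
    using absv_groupD(1)[OF L] by (intro image_eqI[of _ _ 1]) auto
  then obtain h where "h \<in> absv_group L" "absv u = h * absv v" unfolding eq by auto
  thus "absv u / absv v \<in> absv_group L" using assms by simp
next
  have sub: "(\<lambda>h. h * absv u) ` absv_group L \<subseteq> (\<lambda>h. h * absv v) ` absv_group L"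
    if g: "absv u / absv v \<in> absv_group L" and "v \<noteq> 0" for u v :: 'c
  proof
    fix x assume "x \<in> (\<lambda>h. h * absv u) ` absv_group L"
    then obtain h where h: "h \<in> absv_group L" "x = h * absv u" by blast
    have "x = (h * (absv u / absv v)) * absv v" using h that by simp
    thus "x \<in> (\<lambda>h. h * absv v) ` absv_group L" using absv_groupD(2)[OF L h(1) g] by blast
  qed
  assume g: "absv u / absv v \<in> absv_group L"
  hence "absv v / absv u \<in> absv_group L" using absv_groupD(5)[OF L g] by simp
  thus "(\<lambda>h. h * absv u) ` absv_group L = (\<lambda>h. h * absv v) ` absv_group L"
    using sub[OF g] sub[of v u] assms by blast
qed

text \<open>Representatives of different cosets are linearly independent over L, so any finite set
  of cosets has at most [M:L] elements. Finiteness is stated too because \<open>card\<close> of an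
  infinite set is 0, which would spoil lower bounds for the ramification index.\<close>

lemma finite_rcosets_value_group:
  fixes L M :: "'c set"
  assumes fe: "finite_extension L M"
  defines "R \<equiv> rcosets\<^bsub>value_group M\<^esub> carrier (value_group L)"
  shows "finite R \<and> card R \<le> ext_degree L M"
proof (rule finite_if_finite_subsets_card_bdd)
  have L: "subfield L RC" using fe by (simp add: finite_extension_def)
  fix G assume G: "G \<subseteq> R" "finite G"
  let ?cl = "\<lambda>m. (\<lambda>h. h * absv m) ` absv_group L"
  have "\<forall>D\<in>G. \<exists>m. m \<in> M - {0} \<and> D = ?cl m"
    using G(1) unfolding R_def rcosets_value_group by blast
  then obtain rep where rep: "\<And>D. D \<in> G \<Longrightarrow> rep D \<in> M - {0}" "\<And>D. D \<in> G \<Longrightarrow> D = ?cl (rep D)"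
    by metis
  obtain Ds where Ds: "set Ds = G" "distinct Ds" using finite_distinct_list[OF G(2)] by blast
  have "sorted_wrt (\<noteq>) Ds" using Ds(2) by (simp add: sorted_wrt_iff_nth_less nth_eq_iff_index_eq)
  hence "sorted_wrt (\<lambda>D D'. absv (rep D) / absv (rep D') \<notin> absv_group L) Ds"
  proof (rule sorted_wrt_mono_rel[rotated])
    fix D D' assume D: "D \<in> set Ds" "D' \<in> set Ds" "D \<noteq> D'"
    hence DG: "D \<in> G" "D' \<in> G" using Ds by auto
    hence "?cl (rep D) \<noteq> ?cl (rep D')" using rep(2)[OF DG(1)] rep(2)[OF DG(2)] D(3) by simp
    thus "absv (rep D) / absv (rep D') \<notin> absv_group L"
      using coset_eq_iff[OF L, of "rep D" "rep D'"] rep(1)[OF DG(1)] rep(1)[OF DG(2)] by auto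
  qed
  hence "distinct_classes L (map rep Ds)"
    using rep(1) Ds(1) by (auto simp: distinct_classes_def sorted_wrt_map)
  hence "RC.independent L (map rep Ds)" by (rule distinct_classes_independent[OF L])
  moreover have "set (map rep Ds) \<subseteq> M" using rep(1) Ds(1) by auto
  ultimately have "length (map rep Ds) \<le> ext_degree L M"
    by (rule RC.independent_length_le_dimension[OF L finite_extension_dimension[OF fe]])
  thus "card G \<le> ext_degree L M" using Ds distinct_card by fastforce
qed

lemma ramification_index_le_ext_degree:
  fixes L M :: "'c set"
  shows "finite_extension L M \<Longrightarrow> ramification_index L M \<le> ext_degree L M"
  using finite_rcosets_value_group[of L M] unfolding ramification_index_def by blast

lemma ramification_index_ge:
  fixes L M :: "'c set"
  assumes fe: "finite_extension L M" and x: "x \<in> M" "x \<noteq> 0"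
    and pow: "\<And>e. 0 < e \<Longrightarrow> e < n \<Longrightarrow> absv x ^ e \<notin> absv_group L"
  shows "n \<le> ramification_index L M"
proof -
  have L: "subfield L RC" and M: "subfield M RC" using fe by (auto simp: finite_extension_def)
  let ?cl = "\<lambda>i. (\<lambda>h. h * absv (x ^ i)) ` absv_group L"
  have ne: "?cl i \<noteq> ?cl k" if "i < k" "k < n" for i k
  proof
    assume "?cl i = ?cl k"
    hence "absv (x ^ k) / absv (x ^ i) \<in> absv_group L"
      using coset_eq_iff[OF L, of "x ^ k" "x ^ i"] x(2) by simp
    moreover have "absv (x ^ k) / absv (x ^ i) = absv x ^ (k - i)"
      using that x(2) by (simp add: absv_power power_diff)
    ultimately show False using pow[of "k - i"] that by simp
  qed
  have "inj_on ?cl {..<n}"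
    by (rule linorder_inj_onI) (use ne in auto)
  hence "n = card (?cl ` {..<n})" by (simp add: card_image)
  also have "\<dots> \<le> card (rcosets\<^bsub>value_group M\<^esub> carrier (value_group L))"
  proof (rule card_mono)
    show "finite (rcosets\<^bsub>value_group M\<^esub> carrier (value_group L))"
      using finite_rcosets_value_group[OF fe] by blast
    show "?cl ` {..<n} \<subseteq> rcosets\<^bsub>value_group M\<^esub> carrier (value_group L)"
      unfolding rcosets_value_group using x subfield_power[OF M x(1)] by (auto intro!: imageI)
  qed
  finally show ?thesis by (simp add: ramification_index_def)
qed

subsection \<open>The polynomials \<open>e\<^sub>n\<close>\<close>

text \<open>The elements of A of degree < n, so \<open>vanishing (AA n)\<close> is the polynomial
  function \<open>e_n\<close>.\<close>

definition AA :: "nat \<Rightarrow> 'c set" where "AA n = emb_A j ` bounded_polys n"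

lemma inj_emb_A: "inj (emb_A j)"
  by (rule injI) (metis emb_A_diff emb_A_eq_0_iff right_minus_eq)

lemma finite_AA [simp]: "finite (AA n)" by (simp add: AA_def)

lemma card_AA: "card (AA n) = CARD('k) ^ n"
  unfolding AA_def using card_bounded_polys by (subst card_image[OF inj_on_subset[OF inj_emb_A]]) auto

lemma AA_subset_K_inf: "AA n \<subseteq> K_inf j" by (auto simp: AA_def emb_A_in_K_inf)

lemma fq_subspace_AA: "fq_subspace (AA n)"
  unfolding fq_subspace_def AA_def
  by (auto intro!: image_eqI[of 0 _ 0] simp: bounded_polys_add bounded_polys_smult
      simp flip: emb_A_add emb_A_smult)

lemma AA_I: "a \<in> bounded_polys n \<Longrightarrow> emb_A j a \<in> AA n" by (simp add: AA_def)

lemma TT_power: "TT ^ n = emb_A j (Polynomial.monom 1 n :: 'k poly)"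
  by (simp add: TT_def emb_A_power[symmetric] monom_altdef)

text \<open>Comparing the coefficients of T^n gives injectivity; surjectivity then follows by
  counting.\<close>

lemma direct_sum_AA_Suc:
  fixes n :: nat
  defines "U \<equiv> range (\<lambda>s. sc s * TT ^ n)"
  shows "inj_on (\<lambda>(u, v). u + v) (U \<times> AA n)" and "(\<lambda>(u, v). u + v) ` (U \<times> AA n) = AA (Suc n)"
proof -
  have U: "sc s * TT ^ n = emb_A j (Polynomial.monom s n)" for s
    by (simp add: TT_power emb_A_smult[symmetric] smult_monom)
  show inj: "inj_on (\<lambda>(u, v). u + v) (U \<times> AA n)"
  proof (rule inj_onI, clarsimp)
    fix u v u' v' assume u: "u \<in> U" "u' \<in> U" and v: "v \<in> AA n" "v' \<in> AA n" and eq: "u + v = u' + v'"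
    obtain s s' where s: "u = emb_A j (Polynomial.monom s n)" "u' = emb_A j (Polynomial.monom s' n)"
      using u unfolding U_def U by blast
    obtain a a' where a: "v = emb_A j a" "v' = emb_A j a'" "a \<in> bounded_polys n" "a' \<in> bounded_polys n"
      using v unfolding AA_def by blast
    have "Polynomial.monom s n + a = Polynomial.monom s' n + a'"
      using eq unfolding s a emb_A_add[symmetric] by (rule injD[OF inj_emb_A])
    hence "Polynomial.coeff (Polynomial.monom s n + a) n = Polynomial.coeff (Polynomial.monom s' n + a') n"
      by simp
    hence "s = s'" using a(3,4) by (simp add: bounded_polys_def)
    thus "u = u' \<and> v = v'" using eq s by simp
  qed
  have sub: "(\<lambda>(u, v). u + v) ` (U \<times> AA n) \<subseteq> AA (Suc n)"
  proof clarify
    fix u v assume "u \<in> U" "v \<in> AA n"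
    then obtain s a where "u = emb_A j (Polynomial.monom s n)" "v = emb_A j a" "a \<in> bounded_polys n"
      unfolding U_def U AA_def by blast
    thus "u + v \<in> AA (Suc n)"
      by (auto simp: emb_A_add[symmetric] bounded_polys_def intro!: AA_I)
  qed
  have "inj (\<lambda>s. sc s * TT ^ n)" using inj_sc by (auto simp: inj_def)
  hence "card U = CARD('k)" unfolding U_def by (rule card_image)
  hence "card ((\<lambda>(u, v). u + v) ` (U \<times> AA n)) = card (AA (Suc n))"
    unfolding card_image[OF inj] by (simp add: card_cartesian_product card_AA)
  thus "(\<lambda>(u, v). u + v) ` (U \<times> AA n) = AA (Suc n)" by (rule card_subset_eq[OF finite_AA sub])
qed

lemma vanishing_in_subfield:
  assumes "subfield L RC" "V \<subseteq> L" "z \<in> L"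
  shows "vanishing V z \<in> L"
  unfolding vanishing_def
  by (rule subfield_prod[OF assms(1)], rule subfieldD(6)[OF assms(1)]) (use assms in auto)

text \<open>Grouping by the multiples of T^n makes \<open>e_(n+1)(z)\<close> a polynomial in
  \<open>e_n(z)\<close> with coefficients in L, whether or not z itself lies in L.\<close>

lemma vanishing_AA_Suc_in:
  assumes L: "subfield L RC" "K_inf j \<subseteq> L" and z: "vanishing (AA n) z \<in> L"
  shows "vanishing (AA (Suc n)) z \<in> L"
proof -
  let ?U = "range (\<lambda>s. sc s * TT ^ n)"
  have "vanishing (AA (Suc n)) z = (\<Prod>u\<in>?U. vanishing (AA n) z - vanishing (AA n) u)"
    using vanishing_direct_sum[OF finite_AA fq_subspace_AA _ direct_sum_AA_Suc(1), of n z]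
    unfolding direct_sum_AA_Suc(2) by simp
  also have "\<dots> \<in> L"
  proof (rule subfield_prod[OF L(1)])
    fix u assume "u \<in> ?U"
    then obtain s where "u = sc s * TT ^ n" by blast
    hence "u \<in> L" using L(2) sc_in_K_inf TT_in_K_inf
      by (auto intro!: subfieldD(4)[OF L(1)] subfield_power[OF L(1)])
    hence "vanishing (AA n) u \<in> L" using AA_subset_K_inf L by (intro vanishing_in_subfield) auto
    thus "vanishing (AA n) z - vanishing (AA n) u \<in> L" using z by (intro subfieldD(6)[OF L(1)])
  qed
  finally show ?thesis .
qed

lemma vanishing_AA_mono_in:
  assumes "subfield L RC" "K_inf j \<subseteq> L" "n \<le> m" "vanishing (AA n) z \<in> L"
  shows "vanishing (AA m) z \<in> L"
  using assms(3,4) by (induction m rule: dec_induct)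
    (assumption | rule vanishing_AA_Suc_in[OF assms(1,2)])+

text \<open>Now the polynomials of degree < n + 1 are written as s + T a. Up to a power of T,
  \<open>e_(n+1)(T z)\<close> is the product of \<open>e_n(z) - s e_n(1/T)\<close> over the scalars
  s, hence a polynomial over L in \<open>e_n(z)\<close>.\<close>

lemma vanishing_AA_TT_in:
  assumes L: "subfield L RC" "K_inf j \<subseteq> L" and z: "vanishing (AA n) z \<in> L"
  shows "vanishing (AA (Suc n)) (TT * z) \<in> L"
proof -
  let ?B = "bounded_polys n :: 'k poly set"
  have v: "vanishing (AA m) x = (\<Prod>a\<in>bounded_polys m. x - emb_A j a)" for m x
    unfolding vanishing_def AA_def by (subst prod.reindex[OF inj_on_subset[OF inj_emb_A]]) auto
  have inj: "inj_on (\<lambda>(s, a). pCons s a) (UNIV \<times> ?B)" by (auto intro!: inj_onI)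
  have "vanishing (AA (Suc n)) (TT * z) = (\<Prod>(s,a)\<in>UNIV \<times> ?B. TT * z - emb_A j (pCons s a))"
    unfolding v bounded_polys_Suc by (subst prod.reindex[OF inj]) (simp add: case_prod_unfold o_def)
  also have "\<dots> = (\<Prod>s\<in>UNIV. \<Prod>a\<in>?B. TT * ((z - sc s * inverse TT) - emb_A j a))"
    unfolding prod.cartesian_product
    by (intro prod.cong refl) (auto simp: emb_A_pCons right_diff_distrib)
  also have "\<dots> = (\<Prod>s\<in>UNIV. TT ^ card ?B * (vanishing (AA n) z - sc s * vanishing (AA n) (inverse TT)))"
    by (simp only: prod.distrib prod_constant v[symmetric] vanishing_diff[OF finite_AA fq_subspace_AA]
        vanishing_scalar[OF finite_AA fq_subspace_AA])
  also have "\<dots> \<in> L"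
  proof (rule subfield_prod[OF L(1)])
    fix s
    have i: "inverse TT \<in> L" "sc s \<in> L" "TT ^ card ?B \<in> L"
      using L TT_in_K_inf sc_in_K_inf subfieldD(7)[OF L(1)] subfield_power[OF L(1)] by auto
    hence "vanishing (AA n) (inverse TT) \<in> L"
      using AA_subset_K_inf L by (intro vanishing_in_subfield) auto
    thus "TT ^ card ?B * (vanishing (AA n) z - sc s * vanishing (AA n) (inverse TT)) \<in> L"
      using i z by (intro subfieldD(4,6)[OF L(1)]) auto
  qed
  finally show ?thesis .
qed

text \<open>Horner's scheme a = s + T a' and additivity; each multiplication by T raises the index
  by one, whence the bound N + n.\<close>

lemma vanishing_AA_mult_in:
  assumes L: "subfield L RC" "K_inf j \<subseteq> L" and w: "vanishing (AA N) w \<in> L"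
  shows "a \<in> bounded_polys n \<Longrightarrow> N + n \<le> m \<Longrightarrow> vanishing (AA m) (emb_A j a * w) \<in> L"
proof (induction n arbitrary: a m)
  case 0
  hence "vanishing (AA m) (emb_A j a * w) = 0"
    using fq_subspaceD(1)[OF fq_subspace_AA] by (simp add: bounded_polys_0 vanishing_eq_0_iff)
  thus ?case using subfieldD(1)[OF L(1)] by simp
next
  case (Suc n)
  obtain m' where m': "m = Suc m'" "N + n \<le> m'" using Suc.prems by (cases m) auto
  obtain s a' where a': "a = pCons s a'" "a' \<in> bounded_polys n"
    using Suc.prems(1) unfolding bounded_polys_Suc by auto
  have "emb_A j a * w = sc s * w + TT * (emb_A j a' * w)"
    by (simp add: a' emb_A_pCons algebra_simps)
  hence "vanishing (AA m) (emb_A j a * w) = sc s * vanishing (AA m) w + vanishing (AA m) (TT * (emb_A j a' * w))"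
    by (simp add: vanishing_add[OF finite_AA fq_subspace_AA] vanishing_scalar[OF finite_AA fq_subspace_AA])
  moreover have "vanishing (AA m) w \<in> L"
    by (rule vanishing_AA_mono_in[OF L _ w]) (use Suc.prems in simp)
  moreover have "vanishing (AA m) (TT * (emb_A j a' * w)) \<in> L"
    unfolding m' by (intro vanishing_AA_TT_in L Suc.IH a' m')
  moreover have "sc s \<in> L" using L sc_in_K_inf by blast
  ultimately show ?case using subfieldD(3,4)[OF L(1)] by simp
qed

text \<open>
  Otherwise \<open>q\<close> has a \<open>p\<^sup>n\<close>-th root in \<open>|L\<^sup>*|\<close> for all \<open>n\<close>, and the ramification index of \<open>L\<close> over
  \<open>F((1/T))\<close> is infinite.
\<close>

lemma exists_non_pth_power:
  assumes fe: "finite_extension (K_inf j) L" and p: "p > 1"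
  shows "\<exists>g\<in>absv_group L. \<forall>x\<in>absv_group L. g \<noteq> x ^ p"
proof (rule ccontr)
  assume "\<not> ?thesis"
  hence root: "\<forall>g\<in>absv_group L. \<exists>x\<in>absv_group L. g = x ^ p" by blast
  let ?q = "real CARD('k)" and ?n = "ext_degree (K_inf j) L"
  have L: "subfield L RC" "K_inf j \<subseteq> L" using fe by (auto simp: finite_extension_def)
  have "\<exists>x\<in>absv_group L. x ^ (p ^ n) = ?q" for n
  proof (induction n)
    case 0
    have "?q \<in> absv_group L"
      using L(2) TT_in_K_inf by (auto simp: absv_group_def simp flip: absv_TT intro!: imageI)
    thus ?case by auto
  next
    case (Suc n)
    then obtain x where x: "x \<in> absv_group L" "x ^ (p ^ n) = ?q" by blast
    obtain y where y: "y \<in> absv_group L" "x = y ^ p" using root x(1) by blast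
    have "y ^ (p ^ Suc n) = ?q" using x y by (simp add: power_mult)
    thus ?case using y(1) by blast
  qed
  \<comment> \<open>A root of exponent p^n with n = [L : F((1/T))] suffices: the class of |y| modulo
    the powers of q has order p^n, and this already exceeds n.\<close>
  then obtain y where y: "y \<in> L" "y \<noteq> 0" "absv y ^ (p ^ ?n) = ?q"
    unfolding absv_group_def by blast
  have "p ^ ?n \<le> ramification_index (K_inf j) L"
  proof (rule ramification_index_ge[OF fe y(1,2)])
    fix e :: nat assume e: "0 < e" "e < p ^ ?n"
    show "absv y ^ e \<notin> absv_group (K_inf j)"
    proof
      assume "absv y ^ e \<in> absv_group (K_inf j)"
      then obtain x where x: "x \<in> K_inf j" "x \<noteq> 0" "absv y ^ e = absv x"
        by (auto simp: absv_group_def)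
      obtain f where "x = emb_K j f" using x(1) by (auto simp: K_inf_def)
      hence f: "f \<noteq> 0" "absv y ^ e = absv (emb_K j f)" using x by auto
      define i where "i = - fls_subdegree f"
      have "?q powi int e = ?q ^ e" by simp
      also have "\<dots> = (absv y ^ e) ^ (p ^ ?n)" unfolding y(3)[symmetric] by (simp add: mult.commute flip: power_mult)
      also have "\<dots> = (?q powi i) ^ (p ^ ?n)" using f by (simp add: absv_emb_K i_def)
      also have "\<dots> = ?q powi (i * int (p ^ ?n))" by (simp only: power_int_mult power_int_of_nat)
      finally have "int e = i * int (p ^ ?n)"
        using card_gt_1 power_int_strict_increasing[of _ _ ?q] by (metis less_irrefl linorder_neqE of_nat_1 of_nat_less_iff)
      hence "p ^ ?n dvd e" by (metis dvd_triv_right int_dvd_int_iff)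
      thus False using e by (simp add: nat_dvd_not_less)
    qed
  qed
  also have "\<dots> \<le> ?n" by (rule ramification_index_le_ext_degree[OF fe])
  finally have "p ^ ?n \<le> ?n" .
  moreover have "?n < p ^ ?n" using p by (intro power_gt_expt) simp
  ultimately show False by simp
qed

text \<open>Multiplying by p-th powers of T enlarges the absolute value without changing its class
  modulo p-th powers.\<close>

lemma exists_large_non_pth_power:
  assumes fe: "finite_extension (K_inf j) L" and p: "p > 1"
  shows "\<exists>c\<in>L. absv c > B \<and> (\<forall>x\<in>absv_group L. absv c \<noteq> x ^ p)"
proof -
  have L: "subfield L RC" "K_inf j \<subseteq> L" using fe by (auto simp: finite_extension_def)
  obtain c0 where c0: "c0 \<in> L" "c0 \<noteq> 0" "\<And>x. x \<in> absv_group L \<Longrightarrow> absv c0 \<noteq> x ^ p"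
    using exists_non_pth_power[OF fe p] by (auto simp: absv_group_def)
  have TT: "TT \<in> L" using L TT_in_K_inf by blast
  have q: "real CARD('k) ^ p > 1" using card_gt_1 p by (intro one_less_power) auto
  obtain n where n: "B / absv c0 < (real CARD('k) ^ p) ^ n" using real_arch_pow[OF q] by blast
  define c where "c = c0 * (TT ^ n) ^ p"
  have "absv c = absv c0 * (real CARD('k) ^ p) ^ n"
    by (simp add: c_def absv_mult absv_power absv_TT mult.commute flip: power_mult)
  hence "B < absv c" using n c0(2) by (simp add: field_simps)
  moreover have "absv c \<noteq> x ^ p" if x: "x \<in> absv_group L" for x
  proof
    assume eq: "absv c = x ^ p"
    have "absv (TT ^ n) \<in> absv_group L"
      using subfield_power[OF L(1) TT, of n] by (auto simp: absv_group_def)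
    from absv_groupD(3)[OF L(1) x this] have "x / absv (TT ^ n) \<in> absv_group L" .
    moreover have "absv c0 = (x / absv (TT ^ n)) ^ p"
      using eq by (simp add: c_def absv_mult absv_power power_divide field_simps)
    ultimately show False using c0(3) by blast
  qed
  moreover have "c \<in> L" unfolding c_def by (intro subfieldD(4) subfield_power L c0 TT)
  ultimately show ?thesis by blast
qed

section \<open>Roots of \<open>e_n(X) - c\<close>\<close>

lemma exists_vanishing_AA_root:
  assumes "c \<in> range j"
  shows "\<exists>w. vanishing (AA n) w = c"
proof -
  obtain c' where c': "c = j c'" using assms by blast
  define x where "x a = to_ac (poly (map_poly fls_const a) fls_X_inv)" for a :: "'k poly"
  have jx: "j (x a) = emb_A j a" for a by (simp add: x_def emb_A_def emb_K_def)
  let ?B = "bounded_polys n :: 'k poly set"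
  let ?p = "(\<Prod>a\<in>?B. [:- x a, 1:])"
  have "Polynomial.degree ?p = card ?B" by (subst degree_prod_eq_sum_degree) auto
  hence d: "Polynomial.degree ?p > 0" using card_bounded_polys[of n, where 'a = 'k] by simp
  have "Polynomial.degree (?p + [:- c':]) = Polynomial.degree ?p"
    using d by (intro degree_add_eq_left) simp
  hence "Polynomial.degree (?p + [:- c':]) > 0" using d by simp
  then obtain y where "poly (?p + [:- c':]) y = 0" using alg_closed_imp_poly_has_root by blast
  hence y: "(\<Prod>a\<in>?B. y - x a) = c'" by (simp add: poly_prod)
  have jprod: "j (prod f S) = (\<Prod>i\<in>S. j (f i))" for f and S :: "'k poly set"
    by (induction S rule: infinite_finite_induct) (auto simp: j_mult)
  have "c = (\<Prod>a\<in>?B. j y - emb_A j a)" by (simp add: c' jprod j_diff jx flip: y)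
  also have "\<dots> = vanishing (AA n) (j y)"
    unfolding vanishing_def AA_def by (subst prod.reindex[OF inj_on_subset[OF inj_emb_A]]) auto
  finally show ?thesis by blast
qed

lemma absv_AA_le: "a \<in> AA n \<Longrightarrow> absv a \<le> real CARD('k) ^ n"
proof -
  assume "a \<in> AA n"
  then obtain b where b: "a = emb_A j b" "b = 0 \<or> Polynomial.degree b < n"
    by (auto simp: AA_def bounded_polys_iff_degree)
  show ?thesis
  proof (cases "b = 0")
    case False
    thus ?thesis using b absv_emb_A[OF False] card_gt_1 by (auto intro!: power_increasing)
  qed (simp add: b)
qed

text \<open>If |w| were at most q^n, each of the q^n factors w - a would be bounded by q^n; this is
  the origin of the threshold. Beyond it |w| exceeds every |a|, and each factor has absolute value
  |w|.\<close>

lemma absv_vanishing_AA_root: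
  assumes "absv (vanishing (AA n) w) > (real CARD('k) ^ n) ^ (CARD('k) ^ n)"
  shows "absv w > 1" "absv w ^ (CARD('k) ^ n) = absv (vanishing (AA n) w)"
proof -
  let ?q = "real CARD('k)"
  have q: "?q ^ n \<ge> 1" using card_gt_1 by (intro one_le_power) simp
  have eq: "absv (vanishing (AA n) w) = (\<Prod>a\<in>AA n. absv (w - a))"
    by (simp add: vanishing_def absv_prod)
  have w: "absv w > ?q ^ n"
  proof (rule ccontr)
    assume "\<not> ?q ^ n < absv w"
    hence "absv (w - a) \<le> ?q ^ n" if "a \<in> AA n" for a
      using absv_diff[of w a] absv_AA_le[OF that] by simp
    hence "(\<Prod>a\<in>AA n. absv (w - a)) \<le> (\<Prod>a\<in>AA n. ?q ^ n)" by (intro prod_mono) auto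
    thus False using assms eq by (simp add: card_AA)
  qed
  thus "absv w > 1" using q by linarith
  have "absv (w - a) = absv w" if "a \<in> AA n" for a
    using absv_diff_eq[of a w] absv_AA_le[OF that] w by (simp add: absv_diff_commute)
  thus "absv w ^ (CARD('k) ^ n) = absv (vanishing (AA n) w)"
    using eq by (simp add: card_AA)
qed

text \<open>w is a root of \<open>e_n(X) - e_n(w)\<close>. This polynomial maps the infinite set
  \<open>K_inf j\<close> into L, so interpolation puts its coefficients into L.\<close>

lemma algebraic_vanishing_AA:
  assumes L: "subfield L RC" "K_inf j \<subseteq> L" and w: "vanishing (AA n) w \<in> L"
  shows "(RC.algebraic over L) w"
proof -
  define p where "p = (\<Prod>a\<in>AA n. [:- a, 1:]) - [:vanishing (AA n) w:]"
  have poly_p: "poly p x = vanishing (AA n) x - vanishing (AA n) w" for x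
    by (simp add: p_def poly_prod vanishing_def)
  have "p \<noteq> 0"
  proof
    assume "p = 0"
    hence eq: "vanishing (AA n) x = vanishing (AA n) w" for x using poly_p[of x] by simp
    have "vanishing (AA n) 0 = 0" using fq_subspaceD(1)[OF fq_subspace_AA] by (simp add: vanishing_eq_0_iff)
    hence "x \<in> AA n" for x using eq[of x] eq[of 0] by (simp flip: vanishing_eq_0_iff[OF finite_AA])
    thus False using infinite_C finite_subset[of UNIV "AA n"] by auto
  qed
  moreover have "K_inf j \<subseteq> {x \<in> L. poly p x \<in> L}"
  proof
    fix x assume "x \<in> K_inf j"
    hence x: "x \<in> L" using L by blast
    hence "vanishing (AA n) x \<in> L" using AA_subset_K_inf L by (intro vanishing_in_subfield) auto
    thus "x \<in> {x \<in> L. poly p x \<in> L}" using x w subfieldD(6)[OF L(1)] by (simp add: poly_p)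
  qed
  hence "Polynomial.coeff p i \<in> L" for i
    using infinite_K_inf finite_subset by (intro coeff_in_subfield[OF L(1)]) blast
  moreover have "poly p w = 0" by (simp add: poly_p)
  ultimately show ?thesis unfolding algebraic_iff_root[OF L(1)] by blast
qed

end

subsection \<open>Lattices with an orthogonal basis\<close>

text \<open>Orthogonality bounds every coordinate of a lattice vector by the vector itself, which
  gives freeness and local finiteness. Together with |b i| \<ge> 1 it also keeps all nonzero periods
  at absolute value at least 1, as in A.\<close>

locale lattice_basis = completed_alg_closure j
  for j :: "'k::{field,finite} fls alg_closure \<Rightarrow> 'c::{field,complete_space}" +
  fixes b :: "nat \<Rightarrow> 'c" and r :: nat
  assumes orthogonal: "\<And>a i. i < r \<Longrightarrow>
      absv (emb_A j (a i) * b i) \<le> absv (\<Sum>k<r. emb_A j (a k) * b k)"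
    and absv_b_ge_1: "\<And>i. i < r \<Longrightarrow> absv (b i) \<ge> 1"
    and r_pos: "r > 0"
begin

definition comb :: "(nat \<Rightarrow> 'k poly) \<Rightarrow> 'c" where
  "comb a = (\<Sum>i<r. emb_A j (a i) * b i)"

definition Lat :: "'c set" where "Lat = range comb"

lemma comb_cong: "(\<And>i. i < r \<Longrightarrow> a i = a' i) \<Longrightarrow> comb a = comb a'"
  unfolding comb_def by (intro sum.cong) auto

lemma comb_add: "comb (\<lambda>i. a i + a' i) = comb a + comb a'"
  by (simp add: comb_def emb_A_add sum.distrib algebra_simps)
lemma comb_diff: "comb (\<lambda>i. a i - a' i) = comb a - comb a'"
  by (simp add: comb_def emb_A_diff sum_subtractf algebra_simps)
lemma comb_mult: "comb (\<lambda>i. c * a i) = emb_A j c * comb a"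
  by (simp add: comb_def emb_A_mult sum_distrib_left mult.assoc)
lemma comb_smult: "comb (\<lambda>i. Polynomial.smult s (a i)) = sc s * comb a"
  by (simp add: comb_def emb_A_smult sum_distrib_left mult.assoc)
lemma comb_0 [simp]: "comb (\<lambda>i. 0) = 0" by (simp add: comb_def)

lemma absv_comb_ge: "i < r \<Longrightarrow> absv (emb_A j (a i)) \<le> absv (comb a)"
proof -
  assume i: "i < r"
  have "absv (emb_A j (a i)) * 1 \<le> absv (emb_A j (a i)) * absv (b i)"
    using absv_b_ge_1[OF i] by (intro mult_left_mono) auto
  also have "\<dots> \<le> absv (comb a)" using orthogonal[OF i, of a] by (simp add: comb_def absv_mult)
  finally show ?thesis by simp
qed

lemma comb_eq_0D: "comb a = 0 \<Longrightarrow> i < r \<Longrightarrow> a i = 0"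
  using absv_comb_ge[of i a] absv_nonneg[of "emb_A j (a i)"] absv_eq_0_iff[of "emb_A j (a i)"]
  by (metis absv_0 emb_A_eq_0_iff order_antisym)

lemma comb_eqD: "comb a = comb a' \<Longrightarrow> i < r \<Longrightarrow> a i = a' i"
  using comb_eq_0D[of "\<lambda>i. a i - a' i" i] by (simp add: comb_diff)

lemma absv_Lat_ge_1: "\<mu> \<in> Lat - {0} \<Longrightarrow> absv \<mu> \<ge> 1"
proof -
  assume "\<mu> \<in> Lat - {0}"
  then obtain a where a: "\<mu> = comb a" "comb a \<noteq> 0" by (auto simp: Lat_def)
  then obtain i where i: "i < r" "a i \<noteq> 0" using comb_cong[of a "\<lambda>i. 0"] by auto
  show ?thesis using absv_comb_ge[OF i(1), of a] absv_emb_A_ge_1[OF i(2)] a by simp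
qed

lemma Lat_0: "0 \<in> Lat" unfolding Lat_def using comb_0 by (metis rangeI)
lemma Lat_diff: "x \<in> Lat \<Longrightarrow> y \<in> Lat \<Longrightarrow> x - y \<in> Lat"
  by (auto simp: Lat_def simp flip: comb_diff)
lemma free_A_submodule_Lat: "free_A_submodule j r Lat"
  unfolding free_A_submodule_def
proof (intro exI[of _ b] conjI allI impI)
  show "Lat = range (\<lambda>a. \<Sum>i<r. emb_A j (a i) * b i)" by (simp add: Lat_def comb_def[abs_def])
qed (rule comb_eq_0D, simp_all add: comb_def)

lemma discrete_Lat: "discrete Lat"
  unfolding discrete_def isolated_in_dist_Ex_iff
proof (intro ballI conjI exI[of _ 1] impI)
  fix x y assume "x \<in> Lat" "y \<in> Lat" "dist x y < 1"
  thus "y = x" using absv_Lat_ge_1[of "x - y"] Lat_diff by (auto simp: dist_absv)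
qed auto

text \<open>The degree bound may depend on the coordinate: equal bounds suit the functional
  equation, while the values on L require a larger bound for the basis vector 1 than for the
  others.\<close>

definition box :: "(nat \<Rightarrow> nat) \<Rightarrow> 'c set" where
  "box d = comb ` {a. \<forall>i<r. a i \<in> bounded_polys (d i)}"

abbreviation cbox :: "nat \<Rightarrow> 'c set" where "cbox m \<equiv> box (\<lambda>_. m)"

lemma box_PiE: "box d = comb ` (PiE {..<r} (\<lambda>i. bounded_polys (d i)))"
proof
  show "box d \<subseteq> comb ` (PiE {..<r} (\<lambda>i. bounded_polys (d i)))"
  proof
    fix x assume "x \<in> box d"
    then obtain a where a: "x = comb a" "\<forall>i<r. a i \<in> bounded_polys (d i)" by (auto simp: box_def)
    have "x = comb (restrict a {..<r})" unfolding a by (rule comb_cong) simp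
    moreover have "restrict a {..<r} \<in> PiE {..<r} (\<lambda>i. bounded_polys (d i))" using a by auto
    ultimately show "x \<in> comb ` (PiE {..<r} (\<lambda>i. bounded_polys (d i)))" by blast
  qed
qed (auto simp: box_def PiE_iff)

lemma finite_box: "finite (box d)"
  unfolding box_PiE by (intro finite_imageI finite_PiE) auto

lemma card_cbox: "card (cbox m) = CARD('k) ^ (r * m)"
proof -
  have "inj_on comb (PiE {..<r} (\<lambda>i. bounded_polys m))"
    by (intro inj_onI PiE_ext comb_eqD) auto
  thus ?thesis unfolding box_PiE
    by (simp add: card_image card_PiE card_bounded_polys mult.commute flip: power_mult)
qed

lemma box_subset_Lat: "box d \<subseteq> Lat" by (auto simp: box_def Lat_def)

lemma combI_box: "(\<And>i. i < r \<Longrightarrow> a i \<in> bounded_polys (d i)) \<Longrightarrow> comb a \<in> box d"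
  by (auto simp: box_def)

lemma fq_subspace_box: "fq_subspace (box d)"
  unfolding fq_subspace_def
proof (intro conjI ballI allI)
  show "0 \<in> box d" using combI_box[of "\<lambda>_. 0"] by simp
next
  fix x y assume "x \<in> box d" "y \<in> box d"
  thus "x + y \<in> box d"
    by (auto simp: box_def bounded_polys_add comb_add[symmetric] intro!: imageI)
next
  fix x s assume "x \<in> box d"
  thus "sc s * x \<in> box d"
    by (auto simp: box_def bounded_polys_smult comb_smult[symmetric] intro!: imageI)
qed

lemma Lat_eventually_in_box:
  assumes "\<mu> \<in> Lat" "\<And>i m. d m i \<ge> m"
  shows "\<forall>\<^sub>F m in sequentially. \<mu> \<in> box (d m)"
proof -
  obtain a where a: "\<mu> = comb a" using assms by (auto simp: Lat_def)
  have "comb a \<in> box (d m)" if m: "m \<ge> Suc (\<Sum>i<r. Polynomial.degree (a i))" for m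
  proof (rule combI_box)
    fix i assume i: "i < r"
    have "Polynomial.degree (a i) \<le> (\<Sum>i<r. Polynomial.degree (a i))"
      by (rule member_le_sum) (use i in auto)
    thus "a i \<in> bounded_polys (d m i)" using m assms(2)[of m i] by (simp add: bounded_polys_iff_degree)
  qed
  thus ?thesis unfolding a eventually_sequentially by blast
qed

text \<open>A bound on |\<mu>| bounds the degree of every coordinate, so a ball meets the lattice
  inside a finite box.\<close>

lemma locally_finite_Lat: "locally_finite Lat"
  unfolding locally_finite_def
proof
  fix R
  obtain n where n: "R < real CARD('k) ^ n" using card_gt_1 real_arch_pow[of "real CARD('k)" R] by auto
  have "\<mu> \<in> cbox n" if \<mu>: "\<mu> \<in> Lat" "absv \<mu> \<le> R" for \<mu>
  proof -
    obtain a where a: "\<mu> = comb a" using \<mu> by (auto simp: Lat_def)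
    show ?thesis unfolding a
    proof (rule combI_box)
      fix i assume i: "i < r"
      have "Polynomial.degree (a i) < n" if "a i \<noteq> 0"
      proof -
        have "real CARD('k) ^ Polynomial.degree (a i) < real CARD('k) ^ n"
          using absv_emb_A[OF that] absv_comb_ge[OF i, of a] \<open>absv \<mu> \<le> R\<close> a n by simp
        thus ?thesis using card_gt_1 by (subst (asm) power_strict_increasing_iff) auto
      qed
      thus "a i \<in> bounded_polys n" by (auto simp: bounded_polys_iff_degree)
    qed
  qed
  thus "finite {\<mu> \<in> Lat. absv \<mu> \<le> R}" by (intro finite_subset[OF _ finite_box[of "\<lambda>_. n"]]) auto
qed

section \<open>The exponential function and its functional equation\<close>

abbreviation E :: "'c \<Rightarrow> 'c" where "E \<equiv> lattice_exp Lat"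

lemma fexp_box_tendsto:
  assumes "\<And>i m. d m i \<ge> m"
  shows "(\<lambda>m. fexp (box (d m)) z) \<longlonglongrightarrow> E z"
  by (intro fexp_tendsto_lattice_exp locally_finite_Lat finite_box box_subset_Lat
        Lat_eventually_in_box assms)

lemma E_eq_0_iff: "E z = 0 \<longleftrightarrow> z \<in> Lat"
  by (rule lattice_exp_eq_0_iff[OF locally_finite_Lat Lat_0])

lemma E_add: "E (x + y) = E x + E y"
proof (rule LIMSEQ_unique)
  show "(\<lambda>m. fexp (cbox m) (x + y)) \<longlonglongrightarrow> E (x + y)" by (rule fexp_box_tendsto) auto
  show "(\<lambda>m. fexp (cbox m) (x + y)) \<longlonglongrightarrow> E x + E y"
    unfolding fexp_add[OF finite_box fq_subspace_box]
    by (intro C_tendsto_add fexp_box_tendsto) auto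
qed

lemma E_scalar: "E (sc s * x) = sc s * E x"
proof (rule LIMSEQ_unique)
  show "(\<lambda>m. fexp (cbox m) (sc s * x)) \<longlonglongrightarrow> E (sc s * x)" by (rule fexp_box_tendsto) auto
  show "(\<lambda>m. fexp (cbox m) (sc s * x)) \<longlonglongrightarrow> sc s * E x"
    unfolding fexp_scalar[OF finite_box fq_subspace_box]
    by (intro C_tendsto_cmult fexp_box_tendsto) auto
qed

lemma E_diff: "E (x - y) = E x - E y"
  using E_add[of "x - y" y] by (simp add: algebra_simps)

lemma E_eq_iff: "E x = E y \<longleftrightarrow> x - y \<in> Lat"
  using E_eq_0_iff[of "x - y"] by (simp add: E_diff)

lemma E_close: "absv z \<le> 1 \<Longrightarrow> absv (E z - z) \<le> absv z * absv z"
proof (rule lattice_exp_close[OF locally_finite_Lat])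
  fix \<mu> assume \<mu>: "\<mu> \<in> Lat - {0}"
  have "absv z / absv \<mu> \<le> absv z / 1"
    using absv_Lat_ge_1[OF \<mu>] by (intro divide_left_mono) auto
  thus "absv (z / \<mu>) \<le> absv z" by (simp add: absv_divide)
qed auto

lemma TT_conv: "TT = emb_A j [:0, 1:]" by (simp add: TT_def)

lemma comb_pCons: "comb (\<lambda>i. pCons (s i) (a i)) = comb (\<lambda>i. [:s i:]) + TT * comb a"
  by (simp add: comb_def emb_A_pCons sum.distrib sum_distrib_left algebra_simps)

text \<open>\<open>cbox 1\<close> consists of the vectors with constant coordinates and represents
  \<Lambda> modulo T\<Lambda>: a constant divisible by T is 0.\<close>

lemma cbox_1_Int_TT_Lat:
  assumes "w \<in> cbox 1" "w = TT * \<mu>" "\<mu> \<in> Lat"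
  shows "w = 0"
proof -
  obtain a where a: "w = comb a" "\<And>i. i < r \<Longrightarrow> a i \<in> bounded_polys 1"
    using assms by (auto simp: box_def)
  obtain c where c: "\<mu> = comb c" using assms by (auto simp: Lat_def)
  have "comb a = comb (\<lambda>i. [:0, 1:] * c i)"
    using assms(2) unfolding a c comb_mult TT_conv .
  hence eq: "a i = [:0, 1:] * c i" if "i < r" for i using comb_eqD that by blast
  have "a i = 0" if "i < r" for i
    using a(2)[OF that] eq[OF that] by (auto simp: bounded_polys_iff_degree split: if_splits)
  thus ?thesis unfolding a using comb_cong[of a "\<lambda>_. 0"] by simp
qed

lemma direct_sum_cbox_Suc:
  "inj_on (\<lambda>(w, v). w + v) (cbox 1 \<times> (*) TT ` cbox m)"
  "(\<lambda>(w, v). w + v) ` (cbox 1 \<times> (*) TT ` cbox m) = cbox (Suc m)"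
proof -
  show inj: "inj_on (\<lambda>(w, v). w + v) (cbox 1 \<times> (*) TT ` cbox m)"
  proof (rule inj_onI, clarsimp)
    fix w v w' v' assume w: "w \<in> cbox (Suc 0)" "w' \<in> cbox (Suc 0)" and v: "v \<in> cbox m" "v' \<in> cbox m"
      and eq: "w + TT * v = w' + TT * v'"
    have "w - w' = TT * (v' - v)" using eq by (simp add: algebra_simps)
    hence "w - w' = 0" using fq_subspaceD(5)[OF fq_subspace_box w] v box_subset_Lat
      by (intro cbox_1_Int_TT_Lat[of _ "v' - v"] Lat_diff) auto
    thus "w = w' \<and> v = v'" using eq by simp
  qed
  have sub: "(\<lambda>(w, v). w + v) ` (cbox 1 \<times> (*) TT ` cbox m) \<subseteq> cbox (Suc m)"
  proof clarify
    fix w v assume "w \<in> cbox 1" "v \<in> cbox m"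
    then obtain a c where a: "w = comb a" "\<And>i. i < r \<Longrightarrow> a i \<in> bounded_polys 1"
      and c: "v = comb c" "\<And>i. i < r \<Longrightarrow> c i \<in> bounded_polys m" by (auto simp: box_def)
    have "comb a = comb (\<lambda>i. [:Polynomial.coeff (a i) 0:])"
    proof (rule comb_cong)
      fix i assume "i < r"
      hence "Polynomial.degree (a i) = 0" using a(2)[of i] by (auto simp: bounded_polys_iff_degree)
      thus "a i = [:Polynomial.coeff (a i) 0:]" by (auto elim: degree_eq_zeroE)
    qed
    hence "w + TT * v = comb (\<lambda>i. pCons (Polynomial.coeff (a i) 0) (c i))"
      by (simp only: a(1) c(1) comb_pCons[of "\<lambda>i. Polynomial.coeff (a i) 0" c])
    also have "\<dots> \<in> cbox (Suc m)" using c by (intro combI_box) simp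
    finally show "w + TT * v \<in> cbox (Suc m)" .
  qed
  have "card ((*) TT ` cbox m) = card (cbox m)" by (rule card_image) (auto intro: inj_onI)
  hence "card ((\<lambda>(w, v). w + v) ` (cbox 1 \<times> (*) TT ` cbox m)) = card (cbox (Suc m))"
    unfolding card_image[OF inj] by (simp add: card_cartesian_product card_cbox power_add)
  thus "(\<lambda>(w, v). w + v) ` (cbox 1 \<times> (*) TT ` cbox m) = cbox (Suc m)"
    by (rule card_subset_eq[OF finite_box sub])
qed

text \<open>The functional equation at finite level: the next box is a direct sum of
  \<open>cbox 1\<close> and T times the old box, and the factor T is moved out of
  \<open>fexp\<close> by scaling.\<close>

lemma fexp_cbox_Suc:
  "fexp (cbox (Suc m)) (TT * z) = TT * fexp (cbox m) z *
     (\<Prod>w\<in>cbox 1 - {0}. 1 - fexp (cbox m) z / fexp (cbox m) (w / TT))"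
proof -
  let ?V = "(*) TT ` cbox m"
  have scale: "fexp ?V (TT * x) = TT * fexp (cbox m) x" for x by (rule fexp_scale) simp
  have "fexp (cbox (Suc m)) (TT * z) = fexp ?V (TT * z) *
      (\<Prod>w\<in>cbox 1 - {0}. 1 - fexp ?V (TT * z) / fexp ?V w)"
    using fexp_direct_sum[OF _ fq_subspace_scale[OF fq_subspace_box] finite_box
        fq_subspaceD(1)[OF fq_subspace_box] direct_sum_cbox_Suc(1)[of m], of "TT * z"] finite_box
    unfolding direct_sum_cbox_Suc(2) by blast
  also have "(\<Prod>w\<in>cbox 1 - {0}. 1 - fexp ?V (TT * z) / fexp ?V w) =
      (\<Prod>w\<in>cbox 1 - {0}. 1 - fexp (cbox m) z / fexp (cbox m) (w / TT))"
  proof (rule prod.cong[OF refl])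
    fix w
    have "fexp ?V w = TT * fexp (cbox m) (w / TT)" using scale[of "w / TT"] by simp
    thus "1 - fexp ?V (TT * z) / fexp ?V w = 1 - fexp (cbox m) z / fexp (cbox m) (w / TT)"
      by (simp add: scale)
  qed
  finally show ?thesis by (simp only: scale)
qed

text \<open>The limit of the right-hand side of \<open>fexp_cbox_Suc\<close>, read as a polynomial
  in the value of the exponential function: the product expansion over the nonzero T-torsion points
  E(w/T).\<close>

definition P :: "'c poly" where
  "P = [:0, TT:] * (\<Prod>w\<in>cbox 1 - {0}. [:1, - inverse (E (w / TT)):])"

lemma poly_P: "poly P x = TT * x * (\<Prod>w\<in>cbox 1 - {0}. 1 - x / E (w / TT))"
  by (simp add: P_def poly_prod divide_inverse mult_ac)

lemma w_div_TT_notin_Lat: "w \<in> cbox 1 - {0} \<Longrightarrow> w / TT \<notin> Lat"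
  using cbox_1_Int_TT_Lat[of w "w / TT"] by auto

lemma functional_equation: "E (TT * z) = poly P (E z)"
proof (rule LIMSEQ_unique)
  show "(\<lambda>m. fexp (cbox (Suc m)) (TT * z)) \<longlonglongrightarrow> E (TT * z)"
    by (rule fexp_box_tendsto) auto
  show "(\<lambda>m. fexp (cbox (Suc m)) (TT * z)) \<longlonglongrightarrow> poly P (E z)"
  proof -
    have 1: "(\<lambda>m. fexp (cbox m) x) \<longlonglongrightarrow> E x" for x by (rule fexp_box_tendsto) auto
    have 2: "(\<lambda>m. 1 - fexp (cbox m) z / fexp (cbox m) (w / TT)) \<longlonglongrightarrow> 1 - E z / E (w / TT)"
      if "w \<in> cbox 1 - {0}" for w
    proof -
      have "E (w / TT) \<noteq> 0" using w_div_TT_notin_Lat[OF that] by (simp add: E_eq_0_iff)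
      from C_tendsto_inverse[OF 1 this]
      have "(\<lambda>m. fexp (cbox m) z * inverse (fexp (cbox m) (w / TT))) \<longlonglongrightarrow> E z * inverse (E (w / TT))"
        by (rule C_tendsto_mult[OF 1])
      thus ?thesis unfolding divide_inverse by (rule C_tendsto_diff[OF tendsto_const])
    qed
    show ?thesis unfolding fexp_cbox_Suc poly_P
      by (rule C_tendsto_mult[OF C_tendsto_cmult[OF 1] C_tendsto_prod[OF 2]])
  qed
qed

lemma period_lattice_Lat: "period_lattice j r P Lat"
  unfolding period_lattice_def TT_conv[symmetric]
  using free_A_submodule_Lat discrete_Lat functional_equation by blast

definition divT :: "'c set" where "divT = (\<lambda>w. E (w / TT)) ` cbox 1"

lemma inj_on_E_div_TT: "inj_on (\<lambda>w. E (w / TT)) (cbox 1)"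
proof (rule inj_onI)
  fix w w' assume w: "w \<in> cbox 1" "w' \<in> cbox 1" and "E (w / TT) = E (w' / TT)"
  hence "(w - w') / TT \<in> Lat" by (simp add: E_eq_iff diff_divide_distrib)
  hence "w - w' = 0" using fq_subspaceD(5)[OF fq_subspace_box w]
    by (intro cbox_1_Int_TT_Lat[of _ "(w - w') / TT"]) auto
  thus "w = w'" by simp
qed

lemma fq_subspace_divT: "fq_subspace divT"
proof -
  have a: "E (x / TT) + E (y / TT) = E ((x + y) / TT)" for x y by (simp add: add_divide_distrib E_add)
  have s: "sc s * E (x / TT) = E (sc s * x / TT)" for s x using E_scalar[of s "x / TT"] by simp
  have "0 = E (0 / TT)" using E_eq_0_iff[of 0] Lat_0 by simp
  thus ?thesis unfolding fq_subspace_def divT_def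
    using fq_subspaceD[OF fq_subspace_box[of "\<lambda>_. 1"]] by (auto simp: a s intro!: imageI image_eqI)
qed

text \<open>\<open>P\<close> is T times \<open>fexp divT\<close>, where the T-torsion
  \<open>divT\<close> is a space over the scalars with q^r elements. So it is a multiple of a monic
  combination of the powers x^(q^i) for i \<le> r. Its linear coefficient is T by the product
  expansion.\<close>

lemma P_q_polynomial:
  obtains g where "g r \<noteq> 0" "P = Polynomial.monom TT 1 + (\<Sum>i=1..r. Polynomial.monom (g i) (CARD('k) ^ i))"
proof -
  let ?q = "CARD('k)" and ?D = "\<Prod>u\<in>divT - {0}. - u"
  have fin: "finite divT" by (simp add: divT_def finite_box)
  have D: "?D \<noteq> 0" using fin by simp
  have "\<exists>n c. card divT = ?q ^ n \<and> c n = 1 \<and> (\<forall>z. vanishing divT z = (\<Sum>i\<le>n. c i * z ^ (?q ^ i)))"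
    by (rule vanishing_q_polynomial[OF fin fq_subspace_divT]) blast
  then obtain n c where nc: "card divT = ?q ^ n" "c n = 1" "\<And>z. vanishing divT z = (\<Sum>i\<le>n. c i * z ^ (?q ^ i))"
    by blast
  have "card divT = ?q ^ r" unfolding divT_def card_image[OF inj_on_E_div_TT] using card_cbox[of 1] by simp
  hence n: "n = r" using nc(1) card_gt_1 by (simp add: power_inject_exp)
  define g where "g i = TT * c i / ?D" for i
  have E0: "E (0 / TT) = 0" using E_eq_0_iff[of 0] Lat_0 by simp
  have "poly P x = poly (\<Sum>i\<le>r. Polynomial.monom (g i) (?q ^ i)) x" for x
  proof -
    have "(\<lambda>w. E (w / TT)) ` (cbox 1 - {0}) = divT - {0}"
      unfolding divT_def using inj_on_image_set_diff[OF inj_on_E_div_TT, of "cbox 1" "{0}"]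
        fq_subspaceD(1)[OF fq_subspace_box[of "\<lambda>_. 1"]] E0 by simp
    hence "(\<Prod>w\<in>cbox 1 - {0}. 1 - x / E (w / TT)) = (\<Prod>u\<in>divT - {0}. 1 - x / u)"
      using prod.reindex[OF inj_on_subset[OF inj_on_E_div_TT, of "cbox 1 - {0}"], of "\<lambda>u. 1 - x / u"]
      by (simp add: o_def)
    hence "poly P x = TT * fexp divT x" by (simp add: poly_P fexp_def)
    also have "\<dots> = TT * vanishing divT x / ?D"
      by (simp add: fexp_conv_vanishing[OF fin fq_subspaceD(1)[OF fq_subspace_divT]])
    also have "\<dots> = (\<Sum>i\<le>r. g i * x ^ (?q ^ i))"
      by (simp add: nc n g_def sum_distrib_left sum_divide_distrib mult_ac)
    finally show ?thesis by (simp add: poly_sum poly_monom)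
  qed
  hence P: "P = (\<Sum>i\<le>r. Polynomial.monom (g i) (?q ^ i))" by (rule C_poly_eqI)
  have "Polynomial.coeff P 1 = TT * poly (\<Prod>w\<in>cbox 1 - {0}. [:1, - inverse (E (w / TT)):]) 0"
    by (simp add: P_def poly_0_coeff_0)
  also have "\<dots> = TT" by (simp add: poly_prod)
  finally have "Polynomial.coeff P 1 = TT" .
  moreover have "Polynomial.coeff P 1 = (\<Sum>i\<le>r. if i = 0 then g i else 0)"
    unfolding P coeff_sum using card_gt_1 by (intro sum.cong) (auto simp: Polynomial.coeff_monom)
  ultimately have g0: "g 0 = TT" by simp
  have "{..r} = insert 0 {1..r}" by auto
  hence "P = Polynomial.monom TT 1 + (\<Sum>i=1..r. Polynomial.monom (g i) (?q ^ i))"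
    using P g0 by simp
  moreover have "g r \<noteq> 0" using nc n D by (simp add: g_def)
  ultimately show ?thesis using that by blast
qed

lemma degree_P_le: "Polynomial.degree P \<le> CARD('k) ^ r"
proof -
  have "Polynomial.degree P \<le> Polynomial.degree [:0, TT:] +
      Polynomial.degree (\<Prod>w\<in>cbox 1 - {0}. [:1, - inverse (E (w / TT)):])"
    unfolding P_def by (rule degree_mult_le)
  also have "Polynomial.degree (\<Prod>w\<in>cbox 1 - {0}. [:1, - inverse (E (w / TT)):]) \<le> card (cbox 1 - {0})"
    using degree_prod_sum_le[of "cbox 1 - {0}" "\<lambda>w. [:1, - inverse (E (w / TT)):]"]
      sum_bounded_above[of "cbox 1 - {0}" "\<lambda>w. Polynomial.degree [:1, - inverse (E (w / TT)):]" 1] finite_box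
    by (simp add: order_trans)
  also have "card (cbox 1 - {0}) = CARD('k) ^ r - 1"
    using card_cbox[of 1] fq_subspaceD(1)[OF fq_subspace_box[of "\<lambda>_. 1"]] finite_box
    by (simp add: card_Diff_singleton)
  finally show ?thesis using card_gt_1 by (simp add: Suc_leI)
qed

lemma drinfeld_module_P:
  assumes L: "subfield L RC" and inf: "infinite {x \<in> L. poly P x \<in> L}"
  shows "drinfeld_module j L r P"
proof -
  obtain g where g: "g r \<noteq> 0" "P = Polynomial.monom TT 1 + (\<Sum>i=1..r. Polynomial.monom (g i) (CARD('k) ^ i))"
    using P_q_polynomial .
  have "g i \<in> L" if i: "i \<in> {1..r}" for i
  proof -
    have q: "CARD('k) ^ k = CARD('k) ^ i \<longleftrightarrow> k = i" for k
      using card_gt_1 by (simp add: power_inject_exp)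
    have "1 \<noteq> CARD('k) ^ i" using q[of 0] i by simp
    hence "Polynomial.coeff P (CARD('k) ^ i) = (\<Sum>k=1..r. if k = i then g k else 0)"
      unfolding g(2) by (simp only: coeff_add coeff_sum Polynomial.coeff_monom q if_False add_0)
    also have "\<dots> = g i" using i by simp
    finally show ?thesis using coeff_in_subfield[OF L inf] by metis
  qed
  thus ?thesis unfolding drinfeld_module_def TT_conv[symmetric] using g by blast
qed

subsection \<open>Torsion points\<close>

lemma E_sum: "E (sum f S) = (\<Sum>i\<in>S. E (f i))"
proof -
  have "E 0 = 0" using E_eq_0_iff[of 0] Lat_0 by simp
  thus ?thesis by (induction S rule: infinite_finite_induct) (auto simp: E_add)
qed

lemma poly_P_power: "poly ((pcompose P ^^ i) [:0, 1:]) (E z) = E (TT ^ i * z)"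
proof (induction i)
  case (Suc i)
  have "poly ((pcompose P ^^ Suc i) [:0, 1:]) (E z) = poly P (poly ((pcompose P ^^ i) [:0, 1:]) (E z))"
    by (simp add: poly_pcompose)
  also have "\<dots> = E (TT * (TT ^ i * z))" unfolding Suc by (simp only: functional_equation)
  finally show ?case by (simp add: mult.assoc)
qed simp

lemma poly_drinfeld_poly: "poly (drinfeld_poly j P a) (E z) = E (emb_A j a * z)"
proof -
  have "poly (drinfeld_poly j P a) (E z) = (\<Sum>i\<le>Polynomial.degree a. sc (Polynomial.coeff a i) * E (TT ^ i * z))"
    by (simp add: drinfeld_poly_def poly_sum poly_P_power sc_def)
  also have "\<dots> = E (\<Sum>i\<le>Polynomial.degree a. sc (Polynomial.coeff a i) * (TT ^ i * z))"
    by (simp add: E_sum E_scalar)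
  also have "(\<Sum>i\<le>Polynomial.degree a. sc (Polynomial.coeff a i) * (TT ^ i * z)) = emb_A j a * z"
    by (simp add: emb_A_altdef sum_distrib_right mult.assoc)
  finally show ?thesis .
qed

lemma degree_drinfeld_poly_le:
  "Polynomial.degree (drinfeld_poly j P a) \<le> CARD('k) ^ (r * Polynomial.degree a)"
  unfolding drinfeld_poly_def
proof (rule degree_sum_le)
  fix i assume i: "i \<in> {..Polynomial.degree a}"
  have "Polynomial.degree ((pcompose P ^^ i) [:0, 1:]) \<le> (CARD('k) ^ r) ^ i"
  proof (induction i)
    case (Suc i)
    thus ?case using degree_P_le by (simp add: degree_pcompose mult_le_mono)
  qed simp
  also have "\<dots> = CARD('k) ^ (r * i)" by (simp add: power_mult)
  also have "\<dots> \<le> CARD('k) ^ (r * Polynomial.degree a)"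
    using card_gt_1 i by (intro power_increasing mult_le_mono2) auto
  finally show "Polynomial.degree (Polynomial.smult (emb_A j [:Polynomial.coeff a i:]) ((pcompose P ^^ i) [:0, 1:]))
      \<le> CARD('k) ^ (r * Polynomial.degree a)"
    using degree_smult_le order_trans by blast
qed simp

lemma absv_lt_1_notin_Lat: "x \<noteq> 0 \<Longrightarrow> absv x < 1 \<Longrightarrow> x \<notin> Lat"
  using absv_Lat_ge_1[of x] by auto

lemma absv_inverse_TT: "absv (inverse TT) < 1"
  unfolding absv_inverse absv_TT using card_gt_1 by (simp add: inverse_less_1_iff)

lemma drinfeld_poly_nonzero:
  assumes "a \<noteq> 0" shows "drinfeld_poly j P a \<noteq> 0"
proof
  assume "drinfeld_poly j P a = 0"
  \<comment> \<open>The test point is E(1/(T a)): the module maps it to E(1/T), which is nonzero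
    because every nonzero period has absolute value at least 1.\<close>
  hence "E (emb_A j a * (inverse TT / emb_A j a)) = 0"
    using poly_drinfeld_poly[of a "inverse TT / emb_A j a"] by simp
  moreover have "emb_A j a * (inverse TT / emb_A j a) = inverse TT" using assms by simp
  ultimately have "inverse TT \<in> Lat" by (simp only: E_eq_0_iff)
  thus False using absv_lt_1_notin_Lat[OF _ absv_inverse_TT] by simp
qed

text \<open>
  All roots of \<open>\<phi>\<^sub>a\<close> are found by counting: its degree is at most the number of points \<open>e(v/a)\<close> where the
  coordinates of \<open>v\<close> have degree less than that of \<open>a\<close>.
\<close>

lemma torsion_eq: "torsion j P = {E (v / emb_A j a) |a v. a \<noteq> 0 \<and> v \<in> Lat}"
proof (intro equalityI subsetI)
  fix x assume "x \<in> torsion j P"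
  then obtain a where a: "a \<noteq> 0" "poly (drinfeld_poly j P a) x = 0" by (auto simp: torsion_def)
  let ?R = "{x. poly (drinfeld_poly j P a) x = 0}" and ?d = "Polynomial.degree a"
  let ?S = "(\<lambda>v. E (v / emb_A j a)) ` cbox ?d"
  have fin: "finite ?R" by (rule poly_roots_finite[OF drinfeld_poly_nonzero[OF a(1)]])
  have "?S \<subseteq> ?R"
    using a by (auto simp: poly_drinfeld_poly E_eq_0_iff intro: subsetD[OF box_subset_Lat])
  moreover have "inj_on (\<lambda>v. E (v / emb_A j a)) (cbox ?d)"
  proof (rule inj_onI)
    fix v v' assume v: "v \<in> cbox ?d" "v' \<in> cbox ?d" and "E (v / emb_A j a) = E (v' / emb_A j a)"
    hence "(v - v') / emb_A j a \<in> Lat" by (simp add: E_eq_iff diff_divide_distrib)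
    then obtain c where "(v - v') / emb_A j a = comb c" by (auto simp: Lat_def)
    hence c: "v - v' = comb (\<lambda>i. a * c i)" using a(1) by (simp add: comb_mult field_simps)
    have "v - v' \<in> cbox ?d" by (intro fq_subspaceD(5)[OF fq_subspace_box] v)
    then obtain e where e: "v - v' = comb e" "\<And>i. i < r \<Longrightarrow> e i \<in> bounded_polys ?d"
      by (auto simp: box_def)
    have "e i = 0" if i: "i < r" for i
    proof -
      have "e i = a * c i" using comb_eqD[of e "\<lambda>i. a * c i" i] c e(1) i by simp
      thus ?thesis using e(2)[OF i] a(1)
        by (cases "c i = 0") (auto simp: bounded_polys_iff_degree degree_mult_eq)
    qed
    hence "v - v' = 0" unfolding e(1) using comb_cong[of e "\<lambda>_. 0"] by simp
    thus "v = v'" by simp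
  qed
  hence "card ?S = CARD('k) ^ (r * ?d)" by (simp add: card_image card_cbox)
  moreover have "card ?R \<le> CARD('k) ^ (r * ?d)"
    using card_poly_roots_bound[OF drinfeld_poly_nonzero[OF a(1)]] degree_drinfeld_poly_le[of a] by simp
  ultimately have "?S = ?R" using card_seteq[OF fin] by simp
  then obtain v where "v \<in> cbox ?d" "x = E (v / emb_A j a)" using a(2) by blast
  thus "x \<in> {E (v / emb_A j a) |a v. a \<noteq> 0 \<and> v \<in> Lat}" using a(1) box_subset_Lat by blast
next
  fix x assume "x \<in> {E (v / emb_A j a) |a v. a \<noteq> 0 \<and> v \<in> Lat}"
  then obtain a v where "x = E (v / emb_A j a)" "a \<noteq> 0" "v \<in> Lat" by blast
  thus "x \<in> torsion j P" unfolding torsion_def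
    by (auto simp: poly_drinfeld_poly E_eq_0_iff intro!: exI[of _ a])
qed

lemma E_in_closed_subfield:
  assumes "subfield M RC" "closed M" "Lat \<subseteq> M" "z \<in> M"
  shows "E z \<in> M"
proof -
  have "(\<lambda>m. fexp (cbox m) z) \<longlonglongrightarrow> E z" by (rule fexp_box_tendsto) auto
  moreover have "fexp (cbox m) z \<in> M" for m
    using box_subset_Lat assms by (intro fexp_in_subfield) auto
  ultimately show ?thesis by (rule closed_C_limit[OF assms(2), rotated])
qed

lemma torsion_subset:
  assumes "subfield M RC" "closed M" "Lat \<subseteq> M" "K_inf j \<subseteq> M"
  shows "torsion j P \<subseteq> M"
proof
  fix x assume "x \<in> torsion j P"
  then obtain a v where x: "x = E (v / emb_A j a)" "v \<in> Lat" unfolding torsion_eq by blast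
  show "x \<in> M" unfolding x
    by (rule E_in_closed_subfield[OF assms(1-3)], rule subfieldD(8)[OF assms(1)])
       (use x assms emb_A_in_K_inf in blast)+
qed

lemma Lat_subset_of_torsion:
  assumes M: "subfield M RC" "closed M" "torsion j P \<subseteq> M" "K_inf j \<subseteq> M"
  shows "Lat \<subseteq> M"
proof
  fix v assume v: "v \<in> Lat"
  let ?q = "real CARD('k)"
  define f where "f m = TT ^ m * E (v / TT ^ m)" for m
  have "f m \<in> M" for m
  proof -
    have "emb_A j ([:0, 1:] ^ m) = TT ^ m" by (simp add: emb_A_power TT_def)
    hence "E (v / TT ^ m) \<in> torsion j P" unfolding torsion_eq using v
      by (intro CollectI exI[of _ "[:0, 1:] ^ m"] exI[of _ v]) simp
    thus ?thesis unfolding f_def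
      using M TT_in_K_inf by (intro subfieldD(4)[OF M(1)] subfield_power[OF M(1)]) auto
  qed
  moreover have "f \<longlonglongrightarrow> v"
    unfolding C_tendsto_iff
  proof (rule Lim_null_comparison)
    have q1: "?q > 1" using card_gt_1 by simp
    obtain N where N: "absv v < ?q ^ N" using real_arch_pow[OF q1] by blast
    show "\<forall>\<^sub>F m in sequentially. norm (absv (f m - v)) \<le> absv v ^ 2 * inverse ?q ^ m"
      using eventually_ge_at_top[of N]
    proof eventually_elim
      case (elim m)
      have "?q ^ N \<le> ?q ^ m" using q1 elim by (intro power_increasing) auto
      hence "absv v \<le> ?q ^ m" using N by linarith
      hence "absv (v / TT ^ m) \<le> 1" using q1 by (simp add: absv_divide absv_power absv_TT)
      \<comment> \<open>At z = v / T^m the value E z differs from z by at most |z|^2; after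
        multiplication by |T^m| = q^m the error is |v|^2 q^(-m).\<close>
      note c = E_close[OF this]
      have "f m - v = TT ^ m * (E (v / TT ^ m) - v / TT ^ m)"
        by (simp add: f_def right_diff_distrib)
      hence "absv (f m - v) = ?q ^ m * absv (E (v / TT ^ m) - v / TT ^ m)"
        by (simp add: absv_mult absv_power absv_TT)
      also have "\<dots> \<le> ?q ^ m * (absv (v / TT ^ m) * absv (v / TT ^ m))"
        using c by (intro mult_left_mono) auto
      also have "\<dots> = absv v ^ 2 * inverse ?q ^ m"
        using q1 by (simp add: absv_divide absv_power absv_TT power2_eq_square field_simps)
      finally show ?case by simp
    qed
    have "(\<lambda>m. inverse ?q ^ m) \<longlonglongrightarrow> 0"
      using q1 by (intro LIMSEQ_realpow_zero) (auto simp: field_simps)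
    from tendsto_mult[OF tendsto_const[of "absv v ^ 2"] this]
    show "(\<lambda>m. absv v ^ 2 * inverse ?q ^ m) \<longlonglongrightarrow> 0" by simp
  qed
  ultimately show "v \<in> M" by (rule closed_C_limit[OF M(2)])
qed

section \<open>Rationality over \<open>L\<close>\<close>

lemma infinite_P_values:
  assumes L: "subfield L RC" "K_inf j \<subseteq> L" and E: "\<And>z. z \<in> L \<Longrightarrow> E z \<in> L"
  shows "infinite {x \<in> L. poly P x \<in> L}"
proof -
  \<comment> \<open>The exponent \<open>Suc n\<close> keeps the arguments below 1 in absolute value.
    Their differences are then too small to be nonzero periods, so the values of E are pairwise
    different.\<close>
  let ?f = "\<lambda>n. E (inverse TT ^ Suc n)"
  have TT: "TT \<in> L" using L TT_in_K_inf by blast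
  have abs: "absv (inverse TT ^ Suc n) < 1" for n
    using absv_inverse_TT unfolding absv_power by (intro power_Suc_less_one) auto
  have "inj ?f"
  proof (rule injI)
    fix m n assume "?f m = ?f n"
    hence "inverse TT ^ Suc m - inverse TT ^ Suc n \<in> Lat" by (simp only: E_eq_iff)
    moreover have "absv (inverse TT ^ Suc m - inverse TT ^ Suc n) < 1"
      using absv_diff[of "inverse TT ^ Suc m" "inverse TT ^ Suc n"] abs[of m] abs[of n] by (simp only: max_def split: if_splits)
    ultimately have "inverse TT ^ Suc m - inverse TT ^ Suc n = 0"
      using absv_lt_1_notin_Lat by blast
    hence "inverse TT ^ Suc m = inverse TT ^ Suc n" by (simp only: right_minus_eq)
    hence "TT ^ Suc m = TT ^ Suc n" by (simp only: power_inverse inverse_eq_iff_eq)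
    hence "real CARD('k) ^ Suc m = real CARD('k) ^ Suc n" by (metis absv_TT absv_power)
    thus "m = n" using card_gt_1 by (subst (asm) power_inject_exp) auto
  qed
  hence "infinite (range ?f)" by (rule range_inj_infinite)
  moreover have "range ?f \<subseteq> {x \<in> L. poly P x \<in> L}"
  proof clarify
    fix n
    have z: "inverse TT ^ Suc n \<in> L" by (intro subfield_power subfieldD(7) L TT)
    have "TT * inverse TT ^ Suc n \<in> L" by (intro subfieldD(4)[OF L(1)] z TT)
    thus "E (inverse TT ^ Suc n) \<in> L \<and> poly P (E (inverse TT ^ Suc n)) \<in> L"
      unfolding functional_equation[symmetric] using E z by blast
  qed
  ultimately show ?thesis using finite_subset by blast
qed

lemma comb_split: "comb a = comb (a(0 := 0)) + emb_A j (a 0) * b 0"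
proof -
  have "comb a = emb_A j (a 0) * b 0 + (\<Sum>i\<in>{..<r} - {0}. emb_A j (a i) * b i)"
    unfolding comb_def using r_pos by (subst sum.remove[of _ 0]) auto
  also have "(\<Sum>i\<in>{..<r} - {0}. emb_A j (a i) * b i) = (\<Sum>i\<in>{..<r} - {0}. emb_A j ((a(0 := 0)) i) * b i)"
    by (intro sum.cong) auto
  also have "\<dots> = comb (a(0 := 0))"
    unfolding comb_def using r_pos by (subst (2) sum.remove[of _ 0]) auto
  finally show ?thesis by (simp add: add.commute)
qed

text \<open>With d 0 = 0 the coordinate of b 0 = 1 is empty, and adding elements of A fills exactly
  this coordinate.\<close>

lemma direct_sum_box:
  assumes b0: "b 0 = 1" and d0: "d 0 = 0"
  shows "inj_on (\<lambda>(u, v). u + v) (box d \<times> AA M)"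
    "(\<lambda>(u, v). u + v) ` (box d \<times> AA M) = box (d(0 := M))"
proof -
  have elem: "\<exists>a. u = comb a \<and> a 0 = 0 \<and> (\<forall>i<r. a i \<in> bounded_polys (d i))" if u: "u \<in> box d" for u
  proof -
    obtain a where a: "u = comb a" "\<forall>i<r. a i \<in> bounded_polys (d i)" using u by (auto simp: box_def)
    moreover have "a 0 = 0" using a(2) r_pos d0 by (auto simp: bounded_polys_0)
    ultimately show ?thesis by blast
  qed
  have plus: "comb a + emb_A j c = comb (a(0 := c))" if "a 0 = 0" for a c
    using comb_split[of "a(0 := c)"] that b0 by (simp add: fun_upd_idem)
  show "inj_on (\<lambda>(u, v). u + v) (box d \<times> AA M)"
  proof (rule inj_onI, clarsimp)
    fix u v u' v' assume u: "u \<in> box d" "u' \<in> box d" and v: "v \<in> AA M" "v' \<in> AA M" and eq: "u + v = u' + v'"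
    obtain a a' where a: "u = comb a" "u' = comb a'" "a 0 = 0" "a' 0 = 0" using elem[OF u(1)] elem[OF u(2)] by blast
    obtain c c' where c: "v = emb_A j c" "v' = emb_A j c'" using v unfolding AA_def by blast
    have "comb (a(0 := c)) = comb (a'(0 := c'))" using eq plus a c by metis
    from comb_eqD[OF this r_pos] have "c = c'" by simp
    thus "u = u' \<and> v = v'" using eq c by simp
  qed
  show "(\<lambda>(u, v). u + v) ` (box d \<times> AA M) = box (d(0 := M))"
  proof (intro equalityI subsetI)
    fix x assume "x \<in> (\<lambda>(u, v). u + v) ` (box d \<times> AA M)"
    then obtain u v where uv: "x = u + v" "u \<in> box d" "v \<in> AA M" by auto
    obtain a where a: "u = comb a" "a 0 = 0" "\<forall>i<r. a i \<in> bounded_polys (d i)" using elem[OF uv(2)] by blast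
    obtain c where c: "v = emb_A j c" "c \<in> bounded_polys M" using uv(3) unfolding AA_def by blast
    show "x \<in> box (d(0 := M))" unfolding uv(1) a(1) c(1) plus[of a c, OF a(2)]
      by (rule combI_box) (use a c in auto)
  next
    fix x assume "x \<in> box (d(0 := M))"
    then obtain a where a: "x = comb a" "\<And>i. i < r \<Longrightarrow> a i \<in> bounded_polys ((d(0 := M)) i)"
      by (auto simp: box_def)
    have "comb (a(0 := 0)) \<in> box d"
    proof (rule combI_box)
      fix i assume "i < r"
      thus "(a(0 := 0)) i \<in> bounded_polys (d i)" using a(2)[of i] by (cases "i = 0") auto
    qed
    moreover have "emb_A j (a 0) \<in> AA M" using a(2)[OF r_pos] by (auto intro: AA_I)
    moreover have "x = comb (a(0 := 0)) + emb_A j (a 0)" using comb_split[of a] a(1) b0 by simp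
    ultimately show "x \<in> (\<lambda>(u, v). u + v) ` (box d \<times> AA M)" by (auto intro!: image_eqI)
  qed
qed

text \<open>Each finite product is grouped by cosets of V = \<open>AA (N + m)\<close>. A coset
  representative u combines the b i with i > 0 only, so \<open>fexp V u\<close> lies in L by
  additivity and \<open>vanishing_AA_mult_in\<close>. Thus all finite products lie in L, and L is
  closed.\<close>

lemma E_in_L:
  assumes L: "subfield L RC" "closed L" "K_inf j \<subseteq> L" and b0: "b 0 = 1"
    and b: "\<And>i. 0 < i \<Longrightarrow> i < r \<Longrightarrow> vanishing (AA N) (b i) \<in> L" and z: "z \<in> L"
  shows "E z \<in> L"
proof (rule closed_C_limit[OF L(2)])
  \<comment> \<open>\<open>?d'\<close> describes the coset representatives, \<open>?d\<close> the
    full box. Coefficients of degree < m need the index N + m before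
    \<open>vanishing_AA_mult_in\<close> applies, hence the bound in coordinate 0.\<close>
  let ?d' = "\<lambda>m i::nat. if i = 0 then 0 else m"
  let ?d = "\<lambda>m. (?d' m)(0 := N + m)"
  show "(\<lambda>m. fexp (box (?d m)) z) \<longlonglongrightarrow> E z" by (rule fexp_box_tendsto) auto
  fix m
  let ?V = "AA (N + m)"
  have VL: "?V \<subseteq> L" using AA_subset_K_inf L(3) by blast
  have "fexp ?V u \<in> L" if u: "u \<in> box (?d' m)" for u
  proof -
    obtain a where a: "u = comb a" "\<And>i. i < r \<Longrightarrow> a i \<in> bounded_polys (?d' m i)"
      using u by (auto simp: box_def)
    have "vanishing ?V (emb_A j (a i) * b i) \<in> L" if "i < r" for i
    proof (cases "i = 0")
      case True
      hence "emb_A j (a i) * b i = 0" using a(2)[OF that] by (simp add: bounded_polys_0)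
      hence "vanishing ?V (emb_A j (a i) * b i) = vanishing ?V 0" by (simp only:)
      also have "\<dots> = 0" using fq_subspaceD(1)[OF fq_subspace_AA] by (simp add: vanishing_eq_0_iff)
      finally have "vanishing ?V (emb_A j (a i) * b i) = 0" .
      thus ?thesis using subfieldD(1)[OF L(1)] by simp
    next
      case False
      thus ?thesis using a(2)[OF that] that
        by (intro vanishing_AA_mult_in[OF L(1,3) b[of i], of _ m]) auto
    qed
    hence "vanishing ?V u \<in> L"
      unfolding a(1) comb_def vanishing_sum[OF finite_AA fq_subspace_AA]
      by (intro subfield_sum[OF L(1)]) auto
    moreover have "(\<Prod>v\<in>?V - {0}. - v) \<in> L"
      using VL subfieldD(5)[OF L(1)] by (intro subfield_prod[OF L(1)]) auto
    ultimately show ?thesis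
      unfolding fexp_conv_vanishing[OF finite_AA fq_subspaceD(1)[OF fq_subspace_AA]]
      by (intro subfieldD(8)[OF L(1)])
  qed
  moreover have zV: "fexp ?V z \<in> L" by (rule fexp_in_subfield[OF L(1) VL z])
  moreover have "fexp (box (?d m)) z = fexp ?V z * (\<Prod>u\<in>box (?d' m) - {0}. 1 - fexp ?V z / fexp ?V u)"
    using fexp_direct_sum[OF finite_AA fq_subspace_AA finite_box fq_subspaceD(1)[OF fq_subspace_box]
        direct_sum_box(1)[OF b0, of "?d' m" "N + m"], of z]
    unfolding direct_sum_box(2)[OF b0, of "?d' m" "N + m", simplified] by simp
  ultimately show "fexp (box (?d m)) z \<in> L"
    using subfieldD(2)[OF L(1)]
    by (simp only:) (intro subfieldD(4)[OF L(1)] subfield_prod[OF L(1)] subfieldD(6)[OF L(1)] subfieldD(8)[OF L(1)], auto)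
qed

end

subsection \<open>The construction\<close>

context completed_alg_closure begin

text \<open>Every nonzero |a k| is a value of L, so the nonzero terms of a lattice vector inherit
  the distinct classes of the basis and cannot cancel.\<close>

lemma lattice_basisI:
  assumes L: "subfield L RC" "K_inf j \<subseteq> L" and "r > 0" and b1: "\<And>i. i < r \<Longrightarrow> absv (b i) \<ge> 1"
    and cl: "\<And>i k. i < k \<Longrightarrow> k < r \<Longrightarrow> absv (b k) / absv (b i) \<notin> absv_group L"
  shows "lattice_basis j b r"
proof
  fix a :: "nat \<Rightarrow> 'k poly" and i assume i: "i < r"
  let ?f = "\<lambda>k. emb_A j (a k) * b k"
  have ne: "absv (?f i) \<noteq> absv (?f k)" if "i < k" "k < r" "?f i \<noteq> 0" "?f k \<noteq> 0" for i k
  proof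
    assume "absv (?f i) = absv (?f k)"
    hence "absv (b k) / absv (b i) = absv (emb_A j (a i)) / absv (emb_A j (a k))"
      using that by (simp add: absv_mult field_simps)
    moreover have "absv (emb_A j (a l)) \<in> absv_group L" if "emb_A j (a l) \<noteq> 0" for l
      using that L(2) emb_A_in_K_inf[of "a l"] by (auto simp: absv_group_def)
    ultimately show False using cl[OF that(1,2)] that absv_groupD(3)[OF L(1)] by auto
  qed
  show "absv (?f i) \<le> absv (\<Sum>k<r. ?f k)"
  proof (rule absv_le_absv_sum_distinct)
    fix i k assume "i \<in> {..<r}" "k \<in> {..<r}" "i \<noteq> k" "?f i \<noteq> 0" "?f k \<noteq> 0"
    thus "absv (?f i) \<noteq> absv (?f k)" using ne[of i k] ne[of k i] by (cases "i < k") auto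
  qed (use i in auto)
qed (use assms in auto)

lemma exists_highly_ramified:
  assumes fe: "finite_extension (K_inf j) L" and r: "r \<ge> 2"
  shows "\<exists>P \<Lambda>. drinfeld_module j L r P \<and> period_lattice j r P \<Lambda> \<and>
            adjoin L \<Lambda> = adjoin L (torsion j P) \<and>
            finite_extension L (adjoin L \<Lambda>) \<and>
            ramification_index L (adjoin L \<Lambda>) \<ge> N"
proof -
  let ?q = "CARD('k)" and ?p = "CHAR('k)"
  have L: "subfield L RC" "K_inf j \<subseteq> L" using fe by (auto simp: finite_extension_def)
  have clL: "closed L"
    using closed_finite_dimension[OF subfield_K_inf closed_K_inf] fe by (simp add: finite_extension_def)
  note G = absv_groupD[OF L(1)]
  obtain e where e: "?q = ?p ^ e" using CARD_eq_CHAR_power by blast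
  have e0: "e > 0" using e card_gt_1 by (intro gr0I) auto
  have p1: "?p > 1" by (rule prime_gt_1_nat[OF prime_CHAR])
  define M where "M = N + r"
  \<comment> \<open>This is the threshold of \<open>absv_vanishing_AA_root\<close> for the index M =
    N + r. The threshold grows with the index, so one c above it serves every index N + i with i <
    r.\<close>
  define B where "B = (real ?q ^ M) ^ (?q ^ M)"
  obtain c where c: "c \<in> L" "absv c > B" "\<And>x. x \<in> absv_group L \<Longrightarrow> absv c \<noteq> x ^ ?p"
    using exists_large_non_pth_power[OF fe p1, of B] by blast
  have B0: "B \<ge> 0" by (simp add: B_def)
  have cG: "absv c \<in> absv_group L" using c B0 by (auto simp: absv_group_def)
  have "c \<in> range j" using finite_extension_subset_range_j[OF fe] c(1) by blast
  hence "\<forall>i. \<exists>w. vanishing (AA (N + i)) w = c" using exists_vanishing_AA_root by blast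
  then obtain w where w: "\<And>i. vanishing (AA (N + i)) (w i) = c" by metis
  define b where "b i = (if i = 0 then 1 else w i)" for i
  \<comment> \<open>q to the power \<open>\<nu> i\<close> is the order of |b i| modulo
    \<open>absv_group L\<close>, as \<open>order\<close> and \<open>bG\<close> show; the value at 0
    reflects b 0 = 1.\<close>
  define \<nu> where "\<nu> i = (if i = 0 then 0 else N + i)" for i
  have absw: "absv (w i) > 1" "absv (w i) ^ (?q ^ (N + i)) = absv c" if "i < r" for i
  proof -
    have q1: "real ?q \<ge> 1" using card_gt_1 by simp
    have "(real ?q ^ (N + i)) ^ (?q ^ (N + i)) \<le> (real ?q ^ M) ^ (?q ^ (N + i))"
      using that q1 by (intro power_mono power_increasing) (auto simp: M_def)
    also have "\<dots> \<le> B" unfolding B_def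
      using that q1 card_gt_1 by (intro power_increasing one_le_power) (auto simp: M_def)
    also have "\<dots> < absv (vanishing (AA (N + i)) (w i))" using c(2) by (simp add: w)
    finally have *: "(real ?q ^ (N + i)) ^ (?q ^ (N + i)) < absv (vanishing (AA (N + i)) (w i))" .
    show "absv (w i) > 1" "absv (w i) ^ (?q ^ (N + i)) = absv c"
      using absv_vanishing_AA_root[OF *] by (simp_all add: w)
  qed
  have order: "?q ^ \<nu> i dvd k" if "i < r" "absv (b i) ^ k \<in> absv_group L" for i k
  proof (cases "i = 0")
    case False
    have qp: "?q ^ (N + i) = ?p ^ (e * (N + i))" by (simp add: e power_mult)
    have "?p ^ (e * (N + i)) dvd k"
    proof (rule prime_power_dvd_of_power_in_group[of "absv_group L" ?p "absv (w i)"])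
      show "absv (w i) ^ ?p ^ (e * (N + i)) \<in> absv_group L"
        using absw(2)[OF that(1)] cG by (simp flip: qp)
      show "absv (w i) ^ ?p ^ (e * (N + i)) \<noteq> g ^ ?p" if "g \<in> absv_group L" for g
        using absw(2)[OF \<open>i < r\<close>] c(3)[OF that] by (simp flip: qp)
      show "absv (w i) ^ k \<in> absv_group L" using that False by (simp add: b_def)
    qed (use G prime_CHAR absw(1)[OF that(1)] in auto)
    thus ?thesis using False by (simp add: \<nu>_def qp)
  qed (simp add: \<nu>_def)
  have bG: "absv (b i) ^ (?q ^ \<nu> i) \<in> absv_group L" if "i < r" for i
    using absw(2)[OF that] cG G(1) by (simp add: b_def \<nu>_def)
  have b1: "absv (b i) \<ge> 1" if "i < r" for i
    using absw(1)[OF that] by (simp add: b_def)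
  have "lattice_basis j b r"
  proof (rule lattice_basisI[OF L])
    fix i k assume ik: "i < k" "k < r"
    show "absv (b k) / absv (b i) \<notin> absv_group L"
    proof
      assume g: "absv (b k) / absv (b i) \<in> absv_group L"
      \<comment> \<open>This power kills the class of b i, hence also that of b k. The order of |b
        k| would then divide that of |b i|, although \<open>\<nu>\<close> is strictly
        increasing.\<close>
      have "absv (b k) ^ (?q ^ \<nu> i) = (absv (b k) / absv (b i)) ^ (?q ^ \<nu> i) * absv (b i) ^ (?q ^ \<nu> i)"
      proof -
        have "b i \<noteq> 0" using b1[of i] ik by (intro notI) simp
        thus ?thesis by (simp add: power_divide)
      qed
      also have "\<dots> \<in> absv_group L" using ik by (intro G(2) absv_group_power L g bG) auto
      finally have "?q ^ \<nu> k dvd ?q ^ \<nu> i" using order ik by blast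
      hence "\<nu> k \<le> \<nu> i" using card_gt_1 by (simp add: dvd_power_iff_le)
      thus False using ik by (auto simp: \<nu>_def split: if_splits)
    qed
  qed (use r b1 in auto)
  then interpret lattice_basis j b r .
  have EL: "E z \<in> L" if "z \<in> L" for z
  proof (rule E_in_L[OF L(1) clL L(2) _ _ that])
    fix i assume i: "0 < i" "i < r"
    \<comment> \<open>One index has to work for all basis vectors; membership in L persists from N +
      i up to M.\<close>
    show "vanishing (AA M) (b i) \<in> L"
      by (rule vanishing_AA_mono_in[OF L, of "N + i"]) (use i c w in \<open>auto simp: M_def b_def\<close>)
  qed (simp add: b_def)
  let ?M = "adjoin L Lat"
  have feM: "finite_extension L ?M"
  proof (rule finite_extension_adjoin[OF L(1), of "map w [1..<r]"])
    fix x assume "x \<in> set (map w [1..<r])"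
    then obtain i where "x = w i" by auto
    thus "(RC.algebraic over L) x"
      using algebraic_vanishing_AA[OF L, of "N + i" "w i"] w c(1) by simp
  next
    fix M' assume M': "subfield M' RC" "L \<subseteq> M'" "set (map w [1..<r]) \<subseteq> M'"
    have "b i \<in> M'" if "i < r" for i
      using M'(3) that subfieldD(2)[OF M'(1)] by (auto simp: b_def)
    moreover have "emb_A j a \<in> M'" for a using emb_A_in_K_inf L M' by blast
    ultimately show "Lat \<subseteq> M'"
      by (auto simp: Lat_def comb_def intro!: subfield_sum[OF M'(1)] subfieldD(4)[OF M'(1)])
  qed
  have M: "subfield ?M RC" "L \<subseteq> ?M" "Lat \<subseteq> ?M" "RC.finite_dimension L ?M"
    using subfield_adjoin adjoin_supset[of L Lat] feM by (auto simp: finite_extension_def)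
  have clM: "closed ?M" by (rule closed_finite_dimension[OF L(1) clL M(4)])
  have tor: "torsion j P \<subseteq> ?M" by (rule torsion_subset[OF M(1) clM M(3)]) (use L M in blast)
  let ?M' = "adjoin L (torsion j P)"
  have M': "subfield ?M' RC" "L \<subseteq> ?M'" "torsion j P \<subseteq> ?M'" "?M' \<subseteq> ?M"
    using subfield_adjoin adjoin_supset[of L "torsion j P"] adjoin_minimal[OF M(1,2) tor] by auto
  \<comment> \<open>As a subspace of the field of periods, the torsion field is finite over L and
    therefore closed, so it contains the periods as limits of its elements.\<close>
  have "closed ?M'"
    by (rule closed_finite_dimension[OF L(1) clL finite_dimension_subfield[OF L(1) M(4) M'(1,2,4)]])
  hence "Lat \<subseteq> ?M'" by (rule Lat_subset_of_torsion[OF M'(1) _ M'(3)]) (use L M' in blast)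
  hence eq: "?M = ?M'" using M' adjoin_minimal[OF M'(1,2)] by blast
  have "N \<le> ?q ^ \<nu> 1"
  proof -
    have "N < ?q ^ N" using card_gt_1 by (intro power_gt_expt) simp
    also have "\<dots> \<le> ?q ^ \<nu> 1" using card_gt_1 by (intro power_increasing) (auto simp: \<nu>_def)
    finally show ?thesis by simp
  qed
  also have "\<dots> \<le> ramification_index L ?M"
  proof (rule ramification_index_ge[OF feM])
    have "b 1 = comb (\<lambda>i. if i = 1 then 1 else 0)"
    proof -
      have "comb (\<lambda>i. if i = 1 then 1 else 0) = (\<Sum>i<r. if i = 1 then b i else 0)"
        unfolding comb_def by (intro sum.cong) auto
      thus ?thesis using r by simp
    qed
    thus "b 1 \<in> ?M" using M(3) by (auto simp: Lat_def)
    show "b 1 \<noteq> 0" using b1[of 1] r by auto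
    fix k assume k: "0 < k" "k < ?q ^ \<nu> 1"
    show "absv (b 1) ^ k \<notin> absv_group L"
      using order[of 1 k] r k nat_dvd_not_less by auto
  qed
  finally have "N \<le> ramification_index L ?M" .
  moreover have "drinfeld_module j L r P"
    by (rule drinfeld_module_P[OF L(1) infinite_P_values[OF L EL]])
  ultimately show ?thesis using period_lattice_Lat eq feM by blast
qed

end

theorem theorem3p6:
  fixes j :: "'k::{field,finite} fls alg_closure \<Rightarrow> 'c::{field,complete_space}"
    and L :: "'c set" and r :: nat
  assumes "completed_alg_closure j"
    and "finite_extension (K_inf j) L"
    and "r \<ge> 2"
  shows "(\<forall>N::nat. \<exists>P \<Lambda>. drinfeld_module j L r P \<and> period_lattice j r P \<Lambda> \<and>
            adjoin L \<Lambda> = adjoin L (torsion j P) \<and>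
            finite_extension L (adjoin L \<Lambda>) \<and>
            ramification_index L (adjoin L \<Lambda>) \<ge> N) \<and>
         (\<forall>N::nat. \<exists>P \<Lambda>. drinfeld_module j L r P \<and> period_lattice j r P \<Lambda> \<and>
            finite_extension L (adjoin L \<Lambda>) \<and>
            ext_degree L (adjoin L \<Lambda>) \<ge> N)"
proof -
  interpret completed_alg_closure j by fact
  note ram = exists_highly_ramified[OF assms(2,3)]
  show ?thesis
  proof (intro conjI allI)
    fix N
    show "\<exists>P \<Lambda>. drinfeld_module j L r P \<and> period_lattice j r P \<Lambda> \<and>
            finite_extension L (adjoin L \<Lambda>) \<and> ext_degree L (adjoin L \<Lambda>) \<ge> N"
      using ram[of N] ramification_index_le_ext_degree order_trans by meson
  qed (rule ram)
qed

end
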